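(* Let $\mathcal{M}=G/H$ be a reductive homogeneous space with reductive complement $\mathfrak{m}$, let $c_0\in\mathcal{M}$, and let $\omega\colon T\mathcal{M}\to\mathfrak{g}$ be the $\mathfrak{g}$-valued $1$-form on $\mathcal{M}$ determined by $\mathfrak{m}$, with $\theta_\omega\colon C^\infty(I,T\mathcal{M})\to C^\infty(I,\mathfrak{g})$, $f\mapsto\omega\circ f$. Then $\alpha=\theta_\omega$ satisfies (1) $\rho_{c_0}\circ\alpha\circ D=\mathrm{id}_{C^\infty_{c_0}(I,\mathcal{M})}$ and (2) $\alpha\circ D(\mathcal{P}_{c_0})\subseteq C^\infty(I,\mathfrak{g}\setminus\{0\})$, whence for a reductive homogeneous space one can define the square root velocity transform as $$\mathcal{R}(c):=\frac{\theta_\omega(\dot c)}{\sqrt{\|\theta_\omega(\dot c)\|}}\quad\text{for }c\in\mathrm{Imm}(I,\mathcal{M}).$$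
   Context: $G$ is a finite-dimensional Lie group with identity $e$ and Lie algebra $\mathfrak{g}=T_eG$; $H\subseteq G$ is a closed Lie subgroup with Lie algebra $\mathfrak{h}$; $\mathcal{M}=G/H$ carries the manifold structure making $\pi\colon G\to G/H$, $g\mapsto gH$, a submersion. $\Lambda\colon G\times\mathcal{M}\to\mathcal{M}$, $(g,kH)\mapsto(gk)H$, with $\Lambda_{c_0}(g)=\Lambda^g(c_0)=\Lambda(g,c_0)$. $I=[0,1]$; $C^\infty_{c_0}(I,\mathcal{M})$ is the set of smooth curves $c\colon I\to\mathcal{M}$ with $c(0)=c_0$; $\mathrm{Imm}(I,\mathcal{M})$ is the set of smooth curves in $\mathcal{M}$ with nowhere vanishing derivative; $\mathcal{P}_{c_0}=\mathrm{Imm}(I,\mathcal{M})\cap C^\infty_{c_0}(I,\mathcal{M})$; $D(c)=\dot c$. $\mathcal{M}$ is reductive: $\mathfrak{m}\subseteq\mathfrak{g}$ is a fixed vector subspace with $\mathfrak{g}=\mathfrak{h}\oplus\mathfrak{m}$ and $\mathrm{Ad}(h).\mathfrak{m}\subseteq\mathfrak{m}$ for all $h\in H$ (a reductive complement). Let $\omega_e\colon T_{eH}\mathcal{M}\to\mathfrak{m}$ be the inverse of the isomorphism $T_e\pi|_{\mathfrak{m}}\colon\mathfrak{m}\to T_{eH}\mathcal{M}$. The $1$-form is $\omega(v)=\mathrm{Ad}(g).\omega_e(T\Lambda^{g^{-1}}(v))$ for $v\in T_{gH}\mathcal{M}$; it is well defined (independent of the representative $g$ of $gH$). $\mathrm{Evol}\colon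 C^\infty(I,\mathfrak{g})\to\{g\in C^\infty(I,G): g(0)=e\}$ sends $q$ to the solution $g$ of $\dot g(t)=T_eR_{g(t)}(q(t))$, $g(0)=e$, where $R_g$ is right multiplication by $g$. $\rho_{c_0}\colon C^\infty(I,\mathfrak{g})\to C^\infty_{c_0}(I,\mathcal{M})$ is $\rho_{c_0}(q)(t)=\Lambda_{c_0}(\mathrm{Evol}(q)(t))$. $\|\cdot\|$ is the norm on $\mathfrak{g}$ of a fixed inner product coming from a right invariant Riemannian metric on $G$. In general, the square root velocity transform on $\mathcal{M}$ at $c_0$ with respect to a smooth map $\alpha\colon C^\infty(I,T\mathcal{M})\to C^\infty(I,\mathfrak{g})$ satisfying (1) and (2) is $\mathcal{P}_{c_0}\to C^\infty(I,\mathfrak{g}\setminus\{0\})$, $c\mapsto\alpha(\dot c)/\sqrt{\|\alpha(\dot c)\|}$. *)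

theory Defs
  imports "HOL-Analysis.Analysis" "HOL-Algebra.Coset" "HOL-Algebra.Left_Coset"
begin

section \<open>Smooth maps between subsets of Euclidean spaces\<close>

primrec Ck_on :: "nat \<Rightarrow> 'a::euclidean_space set \<Rightarrow> ('a \<Rightarrow> 'b::euclidean_space) \<Rightarrow> bool" where
  "Ck_on 0 U f \<longleftrightarrow> continuous_on U f"
| "Ck_on (Suc k) U f \<longleftrightarrow> (\<forall>x\<in>U. f differentiable (at x)) \<and>
     (\<forall>v. Ck_on k U (\<lambda>x. frechet_derivative f (at x) v))"

text \<open>
  On a set that need not be open (a compact interval, a relatively open subset of a linear
  subspace), smooth means that locally there is a smooth extension to an open set.
\<close>

definition smooth_on :: "'a::euclidean_space set \<Rightarrow> ('a \<Rightarrow> 'b::euclidean_space) \<Rightarrow> bool" where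
  "smooth_on S f \<longleftrightarrow> (\<forall>x\<in>S. \<exists>U F. open U \<and> x \<in> U \<and> (\<forall>k. Ck_on k U F) \<and> (\<forall>y\<in>S \<inter> U. F y = f y))"


section \<open>Finite-dimensional smooth manifolds\<close>

text \<open>
  A manifold is modelled on a linear subspace of a Euclidean space rather than on the whole
  space. The dimension is then not tied to the type (all finite dimensions, including \<open>0\<close>, occur,
  which is needed for quotients). A chart is a pair of its domain and its coordinate map.
  The topology is the one induced by the atlas. Manifolds are Hausdorff, and second countability
  is not required.
\<close>

type_synonym ('p, 'e) chart = "'p set \<times> ('p \<Rightarrow> 'e)"

record ('p, 'e) manifold =
  model :: "'e set"
  atlas :: "('p, 'e) chart set"

definition points :: "('p, 'e) manifold \<Rightarrow> 'p set" where
  "points X = \<Union> (fst ` atlas X)"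

definition mtop :: "('p, 'e::euclidean_space) manifold \<Rightarrow> 'p topology" where
  "mtop X = topology (\<lambda>W. W \<subseteq> points X \<and>
     (\<forall>(U, \<phi>) \<in> atlas X. openin (top_of_set (model X)) (\<phi> ` (W \<inter> U))))"

definition smooth_manifold :: "('p, 'e::euclidean_space) manifold \<Rightarrow> bool" where
  "smooth_manifold X \<longleftrightarrow>
     subspace (model X) \<and>
     (\<forall>(U, \<phi>) \<in> atlas X. inj_on \<phi> U) \<and>
     (\<forall>(U, \<phi>) \<in> atlas X. \<forall>(W, \<psi>) \<in> atlas X.
        openin (top_of_set (model X)) (\<phi> ` (U \<inter> W)) \<and>
        smooth_on (\<phi> ` (U \<inter> W)) (\<psi> \<circ> inv_into U \<phi>)) \<and>
     Hausdorff_space (mtop X)"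

lemma openin_mtop:
  assumes "smooth_manifold X"
  shows "openin (mtop X) W \<longleftrightarrow> W \<subseteq> points X \<and>
     (\<forall>(U, \<phi>) \<in> atlas X. openin (top_of_set (model X)) (\<phi> ` (W \<inter> U)))"
proof -
  let ?L = "\<lambda>W. W \<subseteq> points X \<and>
     (\<forall>(U, \<phi>) \<in> atlas X. openin (top_of_set (model X)) (\<phi> ` (W \<inter> U)))"
  have inj: "inj_on \<phi> U" if "(U, \<phi>) \<in> atlas X" for U \<phi>
    using assms that by (auto simp: smooth_manifold_def)
  have "istopology ?L"
    unfolding istopology_def
  proof (intro conjI allI impI)
    fix S T assume S: "?L S" and T: "?L T"
    show "S \<inter> T \<subseteq> points X" using S by blast
    show "\<forall>(U, \<phi>) \<in> atlas X. openin (top_of_set (model X)) (\<phi> ` (S \<inter> T \<inter> U))"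
    proof clarify
      fix U \<phi> assume U: "(U, \<phi>) \<in> atlas X"
      have "\<phi> ` (S \<inter> T \<inter> U) = \<phi> ` (S \<inter> U) \<inter> \<phi> ` (T \<inter> U)"
        using inj[OF U] by (auto simp: inj_on_def)
      then show "openin (top_of_set (model X)) (\<phi> ` (S \<inter> T \<inter> U))"
        using S T U by (auto intro!: openin_Int)
    qed
  next
    fix \<K> assume K: "\<forall>K\<in>\<K>. ?L K"
    show "\<Union> \<K> \<subseteq> points X" using K by blast
    show "\<forall>(U, \<phi>) \<in> atlas X. openin (top_of_set (model X)) (\<phi> ` (\<Union> \<K> \<inter> U))"
    proof clarify
      fix U \<phi> assume U: "(U, \<phi>) \<in> atlas X"
      have "\<phi> ` (\<Union> \<K> \<inter> U) = (\<Union>K\<in>\<K>. \<phi> ` (K \<inter> U))" by blast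
      then show "openin (top_of_set (model X)) (\<phi> ` (\<Union> \<K> \<inter> U))"
        using K U by (auto intro!: openin_Union)
    qed
  qed
  then show ?thesis by (simp add: mtop_def)
qed

definition smooth_map ::
  "('p, 'e::euclidean_space) manifold \<Rightarrow> ('q, 'f::euclidean_space) manifold \<Rightarrow> ('p \<Rightarrow> 'q) \<Rightarrow> bool"
where
  "smooth_map X Y F \<longleftrightarrow> continuous_map (mtop X) (mtop Y) F \<and>
     (\<forall>(U, \<phi>) \<in> atlas X. \<forall>(W, \<psi>) \<in> atlas Y.
        smooth_on (\<phi> ` (U \<inter> F -` W)) (\<psi> \<circ> F \<circ> inv_into U \<phi>))"

definition smooth_from ::
  "'a::euclidean_space set \<Rightarrow> ('p, 'e::euclidean_space) manifold \<Rightarrow> ('a \<Rightarrow> 'p) \<Rightarrow> bool" where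
  "smooth_from S X f \<longleftrightarrow> continuous_map (top_of_set S) (mtop X) f \<and>
     (\<forall>(U, \<phi>) \<in> atlas X. smooth_on (S \<inter> f -` U) (\<phi> \<circ> f))"

definition prod_manifold ::
  "('p, 'e) manifold \<Rightarrow> ('q, 'f) manifold \<Rightarrow> ('p \<times> 'q, 'e \<times> 'f) manifold" where
  "prod_manifold X Y = \<lparr>model = model X \<times> model Y,
     atlas = {(U \<times> W, map_prod \<phi> \<psi>) | U \<phi> W \<psi>. (U, \<phi>) \<in> atlas X \<and> (W, \<psi>) \<in> atlas Y}\<rparr>"

definition vector_manifold :: "'e set \<Rightarrow> ('e, 'e) manifold" where
  "vector_manifold V = \<lparr>model = V, atlas = {(V, id)}\<rparr>"


section \<open>Tangent vectors\<close>

text \<open>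
  The tangent space of \<open>X\<close> at any point \<open>p\<close> is \<open>model X\<close>: the vector \<open>v\<close> stands for the tangent
  vector at \<open>p\<close> whose coordinates in the preferred chart \<open>chart_at X p\<close> are \<open>v\<close>. Coordinates in
  other charts are obtained with the derivative of the chart change, see \<open>tangent_bundle\<close>.
\<close>

definition chart_at :: "('p, 'e) manifold \<Rightarrow> 'p \<Rightarrow> ('p, 'e) chart" where
  "chart_at X p = (SOME \<kappa>. \<kappa> \<in> atlas X \<and> p \<in> fst \<kappa>)"

definition coord_at :: "('p, 'e) manifold \<Rightarrow> 'p \<Rightarrow> 'p \<Rightarrow> 'e" where
  "coord_at X p = snd (chart_at X p)"

definition param_at :: "('p, 'e) manifold \<Rightarrow> 'p \<Rightarrow> 'e \<Rightarrow> 'p" where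
  "param_at X p = inv_into (fst (chart_at X p)) (coord_at X p)"

text \<open>The derivative of a vector-valued function \<open>f\<close>, defined near \<open>p\<close>, along \<open>v\<close> in the tangent
  space at \<open>p\<close>.\<close>

definition deriv_along ::
  "('p, 'e::euclidean_space) manifold \<Rightarrow> ('p \<Rightarrow> 'f::euclidean_space) \<Rightarrow> 'p \<Rightarrow> 'e \<Rightarrow> 'f" where
  "deriv_along X f p v =
     vector_derivative (\<lambda>s. f (param_at X p (coord_at X p p + s *\<^sub>R v))) (at 0)"

definition tangent_map ::
  "('p, 'e::euclidean_space) manifold \<Rightarrow> ('q, 'f::euclidean_space) manifold \<Rightarrow> ('p \<Rightarrow> 'q) \<Rightarrow>
   'p \<Rightarrow> 'e \<Rightarrow> 'f" where
  "tangent_map X Y F p v = deriv_along X (coord_at Y (F p) \<circ> F) p v"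

definition tangent_bundle ::
  "('p, 'e::euclidean_space) manifold \<Rightarrow> ('p \<times> 'e, 'e \<times> 'e) manifold" where
  "tangent_bundle X = \<lparr>model = model X \<times> model X,
     atlas = {(U \<times> model X, \<lambda>(p, v). (\<phi> p, deriv_along X \<phi> p v)) | U \<phi>. (U, \<phi>) \<in> atlas X}\<rparr>"

definition submersion ::
  "('p, 'e::euclidean_space) manifold \<Rightarrow> ('q, 'f::euclidean_space) manifold \<Rightarrow> ('p \<Rightarrow> 'q) \<Rightarrow> bool"
where
  "submersion X Y F \<longleftrightarrow> smooth_map X Y F \<and>
     (\<forall>p\<in>points X. tangent_map X Y F p ` model X = model Y)"

text \<open>A Riemannian metric is smooth iff its quadratic form is smooth on the tangent bundle,
  by polarization.\<close>

definition riemannian_metric ::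
  "('p, 'e::euclidean_space) manifold \<Rightarrow> ('p \<Rightarrow> 'e \<Rightarrow> 'e \<Rightarrow> real) \<Rightarrow> bool" where
  "riemannian_metric X \<gamma> \<longleftrightarrow>
     (\<forall>p\<in>points X. \<forall>u\<in>model X. \<forall>v\<in>model X. \<forall>w\<in>model X. \<forall>a b.
        \<gamma> p (a *\<^sub>R u + b *\<^sub>R v) w = a * \<gamma> p u w + b * \<gamma> p v w \<and>
        \<gamma> p u v = \<gamma> p v u \<and> (u \<noteq> 0 \<longrightarrow> \<gamma> p u u > 0)) \<and>
     smooth_map (tangent_bundle X) (vector_manifold UNIV) (\<lambda>(p, v). \<gamma> p v v)"


section \<open>Smooth curves on the unit interval\<close>

text \<open>Curves are extensional functions (equal to \<open>undefined\<close> off the unit interval), so that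
  equality of functions is equality of curves.\<close>

definition Cinf :: "('p, 'e::euclidean_space) manifold \<Rightarrow> (real \<Rightarrow> 'p) set" where
  "Cinf X = {c \<in> extensional {0..1}. smooth_from {0..1} X c}"

definition Cinf_at :: "('p, 'e::euclidean_space) manifold \<Rightarrow> 'p \<Rightarrow> (real \<Rightarrow> 'p) set" where
  "Cinf_at X p = {c \<in> Cinf X. c 0 = p}"

definition Cinf_nonzero :: "'e::euclidean_space set \<Rightarrow> (real \<Rightarrow> 'e) set" where
  "Cinf_nonzero V = {q \<in> Cinf (vector_manifold V). \<forall>t\<in>{0..1}. q t \<noteq> 0}"

definition velocity ::
  "('p, 'e::euclidean_space) manifold \<Rightarrow> (real \<Rightarrow> 'p) \<Rightarrow> real \<Rightarrow> 'e" where
  "velocity X c t = vector_derivative (coord_at X (c t) \<circ> c) (at t within {0..1})"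

definition curve_deriv ::
  "('p, 'e::euclidean_space) manifold \<Rightarrow> (real \<Rightarrow> 'p) \<Rightarrow> real \<Rightarrow> 'p \<times> 'e" where
  "curve_deriv X c = (\<lambda>t\<in>{0..1}. (c t, velocity X c t))"

definition Imm :: "('p, 'e::euclidean_space) manifold \<Rightarrow> (real \<Rightarrow> 'p) set" where
  "Imm X = {c \<in> Cinf X. \<forall>t\<in>{0..1}. velocity X c t \<noteq> 0}"

text \<open>
  Smoothness of a map between the Frechet manifolds \<open>Cinf X\<close> and \<open>Cinf Y\<close>. A map between
  Frechet manifolds is smooth iff it sends smooth curves to smooth curves, and by the exponential
  law the smooth curves in \<open>Cinf X\<close> are the smooth maps from \<open>UNIV \<times> {0..1}\<close> to \<open>X\<close>.
\<close>

definition smooth_curve_operator ::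
  "('p, 'e::euclidean_space) manifold \<Rightarrow> ('q, 'f::euclidean_space) manifold \<Rightarrow>
   ((real \<Rightarrow> 'p) \<Rightarrow> (real \<Rightarrow> 'q)) \<Rightarrow> bool" where
  "smooth_curve_operator X Y A \<longleftrightarrow> A \<in> Cinf X \<rightarrow> Cinf Y \<and>
     (\<forall>F. smooth_from ((UNIV :: real set) \<times> {0..1}) X F \<longrightarrow>
        smooth_from ((UNIV :: real set) \<times> {0..1}) Y
          (\<lambda>(s, t). A (\<lambda>\<tau>\<in>{0..1}. F (s, \<tau>)) t))"


section \<open>Lie groups and closed Lie subgroups\<close>

definition lie_group :: "('g, 'r) monoid_scheme \<Rightarrow> ('g, 'e::euclidean_space) manifold \<Rightarrow> bool" where
  "lie_group G X \<longleftrightarrow> group G \<and> smooth_manifold X \<and> points X = carrier G \<and>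
     smooth_map (prod_manifold X X) X (\<lambda>(x, y). x \<otimes>\<^bsub>G\<^esub> y) \<and>
     smooth_map X X (\<lambda>x. inv\<^bsub>G\<^esub> x)"

text \<open>In the following, the Lie algebra of \<open>G\<close>, i.e. its tangent space at the identity,
  is \<open>model X\<close>.\<close>

definition Ad ::
  "('g, 'r) monoid_scheme \<Rightarrow> ('g, 'e::euclidean_space) manifold \<Rightarrow> 'g \<Rightarrow> 'e \<Rightarrow> 'e" where
  "Ad G X g = tangent_map X X (\<lambda>x. g \<otimes>\<^bsub>G\<^esub> x \<otimes>\<^bsub>G\<^esub> inv\<^bsub>G\<^esub> g) \<one>\<^bsub>G\<^esub>"

definition right_invariant ::
  "('g, 'r) monoid_scheme \<Rightarrow> ('g, 'e::euclidean_space) manifold \<Rightarrow>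
   ('g \<Rightarrow> 'e \<Rightarrow> 'e \<Rightarrow> real) \<Rightarrow> bool" where
  "right_invariant G X \<gamma> \<longleftrightarrow>
     (\<forall>g\<in>carrier G. \<forall>p\<in>carrier G. \<forall>v\<in>model X. \<forall>w\<in>model X.
        \<gamma> (p \<otimes>\<^bsub>G\<^esub> g) (tangent_map X X (\<lambda>x. x \<otimes>\<^bsub>G\<^esub> g) p v)
                     (tangent_map X X (\<lambda>x. x \<otimes>\<^bsub>G\<^esub> g) p w) = \<gamma> p v w)"

definition lie_norm ::
  "('g, 'r) monoid_scheme \<Rightarrow> ('g \<Rightarrow> 'e \<Rightarrow> 'e \<Rightarrow> real) \<Rightarrow> 'e \<Rightarrow> real" where
  "lie_norm G \<gamma> x = sqrt (\<gamma> \<one>\<^bsub>G\<^esub> x x)"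

text \<open>Slice charts: adding such a chart to the atlas again gives a manifold, which says that the
  chart is compatible with the smooth structure.\<close>

definition embedded_submanifold :: "('p, 'e::euclidean_space) manifold \<Rightarrow> 'p set \<Rightarrow> bool" where
  "embedded_submanifold X S \<longleftrightarrow> S \<subseteq> points X \<and>
     (\<forall>p\<in>S. \<exists>U \<phi> W. p \<in> U \<and> U \<subseteq> points X \<and>
        smooth_manifold (X\<lparr>atlas := insert (U, \<phi>) (atlas X)\<rparr>) \<and>
        subspace W \<and> W \<subseteq> model X \<and> \<phi> ` (U \<inter> S) = \<phi> ` U \<inter> W)"

text \<open>The tangent space at \<open>p\<close> of an embedded submanifold \<open>S\<close>, as a subset of the tangent space
  of \<open>X\<close>.\<close>

definition tangent_subspace ::
  "('p, 'e::euclidean_space) manifold \<Rightarrow> 'p set \<Rightarrow> 'p \<Rightarrow> 'e set" where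
  "tangent_subspace X S p = {velocity X c 0 | c. c \<in> Cinf_at X p \<and> c ` {0..1} \<subseteq> S}"

definition closed_lie_subgroup ::
  "('g, 'r) monoid_scheme \<Rightarrow> ('g, 'e::euclidean_space) manifold \<Rightarrow> 'g set \<Rightarrow> bool" where
  "closed_lie_subgroup G X H \<longleftrightarrow>
     subgroup H G \<and> closedin (mtop X) H \<and> embedded_submanifold X H"

definition lie_algebra ::
  "('g, 'r) monoid_scheme \<Rightarrow> ('g, 'e::euclidean_space) manifold \<Rightarrow> 'g set \<Rightarrow> 'e set" where
  "lie_algebra G X H = tangent_subspace X H \<one>\<^bsub>G\<^esub>"

definition Evol ::
  "('g, 'r) monoid_scheme \<Rightarrow> ('g, 'e::euclidean_space) manifold \<Rightarrow> (real \<Rightarrow> 'e) \<Rightarrow> real \<Rightarrow> 'g" where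
  "Evol G X q = (THE g. g \<in> Cinf_at X \<one>\<^bsub>G\<^esub> \<and>
     (\<forall>t\<in>{0..1}. velocity X g t = tangent_map X X (\<lambda>x. x \<otimes>\<^bsub>G\<^esub> g t) \<one>\<^bsub>G\<^esub> (q t)))"


section \<open>Reductive homogeneous spaces\<close>

text \<open>\<open>M\<close> is a manifold structure on the set of left cosets, and the left action of \<open>g\<close> on a
  coset \<open>C\<close> is \<open>g <#\<^bsub>G\<^esub> C\<close>.\<close>

definition homogeneous_space ::
  "('g, 'r) monoid_scheme \<Rightarrow> ('g, 'e::euclidean_space) manifold \<Rightarrow> 'g set \<Rightarrow>
   ('g set, 'f::euclidean_space) manifold \<Rightarrow> bool" where
  "homogeneous_space G X H M \<longleftrightarrow> lie_group G X \<and> closed_lie_subgroup G X H \<and>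
     smooth_manifold M \<and> points M = lcosets\<^bsub>G\<^esub> H \<and> submersion X M (\<lambda>g. g <#\<^bsub>G\<^esub> H)"

definition reductive_complement ::
  "('g, 'r) monoid_scheme \<Rightarrow> ('g, 'e::euclidean_space) manifold \<Rightarrow> 'g set \<Rightarrow> 'e set \<Rightarrow> bool" where
  "reductive_complement G X H \<mm> \<longleftrightarrow> subspace \<mm> \<and>
     {x + y | x y. x \<in> lie_algebra G X H \<and> y \<in> \<mm>} = model X \<and>
     lie_algebra G X H \<inter> \<mm> = {0} \<and>
     (\<forall>h\<in>H. Ad G X h ` \<mm> \<subseteq> \<mm>)"

definition rho ::
  "('g, 'r) monoid_scheme \<Rightarrow> ('g, 'e::euclidean_space) manifold \<Rightarrow> 'g set \<Rightarrow>
   (real \<Rightarrow> 'e) \<Rightarrow> real \<Rightarrow> 'g set" where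
  "rho G X c0 q = (\<lambda>t\<in>{0..1}. Evol G X q t <#\<^bsub>G\<^esub> c0)"

definition omega_e ::
  "('g, 'r) monoid_scheme \<Rightarrow> ('g, 'e::euclidean_space) manifold \<Rightarrow> 'g set \<Rightarrow>
   ('g set, 'f::euclidean_space) manifold \<Rightarrow> 'e set \<Rightarrow> 'f \<Rightarrow> 'e" where
  "omega_e G X H M \<mm> = inv_into \<mm> (tangent_map X M (\<lambda>g. g <#\<^bsub>G\<^esub> H) \<one>\<^bsub>G\<^esub>)"

text \<open>The representatives of a coset \<open>C\<close> are precisely its elements. The value does not depend on
  the choice of the representative.\<close>

definition omega ::
  "('g, 'r) monoid_scheme \<Rightarrow> ('g, 'e::euclidean_space) manifold \<Rightarrow> 'g set \<Rightarrow>
   ('g set, 'f::euclidean_space) manifold \<Rightarrow> 'e set \<Rightarrow> 'g set \<times> 'f \<Rightarrow> 'e" where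
  "omega G X H M \<mm> = (\<lambda>(C, v). THE x. \<forall>g\<in>C.
     x = Ad G X g (omega_e G X H M \<mm> (tangent_map M M (\<lambda>K. inv\<^bsub>G\<^esub> g <#\<^bsub>G\<^esub> K) C v)))"

definition theta ::
  "('g, 'r) monoid_scheme \<Rightarrow> ('g, 'e::euclidean_space) manifold \<Rightarrow> 'g set \<Rightarrow>
   ('g set, 'f::euclidean_space) manifold \<Rightarrow> 'e set \<Rightarrow>
   (real \<Rightarrow> 'g set \<times> 'f) \<Rightarrow> real \<Rightarrow> 'e" where
  "theta G X H M \<mm> f = (\<lambda>t\<in>{0..1}. omega G X H M \<mm> (f t))"

definition srvt ::
  "('g, 'r) monoid_scheme \<Rightarrow> ('g \<Rightarrow> 'e \<Rightarrow> 'e \<Rightarrow> real) \<Rightarrow> ('q, 'f::euclidean_space) manifold \<Rightarrow>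
   ((real \<Rightarrow> 'q \<times> 'f) \<Rightarrow> real \<Rightarrow> 'e::euclidean_space) \<Rightarrow> (real \<Rightarrow> 'q) \<Rightarrow> real \<Rightarrow> 'e" where
  "srvt G \<gamma> M \<alpha> c = (\<lambda>t\<in>{0..1}.
     \<alpha> (curve_deriv M c) t /\<^sub>R sqrt (lie_norm G \<gamma> (\<alpha> (curve_deriv M c) t)))"

end

theory Submission
  imports Defs
begin

text \<open>
  For a curve \<open>c\<close> in \<open>G/H\<close>, the value \<open>q = \<omega>(c')\<close> is the unique element of \<open>Ad(g).\<mm>\<close>, \<open>c = gH\<close>, whose fundamental vector field takes the
  value \<open>c'\<close> at the point \<open>c\<close>. If \<open>g\<close> solves the right-invariant equation with right-hand side \<open>q\<close>, then the
  product rule for \<open>c = g.(g\<^sup>-\<^sup>1.c)\<close> gives \<open>(g\<^sup>-\<^sup>1.c)' = 0\<close>, so \<open>c = g.c(0)\<close>. The same computation for \<open>G\<close>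
  acting on itself yields uniqueness of \<open>Evol\<close>, and for a constant right-hand side \<open>v\<close> in the kernel of
  \<open>T\<^sub>e\<pi>\<close> and the constant curve \<open>c = H\<close> it yields \<open>v \<in> \<hh>\<close>, which makes \<open>T\<^sub>e\<pi>\<close> injective on \<open>\<mm>\<close>.

  Existence of \<open>Evol\<close> is Picard iteration in a chart at the identity: right translation moves local
  solutions to any initial value, so they can be glued along \<open>[0, 1]\<close>. Smoothness of \<open>\<omega>\<close> and of
  the action on \<open>G/H\<close> is read off from local smooth sections of \<open>\<pi>\<close>, which come from the inverse function theorem.
\<close>

section \<open>Smooth maps on open sets\<close>

text \<open>The model space of a manifold may be a proper subspace of its Euclidean type, and
  \<open>[0, 1]\<close> has end points, so most functions live on sets that are not open. Linear
  projections \<open>P\<close> onto the model space and local smooth extensions bridge this gap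
  wherever calculus on open sets is invoked: for derivatives, the inverse function theorem and
  Picard iteration. A second obstacle is that a tangent vector is stored as coordinates in a chart
  chosen arbitrarily at each point. The preferred charts at nearby points, or of a product and its
  factors, are unrelated, so stored coordinates need not vary smoothly. Velocities are therefore
  handled by the relation \<open>has_velocity\<close>, tangent maps are computed on test curves, and
  smooth dependence is stated in one fixed chart. In that form the right-invariant field, the
  adjoint action and the translations inside \<open>omega\<close> are all partial derivatives of
  smooth maps of two variables, taken at the identity or on a diagonal.\<close>

lemma frechet_derivative_cong_open:
  assumes "open U" "x \<in> U" "\<And>y. y \<in> U \<Longrightarrow> f y = g y"
  shows "frechet_derivative f (at x) = frechet_derivative g (at x)"
proof -
  have "(f has_derivative D) (at x) = (g has_derivative D) (at x)" for D
    using has_derivative_transform_within_open[of f D x UNIV U g]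
      has_derivative_transform_within_open[of g D x UNIV U f] assms by metis
  then show ?thesis by (simp add: frechet_derivative_def)
qed

lemma Ck_on_cong:
  assumes "open U" "\<And>x. x \<in> U \<Longrightarrow> f x = g x"
  shows "Ck_on k U f \<longleftrightarrow> Ck_on k U g"
  using assms(2)
proof (induction k arbitrary: f g)
  case 0
  then show ?case by (simp cong: continuous_on_cong)
next
  case (Suc k)
  have 1: "f differentiable (at x) \<longleftrightarrow> g differentiable (at x)" if "x \<in> U" for x
    unfolding differentiable_def
    using has_derivative_transform_within_open[of f _ x UNIV U g]
      has_derivative_transform_within_open[of g _ x UNIV U f] assms(1) Suc.prems that by metis
  have 2: "Ck_on k U (\<lambda>x. frechet_derivative f (at x) v) \<longleftrightarrow>
      Ck_on k U (\<lambda>x. frechet_derivative g (at x) v)" for v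
    by (rule Suc.IH) (use frechet_derivative_cong_open[OF assms(1)] Suc.prems in metis)
  show ?case using 1 2 by auto
qed

lemma Ck_on_subset: "Ck_on k U f \<Longrightarrow> V \<subseteq> U \<Longrightarrow> Ck_on k V f"
  by (induction k arbitrary: f) (auto intro: continuous_on_subset)

lemma Ck_on_SucD: "Ck_on (Suc k) U f \<Longrightarrow> Ck_on k U f"
proof (induction k arbitrary: f)
  case 0
  then show ?case
    by (auto intro!: differentiable_imp_continuous_within continuous_at_imp_continuous_on)
next
  case (Suc k)
  then show ?case by simp
qed

text \<open>\<open>frechet_derivative\<close> is a choice operator and cannot be computed with
  directly. Derivatives on an open set are unique, so any explicit formula \<open>f'\<close> may
  stand in for it; the closure rules below rest on this.\<close>

lemma Ck_on_SucI:
  assumes "open U" "\<And>x. x \<in> U \<Longrightarrow> (f has_derivative f' x) (at x)"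
    "\<And>v. Ck_on k U (\<lambda>x. f' x v)"
  shows "Ck_on (Suc k) U f"
proof -
  have "frechet_derivative f (at x) = f' x" if "x \<in> U" for x
    using frechet_derivative_at assms(2) that by metis
  then have "Ck_on k U (\<lambda>x. frechet_derivative f (at x) v)" for v
    using Ck_on_cong[OF assms(1), of "\<lambda>x. f' x v" "\<lambda>x. frechet_derivative f (at x) v" k] assms(3)
    by simp
  then show ?thesis using assms(2) by (auto simp: differentiable_def)
qed

lemma Ck_on_has_derivative:
  "Ck_on (Suc k) U f \<Longrightarrow> x \<in> U \<Longrightarrow> (f has_derivative frechet_derivative f (at x)) (at x)"
  by (simp add: frechet_derivative_works)

lemma Ck_on_has_vector_derivative:
  assumes "Ck_on (Suc k) U f" "t \<in> U"
  shows "(f has_vector_derivative frechet_derivative f (at t) 1) (at t)"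
proof -
  note f = Ck_on_has_derivative[OF assms]
  have "frechet_derivative f (at t) h = h *\<^sub>R frechet_derivative f (at t) 1" for h
    using linear_cmul[OF has_derivative_linear[OF f], of h 1] by simp
  then have "frechet_derivative f (at t) = (\<lambda>h. h *\<^sub>R frechet_derivative f (at t) 1)" by (rule ext)
  then show ?thesis using f unfolding has_vector_derivative_def by metis
qed

lemma Ck_on_local:
  assumes "\<And>x. x \<in> U \<Longrightarrow> \<exists>V. open V \<and> x \<in> V \<and> Ck_on k V f"
  shows "Ck_on k U f"
  using assms
proof (induction k arbitrary: f)
  case 0
  then show ?case
    by (auto intro!: continuous_at_imp_continuous_on simp: continuous_on_eq_continuous_at) 
      (meson continuous_on_eq_continuous_at)
next
  case (Suc k)
  have "f differentiable (at x)" if "x \<in> U" for x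
    using Suc.prems[OF that] by auto
  moreover have "Ck_on k U (\<lambda>x. frechet_derivative f (at x) v)" for v
  proof (rule Suc.IH)
    fix x assume "x \<in> U"
    from Suc.prems[OF this] obtain V where "open V" "x \<in> V" "Ck_on (Suc k) V f" by blast
    then have "open V \<and> x \<in> V \<and> Ck_on k V (\<lambda>x. frechet_derivative f (at x) v)" by simp
    then show "\<exists>V. open V \<and> x \<in> V \<and> Ck_on k V (\<lambda>x. frechet_derivative f (at x) v)" ..
  qed
  ultimately show ?case by simp
qed

lemma Ck_on_const: "Ck_on k U (\<lambda>x. c)"
proof (induction k arbitrary: c)
  case 0
  then show ?case by simp
next
  case (Suc k)
  have "frechet_derivative (\<lambda>x. c) (at x) = (\<lambda>v. 0)" for x::'a
    by (metis frechet_derivative_at has_derivative_const)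
  then show ?case using Suc by simp
qed

lemma Ck_on_linear_comp:
  assumes h: "bounded_linear h" and "open U"
  shows "Ck_on k U f \<Longrightarrow> Ck_on k U (\<lambda>x. h (f x))"
proof (induction k arbitrary: f)
  case 0
  then show ?case using h by (simp add: bounded_linear.continuous_on)
next
  case (Suc k)
  show ?case
    by (rule Ck_on_SucI[OF \<open>open U\<close> bounded_linear.has_derivative[OF h Ck_on_has_derivative[OF Suc.prems]]])
      (use Suc in auto)
qed

lemma Ck_on_id:
  assumes "open U" shows "Ck_on k U (\<lambda>x. x)"
proof (cases k)
  case (Suc j)
  show ?thesis unfolding Suc
    by (rule Ck_on_SucI[OF assms has_derivative_ident Ck_on_const])
qed simp

lemma Ck_on_bounded_linear: "bounded_linear h \<Longrightarrow> open U \<Longrightarrow> Ck_on k U h"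
  using Ck_on_linear_comp[OF _ _ Ck_on_id] by blast

lemma Ck_on_add:
  assumes "open U"
  shows "Ck_on k U f \<Longrightarrow> Ck_on k U g \<Longrightarrow> Ck_on k U (\<lambda>x. f x + g x)"
proof (induction k arbitrary: f g)
  case 0
  then show ?case by (simp add: continuous_on_add)
next
  case (Suc k)
  show ?case
    by (rule Ck_on_SucI[OF \<open>open U\<close> has_derivative_add[OF Ck_on_has_derivative[OF Suc.prems(1)] Ck_on_has_derivative[OF Suc.prems(2)]]])
      (use Suc in auto)
qed

lemma Ck_on_sum:
  assumes "open U" "finite I" "\<And>i. i \<in> I \<Longrightarrow> Ck_on k U (f i)"
  shows "Ck_on k U (\<lambda>x. \<Sum>i\<in>I. f i x)"
  using assms(2,3) by (induction I rule: finite_induct) (auto intro: Ck_on_const Ck_on_add assms(1))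

text \<open>The product rule produces bilinear terms in \<open>f\<close>, \<open>g\<close> and their
  derivatives, so the induction hypothesis applies to each summand.\<close>

lemma Ck_on_bilinear:
  assumes h: "bounded_bilinear h" and "open U"
  shows "Ck_on k U f \<Longrightarrow> Ck_on k U g \<Longrightarrow> Ck_on k U (\<lambda>x. h (f x) (g x))"
proof (induction k arbitrary: f g)
  case 0
  then show ?case using h by (simp add: bounded_bilinear.continuous_on)
next
  case (Suc k)
  \<comment> \<open>The summands of the product rule also contain \<open>f\<close> and
    \<open>g\<close> undifferentiated, which therefore have to be available at the lower order
    \<open>k\<close>.\<close>
  note fg = Ck_on_SucD[OF Suc.prems(1)] Ck_on_SucD[OF Suc.prems(2)]
  show ?case
    by (rule Ck_on_SucI[OF \<open>open U\<close> bounded_bilinear.FDERIV[OF h Ck_on_has_derivative[OF Suc.prems(1)] Ck_on_has_derivative[OF Suc.prems(2)]]])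
      (use Suc fg in \<open>auto intro!: Ck_on_add[OF \<open>open U\<close>]\<close>)
qed

lemma linear_basis_expansion:
  fixes h :: "'a::euclidean_space \<Rightarrow> 'b::real_vector"
  assumes "linear h"
  shows "h x = (\<Sum>b\<in>Basis. (x \<bullet> b) *\<^sub>R h b)"
proof -
  have "h x = h (\<Sum>b\<in>Basis. (x \<bullet> b) *\<^sub>R b)" by (simp add: euclidean_representation)
  also have "\<dots> = (\<Sum>b\<in>Basis. (x \<bullet> b) *\<^sub>R h b)"
    by (simp only: linear_sum[OF assms] linear_cmul[OF assms])
  finally show ?thesis .
qed

text \<open>Expanding \<open>w x\<close> in the standard basis leaves finitely many products of
  scalar coefficients with the functions \<open>A x b\<close>. This avoids function spaces of linear
  maps.\<close>

lemma Ck_on_apply_linear: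
  fixes A :: "'a::euclidean_space \<Rightarrow> 'b::euclidean_space \<Rightarrow> 'c::euclidean_space"
  assumes "open U" "\<And>x. x \<in> U \<Longrightarrow> linear (A x)" "\<And>b. Ck_on k U (\<lambda>x. A x b)" "Ck_on k U w"
  shows "Ck_on k U (\<lambda>x. A x (w x))"
proof -
  have "Ck_on k U (\<lambda>x. \<Sum>b\<in>Basis. (w x \<bullet> b) *\<^sub>R A x b)"
    by (intro Ck_on_sum Ck_on_bilinear[OF bounded_bilinear_scaleR] assms finite_Basis
        Ck_on_linear_comp[OF bounded_linear_inner_left])
  then show ?thesis
    by (subst Ck_on_cong[OF \<open>open U\<close>]) (use linear_basis_expansion assms(2) in auto)
qed

text \<open>The chain rule gives \<open>Dg (f x) (Df x v)\<close>. Its linear part is again a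
  composition with the same \<open>f\<close>, but with the derivative of \<open>g\<close>, which is
  why the induction generalizes \<open>g\<close>; \<open>Ck_on_apply_linear\<close> puts the two
  factors together.\<close>

lemma Ck_on_compose:
  assumes "open U" "open V"
  shows "Ck_on k U f \<Longrightarrow> Ck_on k V g \<Longrightarrow> f ` U \<subseteq> V \<Longrightarrow> Ck_on k U (\<lambda>x. g (f x))"
proof (induction k arbitrary: g)
  case 0
  then show ?case by (auto intro: continuous_on_compose2)
next
  case (Suc k)
  have g: "x \<in> U \<Longrightarrow> (g has_derivative frechet_derivative g (at (f x))) (at (f x))" for x
    using Ck_on_has_derivative[OF Suc.prems(2)] Suc.prems(3) by blast
  show ?case
  proof (rule Ck_on_SucI[OF \<open>open U\<close> has_derivative_compose[OF Ck_on_has_derivative[OF Suc.prems(1)] g]])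
    fix v
    show "Ck_on k U (\<lambda>x. frechet_derivative g (at (f x)) (frechet_derivative f (at x) v))"
    proof (rule Ck_on_apply_linear[OF \<open>open U\<close>, where A = "\<lambda>x. frechet_derivative g (at (f x))"
          and w = "\<lambda>x. frechet_derivative f (at x) v"])
      show "linear (frechet_derivative g (at (f x)))" if "x \<in> U" for x
        using g[OF that] has_derivative_linear by blast
      show "Ck_on k U (\<lambda>x. frechet_derivative g (at (f x)) b)" for b
      proof (rule Suc.IH[OF Ck_on_SucD[OF Suc.prems(1)] _ Suc.prems(3)])
        show "Ck_on k V (\<lambda>y. frechet_derivative g (at y) b)" using Suc.prems(2) by simp
      qed
      show "Ck_on k U (\<lambda>x. frechet_derivative f (at x) v)" using Suc.prems(1) by simp
    qed
  qed assumption
qed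

lemma Ck_on_Pair:
  assumes "open U" "Ck_on k U f" "Ck_on k U g"
  shows "Ck_on k U (\<lambda>x. (f x, g x))"
proof -
  have "Ck_on k U (\<lambda>x. (f x, 0) + (0, g x))"
    by (intro Ck_on_add[OF \<open>open U\<close>] Ck_on_linear_comp[OF _ \<open>open U\<close>, of "\<lambda>y. (y, 0)"]
        Ck_on_linear_comp[OF _ \<open>open U\<close>, of "\<lambda>y. (0, y)"] assms bounded_linear_Pair
        bounded_linear_ident bounded_linear_zero)
  then show ?thesis by simp
qed

text \<open>The exponent is generalized because differentiation lowers it by one. The exponent of
  interest is \<open>-1/4\<close>, from the square root of a norm.\<close>

lemma Ck_on_powr: "Ck_on k {0<..} (\<lambda>x::real. x powr a)"
proof (induction k arbitrary: a)
  case 0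
  then show ?case by (auto intro!: continuous_intros)
next
  case (Suc k)
  have *: "((\<lambda>x. x powr a) has_derivative (\<lambda>h. h * (a * x powr (a - 1)))) (at x)" if "x > 0" for x :: real
    using that has_real_derivative_powr[OF that, of a]
    by (auto simp: has_field_derivative_def mult.commute mult.left_commute elim!: has_derivative_eq_rhs)
  show ?case
  proof (rule Ck_on_SucI[OF _ *])
    show "Ck_on k {0<..} (\<lambda>x. v * (a * x powr (a - 1)))" for v
      using Ck_on_linear_comp[OF bounded_linear_mult_right[of "v * a"] _ Suc[of "a - 1"]]
      by (simp add: mult.assoc)
  qed auto
qed

section \<open>Smooth maps on arbitrary subsets\<close>

lemma smooth_onE:
  assumes "smooth_on S f" "x \<in> S"
  obtains U F where "open U" "x \<in> U" "\<forall>k. Ck_on k U F" "\<forall>y\<in>S \<inter> U. F y = f y"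
  using assms unfolding smooth_on_def by blast

lemma smooth_onI:
  assumes "\<And>x. x \<in> S \<Longrightarrow> \<exists>U F. open U \<and> x \<in> U \<and> (\<forall>k. Ck_on k U F) \<and> (\<forall>y\<in>S \<inter> U. F y = f y)"
  shows "smooth_on S f"
  using assms unfolding smooth_on_def by blast

lemma smooth_on_subset:
  assumes "smooth_on S f" "T \<subseteq> S"
  shows "smooth_on T f"
proof (rule smooth_onI)
  fix x assume "x \<in> T"
  with assms have x: "x \<in> S" by blast
  obtain U F where U: "open U" "x \<in> U" "\<forall>k. Ck_on k U F" "\<forall>y\<in>S \<inter> U. F y = f y"
    by (rule smooth_onE[OF assms(1) x])
  have "\<forall>y\<in>T \<inter> U. F y = f y" using U(4) assms(2) by blast
  then show "\<exists>U F. open U \<and> x \<in> U \<and> (\<forall>k. Ck_on k U F) \<and> (\<forall>y\<in>T \<inter> U. F y = f y)"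
    using U(1-3) by (intro exI[of _ U] exI[of _ F] conjI)
qed

lemma smooth_on_cong: "(\<And>x. x \<in> S \<Longrightarrow> f x = g x) \<Longrightarrow> smooth_on S f \<longleftrightarrow> smooth_on S g"
  unfolding smooth_on_def by simp

lemma smooth_on_Ck: "open U \<Longrightarrow> (\<And>k. Ck_on k U f) \<Longrightarrow> smooth_on U f"
  unfolding smooth_on_def by blast

lemma Ck_on_smooth:
  assumes "smooth_on U f" "open U"
  shows "Ck_on k U f"
proof (rule Ck_on_local)
  fix x assume "x \<in> U"
  obtain V F where V: "open V" "x \<in> V" "\<forall>k. Ck_on k V F" "\<forall>y\<in>U \<inter> V. F y = f y"
    by (rule smooth_onE[OF assms(1) \<open>x \<in> U\<close>])
  have "Ck_on k (U \<inter> V) F" using V(3) Ck_on_subset by blast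
  then have "Ck_on k (U \<inter> V) f"
    using Ck_on_cong[of "U \<inter> V" F f k] V assms by blast
  then show "\<exists>V. open V \<and> x \<in> V \<and> Ck_on k V f" using V assms \<open>x \<in> U\<close> by blast
qed

lemma smooth_on_local:
  assumes "\<And>x. x \<in> S \<Longrightarrow> \<exists>N. openin (top_of_set S) N \<and> x \<in> N \<and> smooth_on N f"
  shows "smooth_on S f"
proof (rule smooth_onI)
  fix x assume "x \<in> S"
  then obtain T where T: "open T" "x \<in> T" "smooth_on (S \<inter> T) f"
    using assms by (metis IntE openin_open)
  obtain U F where U: "open U" "x \<in> U" "\<forall>k. Ck_on k U F" "\<forall>y\<in>S \<inter> T \<inter> U. F y = f y"
    by (rule smooth_onE[OF T(3), of x]) (use T \<open>x \<in> S\<close> in auto)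
  show "\<exists>U F. open U \<and> x \<in> U \<and> (\<forall>k. Ck_on k U F) \<and> (\<forall>y\<in>S \<inter> U. F y = f y)"
    using U T by (intro exI[of _ "U \<inter> T"] exI[of _ F]) (auto intro: Ck_on_subset[OF U(3)[rule_format]])
qed

lemma smooth_on_imp_continuous_on:
  assumes "smooth_on S f" shows "continuous_on S f"
  unfolding continuous_on_eq_continuous_within
proof
  fix x assume x: "x \<in> S"
  obtain U F where U: "open U" "x \<in> U" "\<forall>k. Ck_on k U F" "\<forall>y\<in>S \<inter> U. F y = f y"
    by (rule smooth_onE[OF assms x])
  have "continuous_on U F" using U(3)[rule_format, of 0] by simp
  then have "continuous (at x within S) F"
    using U continuous_at_imp_continuous_within continuous_on_eq_continuous_at by blast
  then show "continuous (at x within S) f"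
    by (rule continuous_transform_within_openin[where T=S and S = "S \<inter> U"]) (use U x in auto)
qed

text \<open>Two local extensions live on different neighbourhoods; both are restricted to the
  intersection, where closure under \<open>h\<close> on open sets applies.\<close>

lemma smooth_on_lift2:
  fixes S :: "'a::euclidean_space set"
  assumes "smooth_on S f" "smooth_on S g"
    and lift: "\<And>(U::'a set) F G. open U \<Longrightarrow> (\<And>k. Ck_on k U F) \<Longrightarrow> (\<And>k. Ck_on k U G) \<Longrightarrow>
      smooth_on U (\<lambda>x. h (F x) (G x))"
  shows "smooth_on S (\<lambda>x. h (f x) (g x))"
proof (rule smooth_onI)
  fix x assume x: "x \<in> S"
  obtain U F where U: "open U" "x \<in> U" "\<forall>k. Ck_on k U F" "\<forall>y\<in>S \<inter> U. F y = f y"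
    by (rule smooth_onE[OF assms(1) x])
  obtain V G where V: "open V" "x \<in> V" "\<forall>k. Ck_on k V G" "\<forall>y\<in>S \<inter> V. G y = g y"
    by (rule smooth_onE[OF assms(2) x])
  have "smooth_on (U \<inter> V) (\<lambda>x. h (F x) (G x))"
    by (rule lift) (use U(1) V(1) in \<open>auto intro: Ck_on_subset[OF U(3)[rule_format]] Ck_on_subset[OF V(3)[rule_format]]\<close>)
  then have "\<forall>k. Ck_on k (U \<inter> V) (\<lambda>x. h (F x) (G x))" using U V Ck_on_smooth by blast
  then show "\<exists>U F. open U \<and> x \<in> U \<and> (\<forall>k. Ck_on k U F) \<and> (\<forall>y\<in>S \<inter> U. F y = h (f y) (g y))"
    using U V by (intro exI[of _ "U \<inter> V"] exI[of _ "\<lambda>x. h (F x) (G x)"]) auto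
qed

lemma smooth_on_const: "smooth_on S (\<lambda>x. c)"
  using smooth_on_subset[OF smooth_on_Ck[OF open_UNIV Ck_on_const]] by blast

lemma smooth_on_bounded_linear: "bounded_linear h \<Longrightarrow> smooth_on S h"
  using smooth_on_subset[OF smooth_on_Ck[OF open_UNIV Ck_on_bounded_linear]] by blast

lemma smooth_on_linear: "linear h \<Longrightarrow> smooth_on S (h :: 'a::euclidean_space \<Rightarrow> 'b::euclidean_space)"
  by (simp add: linear_linear smooth_on_bounded_linear)

lemma smooth_on_id: "smooth_on S (\<lambda>x. x)"
  by (simp add: smooth_on_bounded_linear)

lemma smooth_on_Pair: "smooth_on S f \<Longrightarrow> smooth_on S g \<Longrightarrow> smooth_on S (\<lambda>x. (f x, g x))"
  by (rule smooth_on_lift2[where h = "\<lambda>a b. (a, b)"]) (auto intro: smooth_on_Ck Ck_on_Pair)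

lemma smooth_on_bilinear:
  "bounded_bilinear h \<Longrightarrow> smooth_on S f \<Longrightarrow> smooth_on S g \<Longrightarrow> smooth_on S (\<lambda>x. h (f x) (g x))"
  by (rule smooth_on_lift2[where h = h]) (auto intro: smooth_on_Ck Ck_on_bilinear)

lemma smooth_on_add:
  "smooth_on S f \<Longrightarrow> smooth_on S g \<Longrightarrow> smooth_on S (\<lambda>x. f x + g x)"
  by (rule smooth_on_lift2[where h = "(+)"]) (auto intro: smooth_on_Ck Ck_on_add)

lemma smooth_on_compose:
  assumes f: "smooth_on S f" and g: "smooth_on T g" and "f ` S \<subseteq> T"
  shows "smooth_on S (\<lambda>x. g (f x))"
proof (rule smooth_onI)
  fix x assume x: "x \<in> S"
  obtain U F where U: "open U" "x \<in> U" "\<forall>k. Ck_on k U F" "\<forall>y\<in>S \<inter> U. F y = f y"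
    by (rule smooth_onE[OF f x])
  have fx: "f x \<in> T" using x assms(3) by blast
  obtain V G where V: "open V" "f x \<in> V" "\<forall>k. Ck_on k V G" "\<forall>y\<in>T \<inter> V. G y = g y"
    by (rule smooth_onE[OF g fx])
  \<comment> \<open>The extension \<open>F\<close> may leave \<open>V\<close> at points outside
    \<open>S\<close>, so the neighbourhood is cut down to where \<open>G\<close> is
    controlled.\<close>
  let ?W = "U \<inter> F -` V"
  have W: "open ?W"
    using continuous_on_open_vimage[OF U(1), of F] U(3)[rule_format, of 0] V(1) by (auto simp: Int_commute)
  have "\<forall>k. Ck_on k ?W (\<lambda>x. G (F x))"
    using Ck_on_compose[OF W V(1) _ V(3)[rule_format]] Ck_on_subset[OF U(3)[rule_format], of ?W] by auto
  moreover have "x \<in> ?W" using U V x by auto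
  moreover have "\<forall>y\<in>S \<inter> ?W. G (F y) = g (f y)" using U V assms by auto
  ultimately show "\<exists>U F. open U \<and> x \<in> U \<and> (\<forall>k. Ck_on k U F) \<and> (\<forall>y\<in>S \<inter> U. F y = g (f y))"
    using W by blast
qed

lemma smooth_on_linear_comp:
  "linear h \<Longrightarrow> smooth_on S f \<Longrightarrow> smooth_on S (\<lambda>x. (h :: 'a::euclidean_space \<Rightarrow> 'b::euclidean_space) (f x))"
  by (rule smooth_on_compose[OF _ smooth_on_linear[where S=UNIV]]) auto

lemma smooth_on_fst: "smooth_on S f \<Longrightarrow> smooth_on S (\<lambda>x. fst (f x))"
  by (rule smooth_on_linear_comp[OF linear_fst])

lemma smooth_on_snd: "smooth_on S f \<Longrightarrow> smooth_on S (\<lambda>x. snd (f x))"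
  by (rule smooth_on_linear_comp[OF linear_snd])

section \<open>Derivatives of smooth maps\<close>

text \<open>A linear retraction onto a model space. Precomposed with it, a map on a relatively open
  subset of \<open>V\<close> becomes a map on an open set; applied to values, it detects membership
  in \<open>V\<close>.\<close>

lemma subspace_projection:
  fixes V :: "'a::euclidean_space set"
  assumes "subspace V"
  obtains P :: "'a \<Rightarrow> 'a" where "linear P" "\<And>x. P x \<in> V" "\<And>x. x \<in> V \<Longrightarrow> P x = x"
proof -
  have "\<exists>g. range g \<subseteq> V \<and> linear g \<and> (\<forall>v\<in>V. g (id v) = v)"
    by (rule linear_exists_left_inverse_on[OF linear_id assms]) auto
  then show thesis using that by auto
qed

lemma smooth_on_projection:
  fixes f :: "'a::euclidean_space \<Rightarrow> 'b::euclidean_space"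
  assumes "linear P" "\<And>x. P x \<in> V" and "openin (top_of_set V) A" "smooth_on A f"
  shows "open (P -` A)" "smooth_on (P -` A) (\<lambda>x. f (P x))"
proof -
  obtain T where T: "open T" "A = V \<inter> T" using assms(3) by (auto simp: openin_open)
  have "P -` A = P -` T" using T(2) assms(2) by auto
  then show "open (P -` A)"
    using open_vimage[OF T(1), of P] linear_continuous_on[of P UNIV] assms(1) linear_linear by metis
  show "smooth_on (P -` A) (\<lambda>x. f (P x))"
    by (rule smooth_on_compose[OF smooth_on_linear[OF assms(1)] assms(4)]) auto
qed

lemma smooth_on_has_derivative:
  assumes "smooth_on U f" "open U" "x \<in> U"
  shows "(f has_derivative frechet_derivative f (at x)) (at x)"
  using Ck_on_has_derivative[OF Ck_on_smooth[OF assms(1,2)] assms(3)] .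

lemma Ck_on_frechet_derivative:
  fixes f :: "'a::euclidean_space \<Rightarrow> 'b::euclidean_space"
  assumes "smooth_on U f" "open U"
  shows "Ck_on k U (\<lambda>x. frechet_derivative f (at x) v)"
  using Ck_on_smooth[OF assms, of "Suc k"] by simp

lemma smooth_on_frechet_derivative:
  fixes f :: "'a::euclidean_space \<Rightarrow> 'b::euclidean_space"
  assumes "smooth_on U f" "open U"
  shows "smooth_on (U \<times> UNIV) (\<lambda>z. frechet_derivative f (at (fst z)) (snd z))"
proof (rule smooth_on_Ck)
  show op: "open (U \<times> (UNIV::'a set))" using assms by (simp add: open_Times)
  show "Ck_on k (U \<times> UNIV) (\<lambda>z. frechet_derivative f (at (fst z)) (snd z))" for k
  proof (rule Ck_on_apply_linear[OF op, where A = "\<lambda>z. frechet_derivative f (at (fst z))" and w = snd])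
    show "linear (frechet_derivative f (at (fst x)))" if "x \<in> U \<times> (UNIV::'a set)" for x
      using smooth_on_has_derivative[OF assms] has_derivative_linear that by (metis mem_Times_iff)
    show "Ck_on k (U \<times> (UNIV::'a set)) (\<lambda>x. frechet_derivative f (at (fst x)) b)" for b
      by (rule Ck_on_compose[OF op assms(2) Ck_on_bounded_linear[OF bounded_linear_fst op]
            Ck_on_frechet_derivative[OF assms]]) auto
    show "Ck_on k (U \<times> (UNIV::'a set)) snd"
      by (rule Ck_on_bounded_linear[OF bounded_linear_snd op])
  qed
qed

text \<open>Within a proper subspace a derivative is determined only along \<open>V\<close>. Taking
  the derivative of \<open>f \<circ> P\<close>, with \<open>P\<close> the projection, fixes a choice
  on all vectors that is jointly smooth in the point and the vector.\<close>

lemma smooth_on_subspace_derivative: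
  fixes f :: "'a::euclidean_space \<Rightarrow> 'b::euclidean_space"
  assumes V: "subspace V" and A: "openin (top_of_set V) A" and f: "smooth_on A f"
  obtains D where "smooth_on (A \<times> UNIV) (\<lambda>z. D (fst z) (snd z))"
    "\<And>x. x \<in> A \<Longrightarrow> (f has_derivative D x) (at x within V)"
proof -
  obtain P :: "'a \<Rightarrow> 'a" where P: "linear P" "\<And>x. P x \<in> V" "\<And>x. x \<in> V \<Longrightarrow> P x = x"
    using subspace_projection[OF V] by metis
  note ext = smooth_on_projection[OF P(1,2) A f]
  have OV: "A \<subseteq> V" using A openin_imp_subset by blast
  then have OP: "A \<subseteq> P -` A" using P(3) by auto
  define D where "D x = frechet_derivative (\<lambda>x. f (P x)) (at x)" for x
  have 1: "smooth_on (A \<times> UNIV) (\<lambda>z. D (fst z) (snd z))"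
    unfolding D_def
    by (rule smooth_on_subset[OF smooth_on_frechet_derivative[OF ext(2,1)]]) (use OP in auto)
  have 2: "(f has_derivative D x) (at x within V)" if "x \<in> A" for x
  proof (rule has_derivative_transform)
    show "x \<in> V" using OV that by blast
    show "\<And>x. x \<in> V \<Longrightarrow> f x = f (P x)" using P(3) by simp
    show "((\<lambda>x. f (P x)) has_derivative D x) (at x within V)"
      unfolding D_def
      by (rule has_derivative_at_withinI[OF smooth_on_has_derivative[OF ext(2,1)]]) (use OP that in auto)
  qed
  show thesis by (rule that[OF 1 2])
qed

text \<open>This differentiates families: the first variable is a parameter on which the derivative
  in the second one depends smoothly. The right-invariant field, \<open>Ad\<close> and the
  translations inside \<open>omega\<close> are all obtained in this way.\<close>

lemma smooth_on_partial_derivative: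
  fixes f :: "'a::euclidean_space \<times> 'b::euclidean_space \<Rightarrow> 'c::euclidean_space"
  assumes V: "subspace V" "subspace W" and A: "openin (top_of_set (V \<times> W)) A" and f: "smooth_on A f"
  obtains D where "smooth_on (A \<times> UNIV) (\<lambda>z. D (fst z) (snd z))"
    "\<And>x y. (x, y) \<in> A \<Longrightarrow> ((\<lambda>y. f (x, y)) has_derivative D (x, y)) (at y within W)"
proof -
  obtain D where D: "smooth_on (A \<times> UNIV) (\<lambda>z. D (fst z) (snd z))"
    "\<And>x. x \<in> A \<Longrightarrow> (f has_derivative D x) (at x within V \<times> W)"
    using smooth_on_subspace_derivative[OF subspace_Times[OF V] A f] by blast
  show thesis
  proof (rule that[of "\<lambda>z w. D z (0, w)"])
    have 1: "smooth_on (A \<times> (UNIV::'b set)) (\<lambda>z. (fst z, (0, snd z)) :: ('a \<times> 'b) \<times> ('a \<times> 'b))"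
      by (intro smooth_on_Pair smooth_on_const smooth_on_fst smooth_on_snd smooth_on_id)
    have 2: "(\<lambda>z. (fst z, (0, snd z))) ` (A \<times> (UNIV::'b set)) \<subseteq> A \<times> UNIV"
      by auto
    show "smooth_on (A \<times> UNIV) (\<lambda>z. D (fst z) (0, snd z))"
      using smooth_on_compose[OF 1 D(1) 2] by simp
  next
    fix x y assume xy: "(x, y) \<in> A"
    then have "x \<in> V" using A openin_imp_subset by blast
    then have im: "(\<lambda>y. (x, y)) ` W \<subseteq> V \<times> W" by auto
    have 1: "((\<lambda>y. (x, y)) has_derivative (\<lambda>w. (0, w))) (at y within W)"
      by (auto intro!: derivative_eq_intros)
    show "((\<lambda>y. f (x, y)) has_derivative (\<lambda>w. D (x, y) (0, w))) (at y within W)"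
      using has_derivative_in_compose[OF 1 has_derivative_subset[OF D(2)[OF xy] im]] .
  qed
qed

lemma smooth_on_has_vector_derivative:
  fixes f :: "real \<Rightarrow> 'b::euclidean_space"
  assumes "smooth_on S f" "t \<in> S"
  obtains v where "(f has_vector_derivative v) (at t within S)"
proof -
  obtain U F where U: "open U" "t \<in> U" "\<forall>k. Ck_on k U F" "\<forall>y\<in>S \<inter> U. F y = f y"
    by (rule smooth_onE[OF assms])
  have "(F has_vector_derivative frechet_derivative F (at t) 1) (at t)"
    by (rule Ck_on_has_vector_derivative[OF U(3)[rule_format, of "Suc 0"] U(2)])
  then have "(F has_vector_derivative frechet_derivative F (at t) 1) (at t within S \<inter> U)"
    by (rule has_vector_derivative_at_within)
  then have "(f has_vector_derivative frechet_derivative F (at t) 1) (at t within S \<inter> U)"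
    by (rule has_vector_derivative_transform[rotated 2]) (use U assms in auto)
  then have "(f has_vector_derivative frechet_derivative F (at t) 1) (at t within S)"
    using at_within_nhd[OF U(2,1), of S "S \<inter> U"] by simp
  then show thesis by (rule that)
qed

section \<open>The smooth inverse function theorem\<close>

text \<open>Because \<open>r\<close> vanishes at \<open>y\<close>, the product is differentiable
  although \<open>u\<close> is merely continuous: the correction
  \<open>r z *\<^sub>R (u z - u y)\<close> is the product of a term of order
  \<open>norm (z - y)\<close> and a term that tends to zero.\<close>

lemma has_derivative_scaleR_vanishing:
  fixes u :: "'a::real_normed_vector \<Rightarrow> 'b::real_normed_vector"
  assumes r: "(r has_derivative r') (at y)" "r y = 0" and u: "continuous (at y) u"
  shows "((\<lambda>z. r z *\<^sub>R u z) has_derivative (\<lambda>h. r' h *\<^sub>R u y)) (at y)"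
proof -
  have 1: "((\<lambda>z. r z *\<^sub>R u y) has_derivative (\<lambda>h. r' h *\<^sub>R u y)) (at y)"
    using r(1) by (auto intro!: derivative_eq_intros)
  have 2: "((\<lambda>z. r z *\<^sub>R (u z - u y)) has_derivative (\<lambda>h. 0)) (at y)"
    unfolding has_derivative_at_alt
  proof (intro conjI allI impI)
    fix e :: real assume e: "0 < e"
    obtain K where K: "\<And>h. norm (r' h) \<le> norm h * K" "K > 0"
      using bounded_linear.pos_bounded[OF has_derivative_bounded_linear[OF r(1)]] by (auto simp: mult.commute)
    obtain d1 where d1: "d1 > 0" "\<And>z. norm (z - y) < d1 \<Longrightarrow> norm (r z - r y - r' (z - y)) \<le> 1 * norm (z - y)"
      using r(1) unfolding has_derivative_at_alt by (meson zero_less_one)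
    \<comment> \<open>\<open>K + 1\<close> bounds the growth of \<open>r\<close> near
      \<open>y\<close>: \<open>K\<close> comes from the derivative and \<open>1\<close> from the
      error term.\<close>
    obtain d2 where d2: "d2 > 0" "\<And>z. dist z y < d2 \<Longrightarrow> dist (u z) (u y) < e / (K + 1)"
      using u e K(2) unfolding continuous_at_eps_delta by (metis add_pos_pos divide_pos_pos zero_less_one)
    show "\<exists>d>0. \<forall>z. norm (z - y) < d \<longrightarrow>
       norm (r z *\<^sub>R (u z - u y) - r y *\<^sub>R (u y - u y) - 0) \<le> e * norm (z - y)"
    proof (intro exI[of _ "min d1 d2"] conjI allI impI)
      fix z assume z: "norm (z - y) < min d1 d2"
      have "norm (r z) \<le> norm (r z - r y - r' (z - y)) + norm (r' (z - y))"
        using r(2) norm_triangle_sub[of "r z" "r' (z - y)"] by simp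
      also have "\<dots> \<le> (K + 1) * norm (z - y)"
        using d1(2)[of z] z K(1)[of "z - y"] by (simp add: algebra_simps)
      finally have a: "norm (r z) \<le> (K + 1) * norm (z - y)" .
      have b: "norm (u z - u y) \<le> e / (K + 1)"
        using d2(2)[of z] z by (simp add: dist_norm)
      have "norm (r z *\<^sub>R (u z - u y)) \<le> ((K + 1) * norm (z - y)) * (e / (K + 1))"
        unfolding norm_scaleR using a b by (intro mult_mono) (use K(2) in auto)
      also have "\<dots> = e * norm (z - y)" using K(2) by simp
      finally show "norm (r z *\<^sub>R (u z - u y) - r y *\<^sub>R (u y - u y) - 0) \<le> e * norm (z - y)" by simp
    qed (use d1 d2 in auto)
  qed simp
  have "((\<lambda>z. r z *\<^sub>R u y + r z *\<^sub>R (u z - u y)) has_derivative (\<lambda>h. r' h *\<^sub>R u y + 0)) (at y)"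
    by (rule has_derivative_add[OF 1 2])
  then show ?thesis by (simp add: scaleR_diff_right)
qed

lemma has_derivative_apply_vanishing:
  fixes B :: "'a::euclidean_space \<Rightarrow> 'b::euclidean_space \<Rightarrow> 'c::euclidean_space"
  assumes f: "(f has_derivative f') (at y)" "f y = 0"
    and B: "open V" "y \<in> V" "\<And>z. z \<in> V \<Longrightarrow> linear (B z)" "\<And>b. continuous (at y) (\<lambda>z. B z b)"
  shows "((\<lambda>z. B z (f z)) has_derivative (\<lambda>h. B y (f' h))) (at y)"
proof -
  have "((\<lambda>z. \<Sum>b\<in>Basis. (f z \<bullet> b) *\<^sub>R B z b) has_derivative (\<lambda>h. \<Sum>b\<in>Basis. (f' h \<bullet> b) *\<^sub>R B y b)) (at y)"
    by (intro has_derivative_sum has_derivative_scaleR_vanishing has_derivative_inner_left f B)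
      (simp add: f)
  moreover have "(\<Sum>b\<in>Basis. (f' h \<bullet> b) *\<^sub>R B y b) = B y (f' h)" for h
    using linear_basis_expansion[OF B(3)[OF B(2)], of "f' h"] by simp
  ultimately have "((\<lambda>z. \<Sum>b\<in>Basis. (f z \<bullet> b) *\<^sub>R B z b) has_derivative (\<lambda>h. B y (f' h))) (at y)"
    by simp
  then show ?thesis
    by (rule has_derivative_transform_within_open[OF _ B(1,2)])
      (use linear_basis_expansion[OF B(3)] in metis)
qed

text \<open>A continuously differentiable inverse comes from the classical theorem; the remaining
  work is to bootstrap its regularity. Its derivative \<open>g' y\<close> is the inverse of
  \<open>f' (g y)\<close>, and instead of differentiating the inversion of operators, increments of
  \<open>g'\<close> are written through a resolvent identity. The normalization of the derivative to
  the identity matches the map built in \<open>ex_local_section\<close>.\<close>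

theorem smooth_inverse_function:
  fixes f :: "'a::euclidean_space \<Rightarrow> 'a"
  assumes U: "open U" and f: "smooth_on U f" and x0: "x0 \<in> U"
    and id: "(f has_derivative (\<lambda>h. h)) (at x0)"
  obtains V g where "open V" "f x0 \<in> V" "smooth_on V g" "g ` V \<subseteq> U"
    "\<And>y. y \<in> V \<Longrightarrow> f (g y) = y" "g (f x0) = x0"
proof -
  define f' where "f' x = Blinfun (frechet_derivative f (at x))" for x
  have der: "(f has_derivative frechet_derivative f (at x)) (at x)" if "x \<in> U" for x
    by (rule smooth_on_has_derivative[OF f U that])
  have f': "blinfun_apply (f' x) = frechet_derivative f (at x)" if "x \<in> U" for x
    unfolding f'_def
    by (rule bounded_linear_Blinfun_apply[OF has_derivative_bounded_linear[OF der[OF that]]])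
  have contf': "continuous_on U f'"
  proof (rule continuous_on_blinfun_componentwise)
    fix b :: 'a
    have "continuous_on U (\<lambda>x. frechet_derivative f (at x) b)"
      using Ck_on_frechet_derivative[OF f U, of 0 b] by simp
    then show "continuous_on U (\<lambda>x. blinfun_apply (f' x) b)"
      by (rule continuous_on_cong[THEN iffD1, rotated 2]) (auto simp: f')
  qed
  have f'x0: "f' x0 = id_blinfun"
    by (rule blinfun_eqI) (use f'[OF x0] frechet_derivative_at[OF id] in auto)
  \<comment> \<open>Distance below \<open>1/2\<close> from the identity bounds every inverse
    derivative by \<open>2\<close>: for \<open>h = g' y v\<close> one has
    \<open>v - h = (f' (g y) - id) h\<close>, of norm at most half that of \<open>h\<close>.\<close>
  define U1 where "U1 = {x \<in> U. dist (f' x) id_blinfun < 1/2}"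
  have U1: "open U1"
  proof -
    have "U1 = U \<inter> f' -` ball id_blinfun (1/2)" by (auto simp: U1_def dist_commute)
    then show ?thesis using continuous_on_open_vimage[OF U] contf' by (metis Int_commute open_ball)
  qed
  have x0': "x0 \<in> U1" using x0 f'x0 by (simp add: U1_def)
  have U1U: "U1 \<subseteq> U" by (auto simp: U1_def)
  obtain U' V g g' where ift: "open U'" "U' \<subseteq> U1" "x0 \<in> U'" "open V" "f x0 \<in> V" "homeomorphism U' V f g"
    "\<And>y. y \<in> V \<Longrightarrow> (g has_derivative (g' y)) (at y)"
    "\<And>y. y \<in> V \<Longrightarrow> g' y = inv_into UNIV (blinfun_apply (f'(g y)))"
    "\<And>y. y \<in> V \<Longrightarrow> bij (blinfun_apply (f'(g y)))"
  proof (rule inverse_function_theorem[OF U1, of f f' x0 id_blinfun])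
    show "(f has_derivative blinfun_apply (f' x)) (at x)" if "x \<in> U1" for x
      using der f' that U1U by (metis subsetD)
    show "continuous_on U1 f'" using contf' U1U continuous_on_subset by blast
    show "id_blinfun o\<^sub>L f' x0 = id_blinfun" by (rule blinfun_eqI) (simp add: f'x0)
  qed (use x0' in auto)
  have gU: "g y \<in> U1" if "y \<in> V" for y
    using ift(2,6) that by (auto simp: homeomorphism_def)
  have fg: "f (g y) = y" if "y \<in> V" for y using ift(6) that by (auto simp: homeomorphism_def)
  have gx0: "g (f x0) = x0" using ift(3,6) by (auto simp: homeomorphism_def)
  have contg: "continuous_on V g" using ift(6) by (auto simp: homeomorphism_def)
  have inv1: "f' (g y) (g' y h) = h" if "y \<in> V" for y h
    using ift(8,9)[OF that] by (metis bij_inv_eq_iff)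
  have inv2: "g' y (f' (g y) h) = h" if "y \<in> V" for y h
    using ift(8,9)[OF that] by (metis bij_inv_eq_iff)
  have ling: "linear (g' y)" if "y \<in> V" for y using ift(7)[OF that] has_derivative_linear by blast
  have bound: "norm (g' y v) \<le> 2 * norm v" if y: "y \<in> V" for y v
  proof -
    let ?h = "g' y v"
    have "norm ((f' (g y) - id_blinfun) ?h) \<le> 1/2 * norm ?h"
    proof (rule order_trans[OF norm_blinfun], rule mult_right_mono)
      show "norm (f' (g y) - id_blinfun) \<le> 1/2" using gU[OF y] by (simp add: U1_def dist_norm)
    qed simp
    then have "norm (v - ?h) \<le> 1/2 * norm ?h"
      using inv1[OF y, of v] by (simp add: blinfun.diff_left)
    then show ?thesis using norm_triangle_ineq2[of ?h v] by (simp add: norm_minus_commute)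
  qed
  define F where "F z = frechet_derivative f (at (fst z)) (snd z)" for z :: "'a \<times> 'a"
  have F: "smooth_on (U \<times> UNIV) F" unfolding F_def by (rule smooth_on_frechet_derivative[OF f U])
  have opF: "open (U \<times> (UNIV::'a set))" using U by (simp add: open_Times)
  have F': "F (g y, v) = f' (g y) v" if "y \<in> V" for y v
    using f' gU[OF that] U1U by (auto simp: F_def)
  define F' where "F' z = frechet_derivative F (at z)" for z
  have derF: "(F has_derivative F' z) (at z)" if "z \<in> U \<times> UNIV" for z
    unfolding F'_def by (rule smooth_on_has_derivative[OF F opF that])
  \<comment> \<open>The resolvent identity
    \<open>B - A = B (A\<^sup>-\<^sup>1 - B\<^sup>-\<^sup>1) A\<close> for \<open>A = g' y\<close>
    and \<open>B = g' z\<close>, applied to \<open>v\<close>.\<close>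
  have step: "g' z v = g' y v + g' z (F (g y, g' y v) - F (g z, g' y v))" if "y \<in> V" "z \<in> V" for y z v
    using that by (simp add: F' inv1 inv2 linear_diff[OF ling])
  have derphi: "((\<lambda>z. F (g y, g' y v) - F (g z, g' y v)) has_derivative (\<lambda>h. - F' (g y, g' y v) (g' y h, 0))) (at y)"
    if y: "y \<in> V" for y v
  proof -
    have "((\<lambda>z. (g z, g' y v)) has_derivative (\<lambda>h. (g' y h, 0))) (at y)"
      using ift(7)[OF y] by (auto intro!: derivative_eq_intros)
    then have "((\<lambda>z. F (g z, g' y v)) has_derivative (\<lambda>h. F' (g y, g' y v) (g' y h, 0))) (at y)"
      by (rule has_derivative_compose[where g = F]) (rule derF, use gU[OF y] U1U in auto)
    then show ?thesis by (auto intro!: derivative_eq_intros)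
  qed
  have contg': "continuous (at y) (\<lambda>z. g' z v)" if y: "y \<in> V" for y v
  proof -
    let ?p = "\<lambda>z. F (g y, g' y v) - F (g z, g' y v)"
    have "isCont ?p y" using has_derivative_continuous[OF derphi[OF y]] .
    then have "?p \<midarrow>y\<rightarrow> 0" by (simp add: isCont_def)
    then have p: "(\<lambda>z. 2 * norm (?p z)) \<midarrow>y\<rightarrow> 0"
      by (intro tendsto_mult_right_zero tendsto_norm_zero)
    have "(\<lambda>z. g' z v - g' y v) \<midarrow>y\<rightarrow> 0"
    proof (rule Lim_null_comparison[OF _ p])
      have "norm (g' z v - g' y v) \<le> 2 * norm (?p z)" if "z \<in> V" for z
        using step[OF y that, of v] bound[OF that, of "?p z"] by simp
      then show "eventually (\<lambda>z. norm (g' z v - g' y v) \<le> 2 * norm (?p z)) (at y)"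
        using eventually_at_in_open'[OF ift(4) y] by (auto elim: eventually_mono)
    qed
    then show ?thesis by (simp add: isCont_def LIM_zero_iff)
  qed
  \<comment> \<open>The argument of \<open>g' z\<close> in \<open>step\<close> vanishes at
    \<open>z = y\<close>, so the continuity of \<open>g'\<close> just shown suffices to
    differentiate.\<close>
  have derg': "((\<lambda>z. g' z v) has_derivative (\<lambda>h. g' y (- F' (g y, g' y v) (g' y h, 0)))) (at y)"
    if y: "y \<in> V" for y v
  proof -
    let ?p = "\<lambda>z. F (g y, g' y v) - F (g z, g' y v)"
    have "((\<lambda>z. g' z (?p z)) has_derivative (\<lambda>h. g' y (- F' (g y, g' y v) (g' y h, 0)))) (at y)"
      by (rule has_derivative_apply_vanishing[OF derphi[OF y] _ ift(4) y ling contg'[OF y]]) auto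
    then have "((\<lambda>z. g' y v + g' z (?p z)) has_derivative (\<lambda>h. g' y (- F' (g y, g' y v) (g' y h, 0)))) (at y)"
      by (auto intro!: derivative_eq_intros)
    then show ?thesis
      by (rule has_derivative_transform_within_open[OF _ ift(4) y]) (rule step[OF y, symmetric])
  qed
  \<comment> \<open>Both claims advance together: the derivative of \<open>g\<close> is
    \<open>g'\<close>, and that of \<open>g'\<close> is an expression in \<open>g\<close>,
    \<open>g'\<close> and the derivative \<open>F'\<close> of the smooth map
    \<open>F\<close>.\<close>
  have "Ck_on k V g \<and> (\<forall>v. Ck_on k V (\<lambda>y. g' y v))" for k
  proof (induction k)
    case 0
    show ?case using contg contg' by (auto intro!: continuous_at_imp_continuous_on)
  next
    case (Suc k)
    then have g: "Ck_on k V g" and g': "\<And>v. Ck_on k V (\<lambda>y. g' y v)" by auto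
    have "Ck_on (Suc k) V g" by (rule Ck_on_SucI[OF ift(4) ift(7) g'])
    moreover have "Ck_on (Suc k) V (\<lambda>y. g' y v)" for v
    proof (rule Ck_on_SucI[OF ift(4) derg'])
      fix h
      have im: "(g y, g' y v) \<in> U \<times> UNIV" if "y \<in> V" for y using gU that U1U by auto
      have "Ck_on k V (\<lambda>y. F' (g y, g' y v) (g' y h, 0))"
      proof (rule Ck_on_apply_linear[OF ift(4), where A = "\<lambda>y. F' (g y, g' y v)" and w = "\<lambda>y. (g' y h, 0)"])
        show "linear (F' (g y, g' y v))" if "y \<in> V" for y
          using derF[OF im[OF that]] has_derivative_linear by blast
        show "Ck_on k V (\<lambda>y. F' (g y, g' y v) b)" for b
          unfolding F'_def
          by (rule Ck_on_compose[OF ift(4) opF Ck_on_Pair[OF ift(4) g g'] Ck_on_frechet_derivative[OF F opF]])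
            (use im in auto)
        show "Ck_on k V (\<lambda>y. (g' y h, 0))" by (rule Ck_on_Pair[OF ift(4) g' Ck_on_const])
      qed
      from Ck_on_linear_comp[OF bounded_linear_minus[OF bounded_linear_ident] ift(4) this]
      have "Ck_on k V (\<lambda>y. - F' (g y, g' y v) (g' y h, 0))" .
      then show "Ck_on k V (\<lambda>y. g' y (- F' (g y, g' y v) (g' y h, 0)))"
        by (rule Ck_on_apply_linear[OF ift(4) ling g', rotated -1])
    qed
    ultimately show ?case by blast
  qed
  then have "smooth_on V g" using smooth_on_Ck[OF ift(4)] by blast
  then show thesis using that[OF ift(4,5) _ _ fg gx0] gU U1U by blast
qed

section \<open>Local solutions of ordinary differential equations\<close>

lemma integral_increment_bound:
  fixes f :: "real \<Rightarrow> 'b::euclidean_space"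
  assumes f: "continuous_on {a..b} f" "\<And>s. s \<in> {a..b} \<Longrightarrow> norm (f s) \<le> B"
    and st: "s \<in> {a..b}" "t \<in> {a..b}"
  shows "norm (integral {a..t} f - integral {a..s} f) \<le> B * \<bar>t - s\<bar>"
proof -
  have *: "norm (integral {a..t} f - integral {a..s} f) \<le> B * (t - s)"
    if st: "s \<in> {a..b}" "t \<in> {a..b}" "s \<le> t" for s t
  proof -
    have "integral {a..s} f + integral {s..t} f = integral {a..t} f"
      by (rule Henstock_Kurzweil_Integration.integral_combine)
        (use st in \<open>auto intro!: integrable_continuous_interval continuous_on_subset[OF f(1)]\<close>)
    then have "integral {a..t} f - integral {a..s} f = integral {s..t} f" by (simp add: algebra_simps)
    moreover have "norm (integral {s..t} f) \<le> B * (t - s)"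
      by (rule integral_bound) (use st f(2) in \<open>auto intro!: continuous_on_subset[OF f(1)]\<close>)
    ultimately show ?thesis by simp
  qed
  show ?thesis
  proof (cases "s \<le> t")
    case True then show ?thesis using *[OF st] by simp
  next
    case False then show ?thesis using *[OF st(2,1)] by (simp add: norm_minus_commute)
  qed
qed

text \<open>The operator norm of the derivative is at most the sum of its norms on the basis, a
  continuous function and thus bounded on \<open>K\<close>; convexity then allows the mean value
  inequality.\<close>

lemma smooth_on_lipschitz_compact:
  fixes F :: "'a::euclidean_space \<Rightarrow> 'b::euclidean_space"
  assumes F: "open U" "smooth_on U F" and K: "compact K" "convex K" "K \<subseteq> U"
  obtains L where "L > 0" "\<And>x y. x \<in> K \<Longrightarrow> y \<in> K \<Longrightarrow> norm (F x - F y) \<le> L * norm (x - y)"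
proof -
  let ?D = "\<lambda>z. frechet_derivative F (at z)"
  let ?N = "\<lambda>z. \<Sum>b\<in>Basis. norm (?D z b)"
  have "continuous_on U (\<lambda>z. ?D z b)" for b
    using Ck_on_frechet_derivative[OF F(2,1), of 0 b] by simp
  then have "continuous_on K (\<lambda>z. ?D z b)" for b
    using K(3) continuous_on_subset by blast
  then have "continuous_on K ?N" by (intro continuous_intros) auto
  then have "bounded (?N ` K)" using K(1) compact_continuous_image compact_imp_bounded by blast
  then obtain L where L: "L > 0" "\<And>z. z \<in> K \<Longrightarrow> norm (?N z) \<le> L"
    by (auto simp: bounded_pos)
  have der: "(F has_derivative ?D z) (at z)" if "z \<in> K" for z
    using smooth_on_has_derivative[OF F(2,1)] K(3) that by blast
  have "onorm (?D z) \<le> L" if z: "z \<in> K" for z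
  proof (rule onorm_le)
    fix h
    have "norm (?D z h) = norm (\<Sum>b\<in>Basis. (h \<bullet> b) *\<^sub>R ?D z b)"
      using linear_basis_expansion[OF has_derivative_linear[OF der[OF z]], of h] by simp
    also have "\<dots> \<le> (\<Sum>b\<in>Basis. norm h * norm (?D z b))"
      by (intro order_trans[OF norm_sum] sum_mono) (auto intro!: mult_right_mono Basis_le_norm)
    also have "\<dots> = ?N z * norm h" by (simp add: sum_distrib_left mult.commute)
    also have "\<dots> \<le> L * norm h" using L(2)[OF z] by (intro mult_right_mono) auto
    finally show "norm (?D z h) \<le> L * norm h" .
  qed
  then have "norm (F x - F y) \<le> L * norm (x - y)" if "x \<in> K" "y \<in> K" for x y
    by (intro differentiable_bound[OF K(2) has_derivative_at_withinI[OF der]]) (use that in auto)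
  then show thesis using L(1) that by blast
qed

lemma picard_solution:
  fixes F :: "real \<times> 'e::euclidean_space \<Rightarrow> 'e"
  assumes U: "open U" and F: "smooth_on U F" and p: "(t0, y0) \<in> U"
  obtains d y where "d > 0" "y t0 = y0"
    "\<And>t. t \<in> {t0-d<..<t0+d} \<Longrightarrow> (t, y t) \<in> U \<and> (y has_vector_derivative F (t, y t)) (at t)"
proof -
  obtain r0 where r0: "r0 > 0" "cball (t0, y0) r0 \<subseteq> U" using U p open_contains_cball by blast
  \<comment> \<open>A point of the product of two balls of radius \<open>r\<close> has distance at
    most \<open>2 * r = r0\<close> from the centre.\<close>
  define r where "r = r0 / 2"
  have r: "r > 0" using r0 by (simp add: r_def)
  define K where "K = {t0-r..t0+r} \<times> cball y0 r"
  have KU: "K \<subseteq> U"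
  proof
    fix z assume "z \<in> K"
    then obtain t y where z: "z = (t, y)" "dist t0 t \<le> r" "dist y0 y \<le> r"
      by (auto simp: K_def dist_real_def)
    have "dist (t0, y0) (t, y) \<le> dist t0 t + dist y0 y"
      unfolding dist_Pair_Pair by (intro sqrt_sum_squares_le_sum) auto
    then show "z \<in> U" using r0(2) z by (auto simp: r_def)
  qed
  have K: "compact K" "convex K" by (auto simp: K_def intro: compact_Times convex_Times)
  have contF: "continuous_on K F" using smooth_on_imp_continuous_on[OF F] KU continuous_on_subset by blast
  then have "bounded (F ` K)" using K(1) compact_continuous_image compact_imp_bounded by blast
  then obtain C where C: "C > 0" "\<And>z. z \<in> K \<Longrightarrow> norm (F z) \<le> C" by (auto simp: bounded_pos)
  obtain L where L: "L > 0" "\<And>x y. x \<in> K \<Longrightarrow> y \<in> K \<Longrightarrow> norm (F x - F y) \<le> L * norm (x - y)"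
    using smooth_on_lipschitz_compact[OF U F K KU] by blast
  \<comment> \<open>\<open>d \<le> r\<close> keeps times inside \<open>K\<close>,
    \<open>C * d \<le> r\<close> keeps Picard iterates inside the ball, and
    \<open>L * d \<le> 1/2\<close> makes the iteration a contraction.\<close>
  define d where "d = min r (min (r / C) (1 / (2 * L)))"
  have d: "d > 0" "d \<le> r" "C * d \<le> r" "L * d \<le> 1/2"
  proof -
    show "d > 0" "d \<le> r" using r C L by (auto simp: d_def)
    have "d \<le> r / C" by (simp add: d_def)
    then show "C * d \<le> r" using C(1) by (simp add: field_simps)
    have "d \<le> 1 / (2 * L)" by (simp add: d_def)
    then show "L * d \<le> 1/2" using L(1) by (simp add: field_simps)
  qed
  define a b where "a = t0 - d" and "b = t0 + d"
  have ab: "a \<le> t0" "t0 \<le> b" "a \<le> b" using d by (auto simp: a_def b_def)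
  \<comment> \<open>Clamping time to \<open>[a, b]\<close> turns iterates into bounded continuous
    functions on the whole line, a complete space in which the fixed point theorem applies.\<close>
  define cl where "cl s = max a (min b s)" for s
  have cl: "cl s \<in> {a..b}" for s using ab by (auto simp: cl_def)
  have cl_id: "s \<in> {a..b} \<Longrightarrow> cl s = s" for s by (auto simp: cl_def)
  define S where "S = {y :: real \<Rightarrow>\<^sub>C 'e. \<forall>t. y t \<in> cball y0 r}"
  define f where "f y s = F (s, apply_bcontfun y s)" for y s
  have inK: "(s, apply_bcontfun y s) \<in> K" if "y \<in> S" "s \<in> {a..b}" for y s
    using that d(2) by (auto simp: K_def S_def a_def b_def)
  have contf: "continuous_on {a..b} (f y)" if "y \<in> S" for y
    unfolding f_def
    by (rule continuous_on_compose2[OF contF]) (use inK[OF that] in \<open>auto intro!: continuous_intros\<close>)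
  define J where "J y t = integral {a..t} (f y)" for y t
  \<comment> \<open>The integral from \<open>t0\<close> to \<open>t\<close> is written as a
    difference of integrals from \<open>a\<close>, which treats times before and after
    \<open>t0\<close> alike.\<close>
  define T where "T y t = y0 + J y (cl t) - J y t0" for y t
  have dcl: "\<bar>cl t - t0\<bar> \<le> d" for t using cl[of t] by (auto simp: a_def b_def)
  have Tball: "T y t \<in> cball y0 r" if y: "y \<in> S" for y t
  proof -
    have "norm (J y (cl t) - J y t0) \<le> C * \<bar>cl t - t0\<bar>"
      unfolding J_def
      by (rule integral_increment_bound[OF contf[OF y]])
        (use ab cl C(2) inK[OF y] in \<open>auto simp: f_def\<close>)
    also have "\<dots> \<le> C * d" using dcl C(1) by (intro mult_left_mono) auto
    finally have "norm (J y (cl t) - J y t0) \<le> r" using d(3) by simp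
    then show ?thesis by (simp add: T_def dist_norm norm_minus_commute)
  qed
  have Tcont: "T y \<in> bcontfun" if y: "y \<in> S" for y
  proof -
    have "continuous_on {a..b} (J y)"
      unfolding J_def by (rule indefinite_integral_continuous_1[OF integrable_continuous_interval[OF contf[OF y]]])
    then have "continuous_on UNIV (\<lambda>t. J y (cl t))"
      by (rule continuous_on_compose2) (use cl in \<open>auto simp: cl_def intro!: continuous_intros\<close>)
    then have "continuous_on UNIV (T y)" unfolding T_def by (intro continuous_intros)
    moreover have "bounded (range (T y))" using Tball[OF y] bounded_subset[OF bounded_cball] by blast
    ultimately show ?thesis by (simp add: bcontfun_def)
  qed
  define TT where "TT y = Bcontfun (T y)" for y
  have TT: "apply_bcontfun (TT y) = T y" if "y \<in> S" for y
    unfolding TT_def by (rule Bcontfun_inverse[OF Tcont[OF that]])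
  have "\<exists>!y\<in>S. TT y = y"
  proof (rule Banach_fix[where c = "1/2"])
    have "S = PiC UNIV (\<lambda>_. cball y0 r)" by (auto simp: S_def mem_PiC_iff Pi_iff)
    then show "complete S" unfolding complete_eq_closed using closed_PiC[of UNIV "\<lambda>_. cball y0 r"] by simp
    have "const_bcontfun y0 \<in> S" using r by (simp add: S_def)
    then show "S \<noteq> {}" by blast
    show "TT ` S \<subseteq> S" using TT Tball by (auto simp: S_def simp del: mem_cball)
    show "dist (TT x) (TT y) \<le> 1/2 * dist x y" if x: "x \<in> S" and y: "y \<in> S" for x y
    proof (rule dist_bound)
      fix t
      let ?g = "\<lambda>s. f x s - f y s"
      have int: "f x integrable_on {a..u}" "f y integrable_on {a..u}" if "u \<in> {a..b}" for u
        using that by (auto intro!: integrable_continuous_interval continuous_on_subset[OF contf] x y)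
      have "J x u - J y u = integral {a..u} ?g" if "u \<in> {a..b}" for u
        unfolding J_def using integral_diff[OF int[OF that]] by simp
      then have eq: "T x t - T y t = integral {a..cl t} ?g - integral {a..t0} ?g"
        using cl[of t] ab by (simp add: T_def algebra_simps)
      have "norm (integral {a..cl t} ?g - integral {a..t0} ?g) \<le> (L * dist x y) * \<bar>cl t - t0\<bar>"
      proof (rule integral_increment_bound)
        show "continuous_on {a..b} ?g" by (intro continuous_intros contf x y)
        fix s assume s: "s \<in> {a..b}"
        have "norm (f x s - f y s) \<le> L * norm ((s, apply_bcontfun x s) - (s, apply_bcontfun y s))"
          unfolding f_def by (rule L(2)[OF inK[OF x s] inK[OF y s]])
        also have "\<dots> = L * dist (x s) (y s)" by (simp add: norm_Pair dist_norm)
        also have "\<dots> \<le> L * dist x y" using L(1) dist_bounded[of x s y] by (intro mult_left_mono) auto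
        finally show "norm (f x s - f y s) \<le> L * dist x y" .
      qed (use ab cl in auto)
      moreover have "(L * dist x y) * \<bar>cl t - t0\<bar> \<le> (L * dist x y) * d"
        using dcl L(1) by (intro mult_left_mono) auto
      moreover have "(L * dist x y) * d \<le> 1/2 * dist x y"
        using mult_right_mono[OF d(4), of "dist x y"] by (simp add: algebra_simps)
      ultimately have "norm (T x t - T y t) \<le> 1/2 * dist x y" unfolding eq by linarith
      then show "dist (TT x t) (TT y t) \<le> 1/2 * dist x y"
        unfolding TT[OF x] TT[OF y] dist_norm[of "T x t"] .
    qed
  qed auto
  then obtain y where y: "y \<in> S" "TT y = y" by blast
  then have yT: "apply_bcontfun y t = T y t" for t using TT by metis
  show thesis
  proof (rule that[OF d(1), of y])
    show "apply_bcontfun y t0 = y0" using yT[of t0] cl_id[of t0] ab by (simp add: T_def)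
    fix t assume "t \<in> {t0-d<..<t0+d}"
    then have t: "t \<in> {a<..<b}" by (simp add: a_def b_def)
    have "(t, apply_bcontfun y t) \<in> U" using inK[OF y(1)] t KU by auto
    moreover have "(apply_bcontfun y has_vector_derivative F (t, apply_bcontfun y t)) (at t)"
    proof -
      have "(J y has_vector_derivative f y t) (at t within {a..b})"
        unfolding J_def by (rule integral_has_vector_derivative[OF contf[OF y(1)]]) (use t in auto)
      then have "(J y has_vector_derivative f y t) (at t)" using t by (simp add: at_within_Icc_at)
      then have "((\<lambda>t. y0 + J y t - J y t0) has_vector_derivative f y t) (at t)"
        by (auto intro!: derivative_eq_intros)
      then show ?thesis
        unfolding f_def
        by (rule has_vector_derivative_transform_within_open[of _ _ _ "{a<..<b}"])
          (use t yT cl_id in \<open>auto simp: T_def\<close>)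
    qed
    ultimately show "(t, apply_bcontfun y t) \<in> U \<and>
        (apply_bcontfun y has_vector_derivative F (t, apply_bcontfun y t)) (at t)" by blast
  qed
qed

text \<open>Bootstrapping: if \<open>y\<close> is of class \<open>k\<close>, then so is
  \<open>F (t, y t)\<close>, which is the derivative of \<open>y\<close>.\<close>

lemma smooth_on_ode_solution:
  fixes F :: "real \<times> 'e::euclidean_space \<Rightarrow> 'e"
  assumes U: "open U" and F: "smooth_on U F" and J: "open J"
    and y: "\<And>t. t \<in> J \<Longrightarrow> (t, y t) \<in> U \<and> (y has_vector_derivative F (t, y t)) (at t)"
  shows "smooth_on J y"
proof (rule smooth_on_Ck[OF J])
  have y': "(y has_derivative (\<lambda>h. h *\<^sub>R F (t, y t))) (at t)" if "t \<in> J" for t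
    using y[OF that] by (simp add: has_vector_derivative_def)
  show "Ck_on k J y" for k
  proof (induction k)
    case 0
    then show ?case
      using y' by (auto intro!: continuous_at_imp_continuous_on has_derivative_continuous)
  next
    case (Suc k)
    show ?case
    proof (rule Ck_on_SucI[OF J y'])
      have "Ck_on k J (\<lambda>t. F (t, y t))"
        by (rule Ck_on_compose[OF J U Ck_on_Pair[OF J Ck_on_id[OF J] Suc] Ck_on_smooth[OF F U]])
          (use y in auto)
      then show "Ck_on k J (\<lambda>t. v *\<^sub>R F (t, y t))" for v
        by (rule Ck_on_linear_comp[OF bounded_linear_scaleR_right J])
    qed
  qed
qed

section \<open>Manifolds and smooth parametrizations\<close>

text \<open>The Hausdorff property is never needed; without it, products are immediate.\<close>

definition smooth_atlas :: "('p, 'e::euclidean_space) manifold \<Rightarrow> bool" where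
  "smooth_atlas X \<longleftrightarrow>
     subspace (model X) \<and>
     (\<forall>(U, \<phi>) \<in> atlas X. inj_on \<phi> U) \<and>
     (\<forall>(U, \<phi>) \<in> atlas X. \<forall>(W, \<psi>) \<in> atlas X.
        openin (top_of_set (model X)) (\<phi> ` (U \<inter> W)) \<and>
        smooth_on (\<phi> ` (U \<inter> W)) (\<psi> \<circ> inv_into U \<phi>))"

lemma smooth_manifold_atlas: "smooth_manifold X \<Longrightarrow> smooth_atlas X"
  by (simp add: smooth_manifold_def smooth_atlas_def)

text \<open>Images under an injective chart commute with intersections, so the sets in question form
  a topology. The tangent bundle gets its open sets from this rule, with the injectivity of its
  charts as the sole input.\<close>

lemma openin_mtop_inj:
  assumes inj: "\<And>U \<phi>. (U, \<phi>) \<in> atlas X \<Longrightarrow> inj_on \<phi> U"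
  shows "openin (mtop X) W \<longleftrightarrow> W \<subseteq> points X \<and>
     (\<forall>(U, \<phi>) \<in> atlas X. openin (top_of_set (model X)) (\<phi> ` (W \<inter> U)))"
proof -
  let ?L = "\<lambda>W. W \<subseteq> points X \<and>
     (\<forall>(U, \<phi>) \<in> atlas X. openin (top_of_set (model X)) (\<phi> ` (W \<inter> U)))"
  have Int: "\<phi> ` (S \<inter> T \<inter> U) = \<phi> ` (S \<inter> U) \<inter> \<phi> ` (T \<inter> U)" if "(U, \<phi>) \<in> atlas X" for U \<phi> S T
    using inj[OF that] by (auto simp: inj_on_def)
  have Un: "\<phi> ` (\<Union>\<K> \<inter> U) = (\<Union>K\<in>\<K>. \<phi> ` (K \<inter> U))" for \<phi> :: "'a \<Rightarrow> 'b" and \<K> U by blast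
  have "istopology ?L"
    unfolding istopology_def by (auto simp: Int Un case_prod_unfold intro!: openin_Int openin_Union)
  then show ?thesis by (simp add: mtop_def)
qed

context
  fixes X :: "('p, 'e::euclidean_space) manifold"
  assumes X: "smooth_atlas X"
begin

lemma subspace_model: "subspace (model X)"
  using X by (simp add: smooth_atlas_def)

lemma chart_inj: "(U, \<phi>) \<in> atlas X \<Longrightarrow> inj_on \<phi> U"
  using X by (auto simp: smooth_atlas_def)

lemma chart_image_Int: "(U, \<phi>) \<in> atlas X \<Longrightarrow> (W, \<psi>) \<in> atlas X \<Longrightarrow> openin (top_of_set (model X)) (\<phi> ` (U \<inter> W))"
  using X by (auto simp: smooth_atlas_def)

lemma chart_image: "(U, \<phi>) \<in> atlas X \<Longrightarrow> openin (top_of_set (model X)) (\<phi> ` U)"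
  using chart_image_Int[of U \<phi> U \<phi>] by simp

lemma chart_model: "(U, \<phi>) \<in> atlas X \<Longrightarrow> p \<in> U \<Longrightarrow> \<phi> p \<in> model X"
  using chart_image openin_imp_subset by blast

lemma chart_transition:
  "(U, \<phi>) \<in> atlas X \<Longrightarrow> (W, \<psi>) \<in> atlas X \<Longrightarrow> smooth_on (\<phi> ` (U \<inter> W)) (\<lambda>x. \<psi> (inv_into U \<phi> x))"
  using X by (auto simp: smooth_atlas_def comp_def)

lemma chart_inv: "(U, \<phi>) \<in> atlas X \<Longrightarrow> p \<in> U \<Longrightarrow> inv_into U \<phi> (\<phi> p) = p"
  using chart_inj by simp

lemma chart_points: "(U, \<phi>) \<in> atlas X \<Longrightarrow> U \<subseteq> points X"
  by (force simp: points_def)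

lemma points_chart: "p \<in> points X \<Longrightarrow> \<exists>U \<phi>. (U, \<phi>) \<in> atlas X \<and> p \<in> U"
  by (force simp: points_def)

lemma openin_mtop_iff: "openin (mtop X) W \<longleftrightarrow> W \<subseteq> points X \<and>
     (\<forall>(U, \<phi>) \<in> atlas X. openin (top_of_set (model X)) (\<phi> ` (W \<inter> U)))"
  by (rule openin_mtop_inj[OF chart_inj])

lemma openin_chart_image:
  "openin (mtop X) W \<Longrightarrow> (U, \<phi>) \<in> atlas X \<Longrightarrow> openin (top_of_set (model X)) (\<phi> ` (W \<inter> U))"
  by (auto simp: openin_mtop_iff)

lemma openin_chart_domain: "(U, \<phi>) \<in> atlas X \<Longrightarrow> openin (mtop X) U"
  using chart_image_Int chart_points by (auto simp: openin_mtop_iff Int_commute)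

lemma topspace_mtop: "topspace (mtop X) = points X"
proof -
  have "openin (mtop X) (points X)"
    using chart_image chart_points by (fastforce simp: openin_mtop_iff Int_absorb1)
  then show ?thesis
    by (metis openin_mtop_iff openin_subset openin_topspace subset_antisym)
qed

lemma openin_chart_vimage:
  assumes U: "(U, \<phi>) \<in> atlas X" and A: "openin (top_of_set (model X)) A"
  shows "openin (mtop X) {p \<in> U. \<phi> p \<in> A}"
  unfolding openin_mtop_iff
proof (intro conjI ballI; clarify?)
  show "x \<in> points X" if "x \<in> U" for x using chart_points[OF U] that by blast
  fix U' \<phi>' assume U': "(U', \<phi>') \<in> atlas X"
  let ?h = "\<lambda>x. \<phi> (inv_into U' \<phi>' x)"
  have eq: "\<phi>' ` ({p \<in> U. \<phi> p \<in> A} \<inter> U') = \<phi>' ` (U' \<inter> U) \<inter> ?h -` A"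
    using chart_inv[OF U'] by (auto intro!: imageI)
  have "continuous_on (\<phi>' ` (U' \<inter> U)) ?h"
    by (rule smooth_on_imp_continuous_on[OF chart_transition[OF U' U]])
  moreover have "?h \<in> \<phi>' ` (U' \<inter> U) \<rightarrow> model X"
    using chart_inv[OF U'] chart_model[OF U] by auto
  ultimately have "openin (top_of_set (\<phi>' ` (U' \<inter> U))) (\<phi>' ` (U' \<inter> U) \<inter> ?h -` A)"
    using A by (rule continuous_openin_preimage)
  then show "openin (top_of_set (model X)) (\<phi>' ` ({p \<in> U. \<phi> p \<in> A} \<inter> U'))"
    unfolding eq using chart_image_Int[OF U' U] openin_trans by blast
qed

lemma smooth_from_points: "smooth_from S X f \<Longrightarrow> s \<in> S \<Longrightarrow> f s \<in> points X"
  using topspace_mtop by (auto simp: smooth_from_def continuous_map_def)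

lemma smooth_from_vimage:
  "smooth_from S X f \<Longrightarrow> openin (mtop X) W \<Longrightarrow> openin (top_of_set S) (S \<inter> f -` W)"
  by (auto simp: smooth_from_def continuous_map_def vimage_def Int_def)

lemma smooth_from_chartD:
  "smooth_from S X f \<Longrightarrow> (U, \<phi>) \<in> atlas X \<Longrightarrow> smooth_on (S \<inter> f -` U) (\<lambda>s. \<phi> (f s))"
  by (auto simp: smooth_from_def comp_def)

lemma smooth_fromI:
  assumes "\<And>s. s \<in> S \<Longrightarrow> f s \<in> points X"
    and "\<And>W. openin (mtop X) W \<Longrightarrow> openin (top_of_set S) (S \<inter> f -` W)"
    and "\<And>U \<phi>. (U, \<phi>) \<in> atlas X \<Longrightarrow> smooth_on (S \<inter> f -` U) (\<lambda>s. \<phi> (f s))"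
  shows "smooth_from S X f"
  using assms by (auto simp: smooth_from_def continuous_map_def topspace_mtop vimage_def Int_def comp_def)

text \<open>One chart that contains all values decides smoothness: it maps open sets to relatively
  open sets, and the other charts are reached through the chart changes.\<close>

lemma smooth_fromI_chart:
  assumes U: "(U, \<phi>) \<in> atlas X" and f: "\<And>s. s \<in> S \<Longrightarrow> f s \<in> U" and sm: "smooth_on S (\<lambda>s. \<phi> (f s))"
  shows "smooth_from S X f"
proof (rule smooth_fromI)
  show "f s \<in> points X" if "s \<in> S" for s using f[OF that] chart_points[OF U] by blast
next
  fix W assume W: "openin (mtop X) W"
  have "S \<inter> f -` W = S \<inter> (\<lambda>s. \<phi> (f s)) -` (\<phi> ` (W \<inter> U))"
    using f chart_inj[OF U] by (auto simp: inj_on_def)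
  then show "openin (top_of_set S) (S \<inter> f -` W)"
    using continuous_openin_preimage[OF smooth_on_imp_continuous_on[OF sm] _ openin_chart_image[OF W U]]
      f chart_model[OF U] by (simp add: Pi_iff)
next
  fix W \<psi> assume W: "(W, \<psi>) \<in> atlas X"
  have "smooth_on (S \<inter> f -` W) (\<lambda>s. \<psi> (inv_into U \<phi> (\<phi> (f s))))"
    by (rule smooth_on_compose[OF smooth_on_subset[OF sm] chart_transition[OF U W]]) (use f in auto)
  then show "smooth_on (S \<inter> f -` W) (\<lambda>s. \<psi> (f s))"
    by (rule smooth_on_cong[THEN iffD1, rotated]) (use chart_inv[OF U] f in auto)
qed

lemma smooth_from_cong:
  assumes "smooth_from S X f" "\<And>s. s \<in> S \<Longrightarrow> f s = g s"
  shows "smooth_from S X g"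
proof (rule smooth_fromI)
  show "g s \<in> points X" if "s \<in> S" for s using smooth_from_points[OF assms(1) that] assms(2)[OF that] by simp
  have eq: "S \<inter> g -` W = S \<inter> f -` W" for W using assms(2) by auto
  show "openin (top_of_set S) (S \<inter> g -` W)" if "openin (mtop X) W" for W
    unfolding eq by (rule smooth_from_vimage[OF assms(1) that])
  show "smooth_on (S \<inter> g -` U) (\<lambda>s. \<phi> (g s))" if "(U, \<phi>) \<in> atlas X" for U \<phi>
    unfolding eq using smooth_from_chartD[OF assms(1) that] smooth_on_cong[of "S \<inter> f -` U"] assms(2)
    by (metis (no_types, lifting) IntD1)
qed

lemma smooth_from_comp:
  assumes h: "smooth_on S h" "\<And>s. s \<in> S \<Longrightarrow> h s \<in> T" and f: "smooth_from T X f"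
  shows "smooth_from S X (\<lambda>s. f (h s))"
proof (rule smooth_fromI)
  show "f (h s) \<in> points X" if "s \<in> S" for s using smooth_from_points[OF f h(2)[OF that]] .
  show "openin (top_of_set S) (S \<inter> (\<lambda>s. f (h s)) -` W)" if W: "openin (mtop X) W" for W
  proof -
    have "S \<inter> (\<lambda>s. f (h s)) -` W = S \<inter> h -` (T \<inter> f -` W)" using h(2) by auto
    then show ?thesis
      using continuous_openin_preimage[OF smooth_on_imp_continuous_on[OF h(1)] _ smooth_from_vimage[OF f W]]
        h(2) by (simp add: Pi_iff)
  qed
  show "smooth_on (S \<inter> (\<lambda>s. f (h s)) -` U) (\<lambda>s. \<phi> (f (h s)))" if "(U, \<phi>) \<in> atlas X" for U \<phi>
    by (rule smooth_on_compose[OF smooth_on_subset[OF h(1)] smooth_from_chartD[OF f that]]) (use h(2) in auto)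
qed

lemma smooth_from_subset: "smooth_from S X f \<Longrightarrow> T \<subseteq> S \<Longrightarrow> smooth_from T X f"
  using smooth_from_comp[OF smooth_on_id[of T], of S f] by auto

lemma smooth_from_local:
  assumes "\<And>x. x \<in> S \<Longrightarrow> \<exists>N. openin (top_of_set S) N \<and> x \<in> N \<and> smooth_from N X f"
  shows "smooth_from S X f"
proof (rule smooth_fromI)
  show "f s \<in> points X" if "s \<in> S" for s using assms[OF that] smooth_from_points by blast
next
  fix W assume W: "openin (mtop X) W"
  show "openin (top_of_set S) (S \<inter> f -` W)"
  proof (subst openin_subopen, intro ballI)
    fix x assume x: "x \<in> S \<inter> f -` W"
    then obtain N where N: "openin (top_of_set S) N" "x \<in> N" "smooth_from N X f" using assms by blast
    have "openin (top_of_set S) (N \<inter> f -` W)"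
      using smooth_from_vimage[OF N(3) W] N(1) openin_trans by blast
    then show "\<exists>T. openin (top_of_set S) T \<and> x \<in> T \<and> T \<subseteq> S \<inter> f -` W"
      using x N(1,2) openin_imp_subset by (intro exI[of _ "N \<inter> f -` W"]) blast
  qed
next
  fix U \<phi> assume U: "(U, \<phi>) \<in> atlas X"
  show "smooth_on (S \<inter> f -` U) (\<lambda>s. \<phi> (f s))"
  proof (rule smooth_on_local)
    fix x assume x: "x \<in> S \<inter> f -` U"
    then obtain N where N: "openin (top_of_set S) N" "x \<in> N" "smooth_from N X f" using assms by blast
    have "openin (top_of_set (S \<inter> f -` U)) (N \<inter> (S \<inter> f -` U))"
      using N(1) openin_subtopology_Int2 by (auto simp: openin_open)
    moreover have "smooth_on (N \<inter> (S \<inter> f -` U)) (\<lambda>s. \<phi> (f s))"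
      by (rule smooth_on_subset[OF smooth_from_chartD[OF N(3) U]]) auto
    ultimately show "\<exists>N. openin (top_of_set (S \<inter> f -` U)) N \<and> x \<in> N \<and> smooth_on N (\<lambda>s. \<phi> (f s))"
      using x N(2) by blast
  qed
qed

lemma smooth_from_inv_into: "(U, \<phi>) \<in> atlas X \<Longrightarrow> smooth_from (\<phi> ` U) X (inv_into U \<phi>)"
  by (rule smooth_fromI_chart, assumption, rule inv_into_into, assumption,
      rule smooth_on_cong[THEN iffD1, OF _ smooth_on_id], simp add: f_inv_into_f)

lemma smooth_from_const:
  assumes "p \<in> points X" shows "smooth_from S X (\<lambda>s. p)"
proof -
  obtain U \<phi> where U: "(U, \<phi>) \<in> atlas X" "p \<in> U" using points_chart[OF assms] by blast
  show ?thesis by (rule smooth_fromI_chart[OF U(1) U(2) smooth_on_const])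
qed

end

section \<open>Smooth maps between manifolds\<close>

lemma smooth_map_points:
  assumes "smooth_atlas X" "smooth_atlas Y" "smooth_map X Y F" "p \<in> points X"
  shows "F p \<in> points Y"
  using assms(3,4) unfolding smooth_map_def continuous_map_def
    topspace_mtop[OF assms(1)] topspace_mtop[OF assms(2)] by auto

lemma smooth_map_vimage:
  assumes "smooth_atlas X" "smooth_map X Y F" "openin (mtop Y) W"
  shows "openin (mtop X) (points X \<inter> F -` W)"
  using assms(2,3) unfolding smooth_map_def continuous_map_def topspace_mtop[OF assms(1)]
  by (auto simp: vimage_def Int_def)

lemma smooth_map_from:
  assumes X: "smooth_atlas X" and Y: "smooth_atlas Y" and F: "smooth_map X Y F" and f: "smooth_from S X f"
  shows "smooth_from S Y (\<lambda>s. F (f s))"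
proof (rule smooth_fromI[OF Y])
  note pts = smooth_from_points[OF X f]
  show "F (f s) \<in> points Y" if "s \<in> S" for s using smooth_map_points[OF X Y F] pts[OF that] by blast
  show op: "openin (top_of_set S) (S \<inter> (\<lambda>s. F (f s)) -` W)" if "openin (mtop Y) W" for W
  proof -
    have "S \<inter> (\<lambda>s. F (f s)) -` W = S \<inter> f -` (points X \<inter> F -` W)" using pts by auto
    then show ?thesis using smooth_from_vimage[OF X f smooth_map_vimage[OF X F that]] by simp
  qed
  fix W \<psi> assume W: "(W, \<psi>) \<in> atlas Y"
  show "smooth_on (S \<inter> (\<lambda>s. F (f s)) -` W) (\<lambda>s. \<psi> (F (f s)))" (is "smooth_on ?S' _")
  proof (rule smooth_on_local)
    fix x assume x: "x \<in> ?S'"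
    then obtain U \<phi> where U: "(U, \<phi>) \<in> atlas X" "f x \<in> U" using points_chart[OF X] pts by blast
    let ?N = "?S' \<inter> (S \<inter> f -` U)"
    have "openin (top_of_set ?S') ?N"
      using smooth_from_vimage[OF X f openin_chart_domain[OF X U(1)]] by (auto simp: openin_open)
    moreover have "x \<in> ?N" using x U by auto
    moreover have "smooth_on ?N (\<lambda>s. \<psi> (F (f s)))"
    proof -
      have "smooth_on ?N (\<lambda>s. (\<psi> \<circ> F \<circ> inv_into U \<phi>) (\<phi> (f s)))"
      proof (rule smooth_on_compose[where f = "\<lambda>s. \<phi> (f s)" and g = "\<psi> \<circ> F \<circ> inv_into U \<phi>"])
        show "smooth_on ?N (\<lambda>s. \<phi> (f s))" by (rule smooth_on_subset[OF smooth_from_chartD[OF X f U(1)]]) auto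
        show "smooth_on (\<phi> ` (U \<inter> F -` W)) (\<psi> \<circ> F \<circ> inv_into U \<phi>)"
          using F U(1) W by (auto simp: smooth_map_def)
      qed auto
      then show ?thesis
        by (rule smooth_on_cong[THEN iffD1, rotated]) (use chart_inv[OF X U(1)] in auto)
    qed
    ultimately show "\<exists>N. openin (top_of_set ?S') N \<and> x \<in> N \<and> smooth_on N (\<lambda>s. \<psi> (F (f s)))" by blast
  qed
qed

text \<open>Testing a map on the inverse charts reduces its smoothness to
  \<open>smooth_from\<close>, for which products, inverses and compositions follow from closure
  rules.\<close>

lemma smooth_mapI:
  assumes X: "smooth_atlas X" and Y: "smooth_atlas Y"
    and F: "\<And>U \<phi>. (U, \<phi>) \<in> atlas X \<Longrightarrow> smooth_from (\<phi> ` U) Y (\<lambda>x. F (inv_into U \<phi> x))"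
  shows "smooth_map X Y F"
proof -
  have pts: "F p \<in> points Y" if p: "p \<in> points X" for p
  proof -
    obtain U \<phi> where U: "(U, \<phi>) \<in> atlas X" "p \<in> U" using points_chart[OF X p] by blast
    then show ?thesis using smooth_from_points[OF Y F[OF U(1)], of "\<phi> p"] chart_inv[OF X U] by simp
  qed
  have "openin (mtop X) {p \<in> points X. F p \<in> V}" if V: "openin (mtop Y) V" for V
    unfolding openin_mtop_iff[OF X]
  proof (intro conjI ballI; clarify?)
    fix U \<phi> assume U: "(U, \<phi>) \<in> atlas X"
    have "\<phi> ` ({p \<in> points X. F p \<in> V} \<inter> U) = \<phi> ` U \<inter> (\<lambda>x. F (inv_into U \<phi> x)) -` V"
      using chart_inv[OF X U] chart_points[OF X U] by (auto intro!: imageI)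
    then show "openin (top_of_set (model X)) (\<phi> ` ({p \<in> points X. F p \<in> V} \<inter> U))"
      using smooth_from_vimage[OF Y F[OF U] V] chart_image[OF X U] openin_trans by simp
  qed
  then have "continuous_map (mtop X) (mtop Y) F"
    using pts by (auto simp: continuous_map_def topspace_mtop X Y)
  moreover have "smooth_on (\<phi> ` (U \<inter> F -` W)) (\<psi> \<circ> F \<circ> inv_into U \<phi>)"
    if U: "(U, \<phi>) \<in> atlas X" and W: "(W, \<psi>) \<in> atlas Y" for U \<phi> W \<psi>
    unfolding comp_def
    by (rule smooth_on_subset[OF smooth_from_chartD[OF Y F[OF U] W]]) (use chart_inv[OF X U] in auto)
  ultimately show ?thesis by (auto simp: smooth_map_def)
qed

lemma smooth_map_compose:
  assumes X: "smooth_atlas X" and Y: "smooth_atlas Y" and Z: "smooth_atlas Z"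
    and F: "smooth_map X Y F" and G: "smooth_map Y Z G"
  shows "smooth_map X Z (\<lambda>x. G (F x))"
  by (rule smooth_mapI[OF X Z])
    (intro smooth_map_from[OF Y Z G] smooth_map_from[OF X Y F] smooth_from_inv_into X)

subsection \<open>Products and vector spaces\<close>

lemma points_prod_manifold: "points (prod_manifold X Y) = points X \<times> points Y"
  by (force simp: points_def prod_manifold_def)

lemma inv_into_map_prod:
  assumes "inj_on f A" "inj_on g B" "x \<in> f ` A" "y \<in> g ` B"
  shows "inv_into (A \<times> B) (map_prod f g) (x, y) = (inv_into A f x, inv_into B g y)"
  by (rule inv_into_f_eq) (use assms in \<open>auto intro: map_prod_inj_on inv_into_into simp: f_inv_into_f\<close>)

lemma atlas_prod_manifoldE:
  assumes "(U, \<phi>) \<in> atlas (prod_manifold X Y)"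
  obtains U1 \<phi>1 U2 \<phi>2 where "U = U1 \<times> U2" "\<phi> = map_prod \<phi>1 \<phi>2" "(U1, \<phi>1) \<in> atlas X" "(U2, \<phi>2) \<in> atlas Y"
  using assms by (auto simp: prod_manifold_def)

lemma smooth_atlas_prod:
  assumes X: "smooth_atlas X" and Y: "smooth_atlas Y"
  shows "smooth_atlas (prod_manifold X Y)"
  unfolding smooth_atlas_def
proof (intro conjI ballI; clarify?)
  show "subspace (model (prod_manifold X Y))"
    using X Y by (simp add: prod_manifold_def subspace_Times subspace_model)
next
  fix U \<phi> assume "(U, \<phi>) \<in> atlas (prod_manifold X Y)"
  then show "inj_on \<phi> U" by (rule atlas_prod_manifoldE) (simp add: map_prod_inj_on chart_inj[OF X] chart_inj[OF Y])
next
  fix U \<phi> W \<psi>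
  assume U0: "(U, \<phi>) \<in> atlas (prod_manifold X Y)" and W0: "(W, \<psi>) \<in> atlas (prod_manifold X Y)"
  obtain U1 \<phi>1 U2 \<phi>2 where
    U: "U = U1 \<times> U2" "\<phi> = map_prod \<phi>1 \<phi>2" "(U1, \<phi>1) \<in> atlas X" "(U2, \<phi>2) \<in> atlas Y"
    by (rule atlas_prod_manifoldE[OF U0])
  obtain W1 \<psi>1 W2 \<psi>2 where
    W: "W = W1 \<times> W2" "\<psi> = map_prod \<psi>1 \<psi>2" "(W1, \<psi>1) \<in> atlas X" "(W2, \<psi>2) \<in> atlas Y"
    by (rule atlas_prod_manifoldE[OF W0])
  have im: "\<phi> ` (U \<inter> W) = \<phi>1 ` (U1 \<inter> W1) \<times> \<phi>2 ` (U2 \<inter> W2)"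
    unfolding U W by (auto simp: map_prod_def)
  have 1: "openin (top_of_set (model (prod_manifold X Y))) (\<phi> ` (U \<inter> W))"
    unfolding im using chart_image_Int[OF X U(3) W(3)] chart_image_Int[OF Y U(4) W(4)]
    by (simp add: prod_manifold_def openin_Times)
  have "smooth_on (\<phi> ` (U \<inter> W)) (\<lambda>z. (\<psi>1 (inv_into U1 \<phi>1 (fst z)), \<psi>2 (inv_into U2 \<phi>2 (snd z))))"
    unfolding im
    by (intro smooth_on_Pair smooth_on_compose[OF smooth_on_fst[OF smooth_on_id] chart_transition[OF X U(3) W(3)]]
        smooth_on_compose[OF smooth_on_snd[OF smooth_on_id] chart_transition[OF Y U(4) W(4)]]) auto
  then have "smooth_on (\<phi> ` (U \<inter> W)) (\<psi> \<circ> inv_into U \<phi>)"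
  proof (rule smooth_on_cong[THEN iffD1, rotated])
    fix z assume "z \<in> \<phi> ` (U \<inter> W)"
    then have "fst z \<in> \<phi>1 ` U1" "snd z \<in> \<phi>2 ` U2" unfolding im by auto
    then have "inv_into U \<phi> z = (inv_into U1 \<phi>1 (fst z), inv_into U2 \<phi>2 (snd z))"
      unfolding U using inv_into_map_prod[OF chart_inj[OF X U(3)] chart_inj[OF Y U(4)], of "fst z" "snd z"]
      by simp
    then show "(\<psi>1 (inv_into U1 \<phi>1 (fst z)), \<psi>2 (inv_into U2 \<phi>2 (snd z))) = (\<psi> \<circ> inv_into U \<phi>) z"
      by (simp add: W)
  qed
  with 1 show "openin (top_of_set (model (prod_manifold X Y))) (\<phi> ` (U \<inter> W)) \<and>
      smooth_on (\<phi> ` (U \<inter> W)) (\<psi> \<circ> inv_into U \<phi>)" ..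
qed

lemma smooth_from_Pair:
  assumes X: "smooth_atlas X" and Y: "smooth_atlas Y" and f: "smooth_from S X f" and g: "smooth_from S Y g"
  shows "smooth_from S (prod_manifold X Y) (\<lambda>s. (f s, g s))"
proof (rule smooth_from_local[OF smooth_atlas_prod[OF X Y]])
  fix x assume x: "x \<in> S"
  obtain U \<phi> where U: "(U, \<phi>) \<in> atlas X" "f x \<in> U" using points_chart[OF X smooth_from_points[OF X f x]] by blast
  obtain W \<psi> where W: "(W, \<psi>) \<in> atlas Y" "g x \<in> W" using points_chart[OF Y smooth_from_points[OF Y g x]] by blast
  let ?N = "(S \<inter> f -` U) \<inter> (S \<inter> g -` W)"
  have "openin (top_of_set S) ?N"
    by (intro openin_Int smooth_from_vimage[OF X f] smooth_from_vimage[OF Y g]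
        openin_chart_domain[OF X U(1)] openin_chart_domain[OF Y W(1)])
  moreover have "smooth_from ?N (prod_manifold X Y) (\<lambda>s. (f s, g s))"
  proof (rule smooth_fromI_chart[OF smooth_atlas_prod[OF X Y]])
    show "(U \<times> W, map_prod \<phi> \<psi>) \<in> atlas (prod_manifold X Y)"
      using U W by (auto simp: prod_manifold_def)
    have "smooth_on ?N (\<lambda>s. (\<phi> (f s), \<psi> (g s)))"
      by (intro smooth_on_Pair smooth_on_subset[OF smooth_from_chartD[OF X f U(1)]]
          smooth_on_subset[OF smooth_from_chartD[OF Y g W(1)]]) auto
    then show "smooth_on ?N (\<lambda>s. map_prod \<phi> \<psi> (f s, g s))" by simp
  qed auto
  ultimately show "\<exists>N. openin (top_of_set S) N \<and> x \<in> N \<and> smooth_from N (prod_manifold X Y) (\<lambda>s. (f s, g s))"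
    using x U W by blast
qed

lemma smooth_atlas_vector: "subspace V \<Longrightarrow> smooth_atlas (vector_manifold V)"
proof -
  have "smooth_on V (id \<circ> inv_into V id)"
    using smooth_on_id by (rule smooth_on_cong[THEN iffD1, rotated]) (simp add: inv_into_f_f)
  then show "subspace V \<Longrightarrow> smooth_atlas (vector_manifold V)"
    by (simp add: smooth_atlas_def vector_manifold_def)
qed

lemma smooth_from_vector:
  assumes "subspace V" "\<And>s. s \<in> S \<Longrightarrow> f s \<in> V" "smooth_on S f"
  shows "smooth_from S (vector_manifold V) f"
  by (rule smooth_fromI_chart[OF smooth_atlas_vector[OF assms(1)], of V id])
    (use assms in \<open>auto simp: vector_manifold_def\<close>)

section \<open>Velocities of curves and tangent maps\<close>

abbreviation dom_at :: "('p, 'e) manifold \<Rightarrow> 'p \<Rightarrow> 'p set" where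
  "dom_at X p \<equiv> fst (chart_at X p)"

definition curve_continuous ::
  "('p, 'e::euclidean_space) manifold \<Rightarrow> (real \<Rightarrow> 'p) \<Rightarrow> real \<Rightarrow> real set \<Rightarrow> bool" where
  "curve_continuous X c t S \<longleftrightarrow>
     (\<forall>W. openin (mtop X) W \<longrightarrow> c t \<in> W \<longrightarrow> eventually (\<lambda>s. c s \<in> W) (at t within S))"

text \<open>A relational form of velocity for arbitrary time sets \<open>S\<close>, one- or
  two-sided. Continuity of the curve is included because \<open>coord_at\<close> takes arbitrary
  values off its chart domain, so the derivative of the coordinates alone would not tie
  \<open>c\<close> to the point \<open>c t\<close>.\<close>

definition has_velocity ::
  "('p, 'e::euclidean_space) manifold \<Rightarrow> (real \<Rightarrow> 'p) \<Rightarrow> 'e \<Rightarrow> real \<Rightarrow> real set \<Rightarrow> bool" where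
  "has_velocity X c v t S \<longleftrightarrow> v \<in> model X \<and> c t \<in> points X \<and> curve_continuous X c t S \<and>
     ((\<lambda>s. coord_at X (c t) (c s)) has_vector_derivative v) (at t within S)"

lemma has_velocityD:
  assumes "has_velocity X c v t S"
  shows "v \<in> model X" "c t \<in> points X"
    "\<And>W. openin (mtop X) W \<Longrightarrow> c t \<in> W \<Longrightarrow> eventually (\<lambda>s. c s \<in> W) (at t within S)"
    "((\<lambda>s. coord_at X (c t) (c s)) has_vector_derivative v) (at t within S)"
  using assms unfolding has_velocity_def curve_continuous_def by blast+

lemma at_within_eventually_eq:
  assumes ev: "eventually (\<lambda>s. s \<in> S') (at t within S)" and "S' \<subseteq> insert t S"
  shows "at t within S' = at t within S"
proof -
  obtain T where T: "open T" "t \<in> T" "\<forall>s\<in>T. s \<noteq> t \<longrightarrow> s \<in> S \<longrightarrow> s \<in> S'"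
    using ev unfolding eventually_at_topological by blast
  show ?thesis by (rule at_within_nhd[OF T(2,1)]) (use T(3) assms(2) in auto)
qed

lemma at_within_openin:
  assumes "openin (top_of_set S) J" "t \<in> J"
  shows "at t within J = at t within S"
proof -
  obtain T where "open T" "J = S \<inter> T" using assms(1) by (auto simp: openin_open)
  then show ?thesis using assms(2) by (intro at_within_nhd[of t T]) auto
qed

text \<open>The chain rule within a set needs its relations at all times of that set. Passing to the
  set \<open>S'\<close> of good times does not change the filter at \<open>t\<close>, and
  \<open>t\<close> itself is added by hand.\<close>

lemma has_vector_derivative_compose_within:
  assumes h: "(h has_derivative L) (at (f t) within V)" and f: "(f has_vector_derivative v) (at t within S)"
    and ev: "eventually (\<lambda>s. f s \<in> V \<and> g s = h (f s)) (at t within S)" and t: "f t \<in> V" "g t = h (f t)"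
  shows "(g has_vector_derivative L v) (at t within S)"
proof -
  define S' where "S' = insert t {s \<in> S. f s \<in> V \<and> g s = h (f s)}"
  have "eventually (\<lambda>s. s \<in> S') (at t within S)"
    using ev by (auto simp: eventually_at_filter S'_def elim: eventually_mono)
  then have S': "at t within S' = at t within S"
    by (rule at_within_eventually_eq) (auto simp: S'_def)
  have "(f has_derivative (\<lambda>x. x *\<^sub>R v)) (at t within S')"
    using f S' by (simp add: has_vector_derivative_def)
  moreover have "(h has_derivative L) (at (f t) within f ` S')"
    by (rule has_derivative_subset[OF h]) (use t in \<open>auto simp: S'_def\<close>)
  ultimately have "((\<lambda>s. h (f s)) has_derivative (\<lambda>x. L (x *\<^sub>R v))) (at t within S')"
    by (rule has_derivative_in_compose)
  then have "(g has_derivative (\<lambda>x. L (x *\<^sub>R v))) (at t within S')"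
    by (rule has_derivative_transform[rotated 2]) (use t in \<open>auto simp: S'_def\<close>)
  then show ?thesis
    using linear_cmul[OF has_derivative_linear[OF h]] by (simp add: has_vector_derivative_def S')
qed

text \<open>Near \<open>t\<close> the function equals its projection \<open>P \<circ> f\<close>,
  whose derivative is \<open>P v\<close>; uniqueness of derivatives gives
  \<open>P v = v\<close>.\<close>

lemma vector_derivative_in_subspace:
  fixes f :: "real \<Rightarrow> 'b::euclidean_space"
  assumes V: "subspace V" and f: "(f has_vector_derivative v) (at t within S)" and "at t within S \<noteq> bot"
    and ev: "eventually (\<lambda>s. f s \<in> V) (at t within S)" and "f t \<in> V"
  shows "v \<in> V"
proof -
  obtain P :: "'b \<Rightarrow> 'b" where P: "linear P" "\<And>x. P x \<in> V" "\<And>x. x \<in> V \<Longrightarrow> P x = x"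
    using subspace_projection[OF V] by metis
  have "(f has_vector_derivative P v) (at t within S)"
    by (rule has_vector_derivative_compose_within[OF linear_imp_has_derivative[OF P(1)] f])
      (use ev assms(5) P(3) in \<open>auto elim: eventually_mono\<close>)
  then have "P v = v" using f vector_derivative_unique_within assms(3) by metis
  then show ?thesis using P(2)[of v] by simp
qed

lemma has_derivative_along_line:
  fixes h :: "'a::euclidean_space \<Rightarrow> 'b::euclidean_space"
  assumes V: "subspace V" and h: "(h has_derivative L) (at x within V)" and x: "x \<in> V" and v: "v \<in> V"
  shows "((\<lambda>s. h (x + s *\<^sub>R v)) has_vector_derivative L v) (at 0)"
proof -
  have 1: "((\<lambda>s::real. x + s *\<^sub>R v) has_derivative (\<lambda>s. s *\<^sub>R v)) (at 0)"
    by (auto intro!: derivative_eq_intros)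
  have im: "range (\<lambda>s::real. x + s *\<^sub>R v) \<subseteq> V"
    using x v V by (auto intro: subspace_add subspace_scale)
  have "((\<lambda>s::real. h (x + s *\<^sub>R v)) has_derivative (\<lambda>s. L (s *\<^sub>R v))) (at 0)"
    by (rule has_derivative_in_compose[OF 1]) (use has_derivative_subset[OF h im] in simp)
  then show ?thesis
    using linear_cmul[OF has_derivative_linear[OF h]] by (simp add: has_vector_derivative_def)
qed

lemma eventually_in_openin:
  assumes "openin (top_of_set V) A" "x \<in> A"
  shows "eventually (\<lambda>y. y \<in> A) (at x within V)"
proof -
  obtain T where "open T" "A = V \<inter> T" using assms(1) by (auto simp: openin_open)
  then show ?thesis using assms(2) by (auto simp: eventually_at_topological)
qed

lemma eventually_along_line:
  fixes x v :: "'a::euclidean_space"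
  assumes V: "subspace V" and A: "openin (top_of_set V) A" "x \<in> A" and v: "v \<in> V"
  shows "eventually (\<lambda>s. x + s *\<^sub>R v \<in> A) (at (0::real))"
proof -
  obtain T where T: "open T" "A = V \<inter> T" using A(1) by (auto simp: openin_open)
  have lim: "((\<lambda>s::real. x + s *\<^sub>R v) \<longlongrightarrow> x) (at 0)" by (auto intro!: tendsto_eq_intros)
  have "eventually (\<lambda>s::real. x + s *\<^sub>R v \<in> T) (at 0)"
    using topological_tendstoD[OF lim T(1)] A(2) T(2) by blast
  then show ?thesis
    by eventually_elim (use A(2) T v V in \<open>auto intro: subspace_add subspace_scale\<close>)
qed

lemma has_derivative_in_subspace:
  fixes h :: "'a::euclidean_space \<Rightarrow> 'b::euclidean_space"
  assumes V: "subspace V" and W: "subspace W" and h: "(h has_derivative L) (at x within V)"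
    and A: "openin (top_of_set V) A" "x \<in> A" "\<And>y. y \<in> A \<Longrightarrow> h y \<in> W" and v: "v \<in> V"
  shows "L v \<in> W"
proof (rule vector_derivative_in_subspace[OF W has_derivative_along_line[OF V h _ v]])
  show "x \<in> V" using A(1,2) openin_imp_subset by blast
  show "eventually (\<lambda>s. h (x + s *\<^sub>R v) \<in> W) (at 0)"
    using eventually_along_line[OF V A(1,2) v] by eventually_elim (rule A(3))
qed (use A in auto)

section \<open>Velocities and test curves in the charts of one manifold\<close>

context
  fixes X :: "('p, 'e::euclidean_space) manifold"
  assumes X: "smooth_atlas X"
begin

lemma chart_at_atlas:
  assumes "p \<in> points X"
  shows "(dom_at X p, coord_at X p) \<in> atlas X" "p \<in> dom_at X p"
proof -
  have "\<exists>\<kappa>. \<kappa> \<in> atlas X \<and> p \<in> fst \<kappa>" using assms by (auto simp: points_def)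
  then have "chart_at X p \<in> atlas X \<and> p \<in> fst (chart_at X p)"
    unfolding chart_at_def by (rule someI_ex)
  then show "(dom_at X p, coord_at X p) \<in> atlas X" "p \<in> dom_at X p"
    by (simp_all add: coord_at_def)
qed

lemma coord_at_model: "p \<in> points X \<Longrightarrow> q \<in> dom_at X p \<Longrightarrow> coord_at X p q \<in> model X"
  by (rule chart_model[OF X chart_at_atlas(1)])

lemma param_at_coord: "p \<in> points X \<Longrightarrow> q \<in> dom_at X p \<Longrightarrow> param_at X p (coord_at X p q) = q"
  unfolding param_at_def by (rule chart_inv[OF X chart_at_atlas(1)])

lemma deriv_along_eq:
  assumes p: "p \<in> points X" and f: "((\<lambda>x. f (param_at X p x)) has_derivative L) (at (coord_at X p p) within model X)"
    and v: "v \<in> model X"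
  shows "deriv_along X f p v = L v"
  unfolding deriv_along_def
  by (rule vector_derivative_at[OF has_derivative_along_line[OF subspace_model[OF X] f]])
    (use coord_at_model chart_at_atlas p v in auto)

text \<open>Near \<open>t\<close> the curve runs in the preferred chart domain, where
  \<open>f\<close> is a function of the coordinates and the chain rule applies.\<close>

lemma has_velocity_derivative:
  assumes c: "has_velocity X c v t S"
    and f: "((\<lambda>x. f (param_at X (c t) x)) has_derivative L) (at (coord_at X (c t) (c t)) within model X)"
  shows "((\<lambda>s. f (c s)) has_vector_derivative L v) (at t within S)"
proof -
  note p = has_velocityD(2)[OF c]
  let ?D = "dom_at X (c t)" and ?k = "coord_at X (c t)"
  have "eventually (\<lambda>s. c s \<in> ?D) (at t within S)"
    using has_velocityD(3)[OF c openin_chart_domain[OF X chart_at_atlas(1)[OF p]]] chart_at_atlas(2)[OF p] .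
  then have ev: "eventually (\<lambda>s. ?k (c s) \<in> model X \<and> f (c s) = f (param_at X (c t) (?k (c s)))) (at t within S)"
    by eventually_elim (simp add: coord_at_model[OF p] param_at_coord[OF p])
  show ?thesis
    by (rule has_vector_derivative_compose_within[OF f has_velocityD(4)[OF c] ev])
      (simp_all add: coord_at_model[OF p] param_at_coord[OF p] chart_at_atlas(2)[OF p])
qed

lemma chart_param_derivative:
  assumes U: "(U, \<psi>) \<in> atlas X" and p: "p \<in> points X" "p \<in> U"
  obtains L where "((\<lambda>x. \<psi> (param_at X p x)) has_derivative L) (at (coord_at X p p) within model X)"
    "\<And>v. v \<in> model X \<Longrightarrow> L v \<in> model X"
proof -
  note k = chart_at_atlas[OF p(1)]
  have A: "openin (top_of_set (model X)) (coord_at X p ` (dom_at X p \<inter> U))" by (rule chart_image_Int[OF X k(1) U])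
  have x: "coord_at X p p \<in> coord_at X p ` (dom_at X p \<inter> U)" using k p by blast
  obtain D where D: "\<And>x. x \<in> coord_at X p ` (dom_at X p \<inter> U) \<Longrightarrow> ((\<lambda>x. \<psi> (param_at X p x)) has_derivative D x) (at x within model X)"
    using smooth_on_subspace_derivative[OF subspace_model[OF X] A chart_transition[OF X k(1) U]] 
    unfolding param_at_def by blast
  have m: "\<psi> (param_at X p y) \<in> model X" if "y \<in> coord_at X p ` (dom_at X p \<inter> U)" for y
    using that chart_model[OF X U] param_at_coord[OF p(1)] by auto
  show thesis
    by (rule that[OF D[OF x]], rule has_derivative_in_subspace[OF subspace_model[OF X] subspace_model[OF X] D[OF x] A x m])
qed

lemma has_velocity_chart:
  assumes "(U, \<psi>) \<in> atlas X" "c t \<in> U" "has_velocity X c v t S"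
  shows "((\<lambda>s. \<psi> (c s)) has_vector_derivative deriv_along X \<psi> (c t) v) (at t within S)"
proof -
  note p = has_velocityD(2)[OF assms(3)]
  obtain L where L: "((\<lambda>x. \<psi> (param_at X (c t) x)) has_derivative L) (at (coord_at X (c t) (c t)) within model X)"
    by (rule chart_param_derivative[OF assms(1) p assms(2)])
  show ?thesis
    using has_velocity_derivative[OF assms(3) L] deriv_along_eq[OF p L has_velocityD(1)[OF assms(3)]] by simp
qed

lemma deriv_along_chart_model:
  assumes "(U, \<psi>) \<in> atlas X" "p \<in> U" "v \<in> model X"
  shows "deriv_along X \<psi> p v \<in> model X"
proof -
  have p: "p \<in> points X" using assms chart_points[OF X] by blast
  obtain L where L: "((\<lambda>x. \<psi> (param_at X p x)) has_derivative L) (at (coord_at X p p) within model X)"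
    "\<And>v. v \<in> model X \<Longrightarrow> L v \<in> model X"
    by (rule chart_param_derivative[OF assms(1) p assms(2)]) blast
  show ?thesis using deriv_along_eq[OF p L(1) assms(3)] L(2)[OF assms(3)] by simp
qed

lemma has_velocity_cong:
  assumes c: "has_velocity X c v t S" and "t \<in> S" "\<And>s. s \<in> S \<Longrightarrow> c s = d s"
  shows "has_velocity X d v t S"
proof -
  have ev: "eventually (\<lambda>s. d s = c s) (at t within S)"
    using assms(3) by (simp add: eventually_at_filter)
  have t: "d t = c t" using assms by simp
  show ?thesis
    unfolding has_velocity_def curve_continuous_def t
  proof (intro conjI allI impI)
    fix W assume "openin (mtop X) W" "c t \<in> W"
    from has_velocityD(3)[OF c this] ev show "eventually (\<lambda>s. d s \<in> W) (at t within S)"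
      by eventually_elim simp
  next
    show "((\<lambda>s. coord_at X (c t) (d s)) has_vector_derivative v) (at t within S)"
      by (rule has_vector_derivative_transform[OF assms(2) _ has_velocityD(4)[OF c]]) (use assms(3) in simp)
  qed (use has_velocityD[OF c] in auto)
qed

lemma has_velocity_subset:
  assumes c: "has_velocity X c v t S" and "T \<subseteq> S"
  shows "has_velocity X c v t T"
  using has_velocityD[OF c] has_vector_derivative_within_subset[OF _ assms(2)]
    filter_leD[OF at_le[OF assms(2)]]
  unfolding has_velocity_def curve_continuous_def by blast

lemma has_velocity_within_openin:
  assumes "openin (top_of_set S) J" "t \<in> J"
  shows "has_velocity X c v t J \<longleftrightarrow> has_velocity X c v t S"
  unfolding has_velocity_def curve_continuous_def at_within_openin[OF assms] by simp

lemma has_velocity_unique: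
  assumes "has_velocity X c v t S" "has_velocity X c w t S" "at t within S \<noteq> bot"
  shows "v = w"
  using vector_derivative_unique_within[OF assms(3) has_velocityD(4)[OF assms(1)] has_velocityD(4)[OF assms(2)]] .

lemma has_velocity_const: "p \<in> points X \<Longrightarrow> has_velocity X (\<lambda>s. p) 0 t S"
  unfolding has_velocity_def curve_continuous_def using subspace_0[OF subspace_model[OF X]] by auto

text \<open>The preferred chart at \<open>p\<close> fixes how velocities are stored, but any chart
  may be used to compute them. \<open>L\<close> is the derivative of the change to the preferred
  chart; it depends on \<open>p\<close> and the chart alone, and one \<open>L\<close> serving all
  curves is what later gives injectivity and linearity.\<close>

lemma velocity_from_chart:
  assumes U: "(U, \<psi>) \<in> atlas X" and p: "p \<in> U"
  obtains L where "linear L" "\<forall>c t S u. c t = p \<and> curve_continuous X c t S \<and>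
      ((\<lambda>s. \<psi> (c s)) has_vector_derivative u) (at t within S) \<and> u \<in> model X \<longrightarrow> has_velocity X c (L u) t S"
proof -
  have pp: "p \<in> points X" using U p chart_points[OF X] by blast
  note k = chart_at_atlas[OF pp]
  let ?A = "\<psi> ` (U \<inter> dom_at X p)" and ?h = "\<lambda>x. coord_at X p (inv_into U \<psi> x)"
  have A: "openin (top_of_set (model X)) ?A" by (rule chart_image_Int[OF X U k(1)])
  have x: "\<psi> p \<in> ?A" using k p by blast
  obtain D where D: "\<And>x. x \<in> ?A \<Longrightarrow> (?h has_derivative D x) (at x within model X)"
    using smooth_on_subspace_derivative[OF subspace_model[OF X] A chart_transition[OF X U k(1)]] by blast
  define L where "L = D (\<psi> p)"
  have L: "(?h has_derivative L) (at (\<psi> p) within model X)" unfolding L_def by (rule D[OF x])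
  show thesis
  proof (rule that; (intro allI impI; elim conjE)?)
    show "linear L" using has_derivative_linear[OF L] .
  next
    fix c :: "real \<Rightarrow> 'p" and t S u
    assume ct: "c t = p" and cc: "curve_continuous X c t S"
      and der: "((\<lambda>s. \<psi> (c s)) has_vector_derivative u) (at t within S)" and u: "u \<in> model X"
    note ev = cc[unfolded curve_continuous_def, rule_format]
    have "L u \<in> model X"
    proof (rule has_derivative_in_subspace[OF subspace_model[OF X] subspace_model[OF X] L A x _ u])
      show "?h y \<in> model X" if "y \<in> ?A" for y
        using that chart_inv[OF X U] coord_at_model[OF pp] by auto
    qed
    moreover have "((\<lambda>s. coord_at X p (c s)) has_vector_derivative L u) (at t within S)"
    proof (rule has_vector_derivative_compose_within[OF _ der])
      show "(?h has_derivative L) (at (\<psi> (c t)) within model X)" using L ct by simp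
      have "eventually (\<lambda>s. c s \<in> U) (at t within S)"
        using ev[OF openin_chart_domain[OF X U]] ct p by simp
      then show "eventually (\<lambda>s. \<psi> (c s) \<in> model X \<and> coord_at X p (c s) = ?h (\<psi> (c s))) (at t within S)"
        by eventually_elim (simp add: chart_model[OF X U] chart_inv[OF X U])
    qed (simp_all add: ct chart_model[OF X U p] chart_inv[OF X U p])
    ultimately show "has_velocity X c (L u) t S"
      unfolding has_velocity_def curve_continuous_def using ev ct pp by auto
  qed
qed

lemma chart_line:
  assumes U: "(U, \<psi>) \<in> atlas X" and p: "p \<in> U" and u: "u \<in> model X"
  defines "c \<equiv> \<lambda>s. inv_into U \<psi> (\<psi> p + s *\<^sub>R u)"
  shows "c 0 = p" "\<And>W. openin (mtop X) W \<Longrightarrow> p \<in> W \<Longrightarrow> eventually (\<lambda>s. c s \<in> W) (at 0)"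
    "((\<lambda>s. \<psi> (c s)) has_vector_derivative u) (at 0)"
proof -
  show "c 0 = p" using chart_inv[OF X U p] by (simp add: c_def)
  have ev: "eventually (\<lambda>s. \<psi> p + s *\<^sub>R u \<in> \<psi> ` (W \<inter> U)) (at 0)" if "openin (mtop X) W" "p \<in> W" for W
    by (rule eventually_along_line[OF subspace_model[OF X] openin_chart_image[OF X that(1) U] _ u]) (use that p in auto)
  show "eventually (\<lambda>s. c s \<in> W) (at 0)" if "openin (mtop X) W" "p \<in> W" for W
    using ev[OF that] by eventually_elim (use chart_inv[OF X U] in \<open>auto simp: c_def\<close>)
  have "eventually (\<lambda>s. \<psi> p + s *\<^sub>R u \<in> \<psi> ` (U \<inter> U)) (at 0)"
    by (rule ev[OF openin_chart_domain[OF X U] p])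
  then have ev2: "eventually (\<lambda>s. \<psi> p + s *\<^sub>R u = \<psi> (c s)) (at 0)"
    by eventually_elim (simp add: c_def f_inv_into_f)
  have D: "((\<lambda>s::real. \<psi> p + s *\<^sub>R u) has_derivative (\<lambda>s. s *\<^sub>R u)) (at 0)"
    by (auto intro!: derivative_eq_intros)
  show "((\<lambda>s. \<psi> (c s)) has_vector_derivative u) (at 0)"
    unfolding has_vector_derivative_def
    by (rule has_derivative_transform_eventually[OF D ev2]) (use \<open>c 0 = p\<close> in simp_all)
qed

text \<open>Every tangent vector is the velocity of the very curve along which
  \<open>deriv_along\<close> differentiates, so tangent maps can be computed from
  velocities.\<close>

lemma has_velocity_param_line:
  assumes p: "p \<in> points X" and v: "v \<in> model X"
  shows "has_velocity X (\<lambda>s. param_at X p (coord_at X p p + s *\<^sub>R v)) v 0 UNIV"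
    "param_at X p (coord_at X p p + 0 *\<^sub>R v) = p"
proof -
  note line = chart_line[OF chart_at_atlas[OF p] v, folded param_at_def]
  show "param_at X p (coord_at X p p + 0 *\<^sub>R v) = p" using line(1) .
  then show "has_velocity X (\<lambda>s. param_at X p (coord_at X p p + s *\<^sub>R v)) v 0 UNIV"
    unfolding has_velocity_def curve_continuous_def using line(2,3) p v by auto
qed

text \<open>The map \<open>L\<close> back to preferred coordinates is a left inverse of the
  coordinate change, as one sees on the test curve with velocity \<open>v\<close>.\<close>

lemma deriv_along_chart_inj:
  assumes U: "(U, \<psi>) \<in> atlas X" and p: "p \<in> U" and v: "v \<in> model X" "w \<in> model X"
    and eq: "deriv_along X \<psi> p v = deriv_along X \<psi> p w"
  shows "v = w"
proof -
  have pp: "p \<in> points X" using U p chart_points[OF X] by blast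
  obtain L where "linear L" and L: "\<forall>c t S u. c t = p \<and> curve_continuous X c t S \<and>
      ((\<lambda>s. \<psi> (c s)) has_vector_derivative u) (at t within S) \<and> u \<in> model X \<longrightarrow> has_velocity X c (L u) t S"
    by (rule velocity_from_chart[OF U p])
  have "L (deriv_along X \<psi> p v) = v" if v: "v \<in> model X" for v
  proof -
    let ?c = "\<lambda>s. param_at X p (coord_at X p p + s *\<^sub>R v)"
    note c = has_velocity_param_line[OF pp v]
    have "((\<lambda>s. \<psi> (?c s)) has_vector_derivative deriv_along X \<psi> p v) (at 0)"
      using has_velocity_chart[OF U _ c(1)] c(2) p by simp
    moreover have "curve_continuous X ?c 0 UNIV" using c(1) by (simp add: has_velocity_def)
    ultimately have "has_velocity X ?c (L (deriv_along X \<psi> p v)) 0 UNIV"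
      using L[rule_format, of ?c 0 UNIV] deriv_along_chart_model[OF U p v] c(2) by blast
    then show ?thesis using has_velocity_unique[OF _ c(1)] by simp
  qed
  then show ?thesis using v eq by metis
qed

lemma deriv_along_chart_surj:
  assumes U: "(U, \<psi>) \<in> atlas X" and p: "p \<in> U" and u: "u \<in> model X"
  obtains v where "v \<in> model X" "deriv_along X \<psi> p v = u"
proof -
  obtain L where "linear L" and L: "\<forall>c t S u. c t = p \<and> curve_continuous X c t S \<and>
      ((\<lambda>s. \<psi> (c s)) has_vector_derivative u) (at t within S) \<and> u \<in> model X \<longrightarrow> has_velocity X c (L u) t S"
    by (rule velocity_from_chart[OF U p])
  let ?c = "\<lambda>s. inv_into U \<psi> (\<psi> p + s *\<^sub>R u)"
  note line = chart_line[OF U p u]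
  have v: "has_velocity X ?c (L u) 0 UNIV"
    by (rule L[rule_format]) (use line u in \<open>auto simp: curve_continuous_def\<close>)
  then have "((\<lambda>s. \<psi> (?c s)) has_vector_derivative deriv_along X \<psi> p (L u)) (at 0)"
    using has_velocity_chart[OF U _ v] line(1) p by simp
  then have "deriv_along X \<psi> p (L u) = u"
    using line(3) vector_derivative_unique_at by blast
  then show thesis using that has_velocityD(1)[OF v] by blast
qed

lemma smooth_from_has_velocity:
  assumes c: "smooth_from S X c" and t: "t \<in> S" and "at t within S \<noteq> bot"
  obtains v where "has_velocity X c v t S"
proof -
  note p = smooth_from_points[OF X c t]
  note k = chart_at_atlas[OF p]
  let ?N = "S \<inter> c -` dom_at X (c t)"
  have N: "openin (top_of_set S) ?N" by (rule smooth_from_vimage[OF X c openin_chart_domain[OF X k(1)]])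
  have tN: "t \<in> ?N" using t k by auto
  obtain v where v: "((\<lambda>s. coord_at X (c t) (c s)) has_vector_derivative v) (at t within ?N)"
    using smooth_on_has_vector_derivative[OF smooth_from_chartD[OF X c k(1)] tN] .
  have v': "((\<lambda>s. coord_at X (c t) (c s)) has_vector_derivative v) (at t within S)"
    using v at_within_openin[OF N tN] by simp
  have ev: "eventually (\<lambda>s. c s \<in> W) (at t within S)" if "openin (mtop X) W" "c t \<in> W" for W
    using eventually_in_openin[OF smooth_from_vimage[OF X c that(1)], of t] t that(2)
    by (auto elim: eventually_mono)
  have "v \<in> model X"
  proof (rule vector_derivative_in_subspace[OF subspace_model[OF X] v' assms(3)])
    show "eventually (\<lambda>s. coord_at X (c t) (c s) \<in> model X) (at t within S)"
      using ev[OF openin_chart_domain[OF X k(1)] k(2)]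
      by eventually_elim (rule coord_at_model[OF p])
  qed (use coord_at_model[OF p] k in auto)
  then show thesis using that v' ev p unfolding has_velocity_def curve_continuous_def by blast
qed

text \<open>Around each time the curve lies in one chart, where its coordinates have zero derivative
  and are constant; connectedness of \<open>J\<close> passes from local to global constancy.\<close>

lemma velocity_zero_constant:
  assumes c: "smooth_from J X c" and J: "convex J"
    and zero: "\<And>t. t \<in> J \<Longrightarrow> has_velocity X c 0 t J" and "a \<in> J" "b \<in> J"
  shows "c a = c b"
proof (rule connected_local_const[OF convex_connected[OF J] \<open>a \<in> J\<close> \<open>b \<in> J\<close>], intro ballI)
  fix a assume a: "a \<in> J"
  note p = smooth_from_points[OF X c a]
  note k = chart_at_atlas[OF p]
  let ?U = "dom_at X (c a)" and ?k = "coord_at X (c a)"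
  have "openin (top_of_set J) (J \<inter> c -` ?U)" by (rule smooth_from_vimage[OF X c openin_chart_domain[OF X k(1)]])
  then obtain e where e: "e > 0" "ball a e \<inter> J \<subseteq> J \<inter> c -` ?U"
    using a k(2) unfolding openin_contains_ball by blast
  let ?K = "ball a e \<inter> J"
  have "((\<lambda>s. ?k (c s)) has_vector_derivative 0) (at s within ?K)" if s: "s \<in> ?K" for s
  proof -
    have "has_velocity X c 0 s ?K" using has_velocity_subset[OF zero] s by blast
    then have "((\<lambda>s. ?k (c s)) has_vector_derivative deriv_along X ?k (c s) 0) (at s within ?K)"
      using has_velocity_chart[OF k(1)] e(2) s by blast
    moreover have "deriv_along X ?k (c s) 0 = 0" by (simp add: deriv_along_def)
    ultimately show ?thesis by simp
  qed
  moreover have "convex ?K" using J by (intro convex_Int) auto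
  ultimately obtain d where d: "\<And>s. s \<in> ?K \<Longrightarrow> ?k (c s) = d"
    using has_vector_derivative_zero_constant[of ?K] by metis
  have "c a = c s" if "s \<in> ?K" for s
  proof -
    have "?k (c a) = ?k (c s)" using d[OF that] d[of a] a e(1) by simp
    then show ?thesis using inj_onD[OF chart_inj[OF X k(1)]] k(2) e(2) that by blast
  qed
  moreover have "eventually (\<lambda>s. s \<in> ?K) (at a within J)"
    using e(1) by (auto simp: eventually_at dist_commute intro!: exI[of _ e])
  ultimately show "eventually (\<lambda>s. c a = c s) (at a within J)" by (auto elim: eventually_mono)
qed

end

lemma chart_line_velocity:
  assumes X: "smooth_atlas X" and U: "(U, \<psi>) \<in> atlas X" and p: "p \<in> U" and v: "v \<in> model X"
  shows "has_velocity X (\<lambda>s. inv_into U \<psi> (\<psi> p + s *\<^sub>R deriv_along X \<psi> p v)) v 0 UNIV"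
proof -
  define u where "u = deriv_along X \<psi> p v"
  have u: "u \<in> model X" unfolding u_def by (rule deriv_along_chart_model[OF X U p v])
  obtain L where L: "linear L" "\<forall>c t S u. c t = p \<and> curve_continuous X c t S \<and>
      ((\<lambda>s. \<psi> (c s)) has_vector_derivative u) (at t within S) \<and> u \<in> model X \<longrightarrow> has_velocity X c (L u) t S"
    by (rule velocity_from_chart[OF X U p])
  let ?c = "\<lambda>s. inv_into U \<psi> (\<psi> p + s *\<^sub>R u)"
  note line = chart_line[OF X U p u]
  have c: "has_velocity X ?c (L u) 0 UNIV"
    by (rule L(2)[rule_format]) (use line u in \<open>auto simp: curve_continuous_def\<close>)
  have "((\<lambda>s. \<psi> (?c s)) has_vector_derivative deriv_along X \<psi> p (L u)) (at 0)"
    using has_velocity_chart[OF X U _ c] line(1) p by simp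
  then have "deriv_along X \<psi> p (L u) = deriv_along X \<psi> p v"
    using line(3) vector_derivative_unique_at u_def by blast
  then have "L u = v" by (rule deriv_along_chart_inj[OF X U p has_velocityD(1)[OF c] v])
  then show ?thesis using c by (simp add: u_def)
qed

section \<open>Tangent maps, the chain rule and the product rule\<close>

lemma smooth_map_derivative:
  assumes X: "smooth_atlas X" and Y: "smooth_atlas Y" and F: "smooth_map X Y F" and p: "p \<in> points X"
  obtains L where
    "((\<lambda>x. coord_at Y (F p) (F (param_at X p x))) has_derivative L) (at (coord_at X p p) within model X)"
    "\<And>v. v \<in> model X \<Longrightarrow> L v \<in> model Y"
proof -
  note k = chart_at_atlas[OF X p]
  note q = smooth_map_points[OF X Y F p]
  note l = chart_at_atlas[OF Y q]
  let ?V = "dom_at X p \<inter> F -` dom_at Y (F p)"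
  let ?A = "coord_at X p ` ?V" and ?h = "\<lambda>x. coord_at Y (F p) (F (param_at X p x))"
  have "(points X \<inter> F -` dom_at Y (F p)) \<inter> dom_at X p = ?V" using chart_points[OF X k(1)] by blast
  then have A: "openin (top_of_set (model X)) ?A"
    using openin_chart_image[OF X smooth_map_vimage[OF X F openin_chart_domain[OF Y l(1)]] k(1)] by simp
  have x: "coord_at X p p \<in> ?A" using k l by blast
  have "smooth_on ?A ?h"
    using F k(1) l(1) unfolding smooth_map_def comp_def param_at_def by blast
  then obtain D where D: "\<And>x. x \<in> ?A \<Longrightarrow> (?h has_derivative D x) (at x within model X)"
    using smooth_on_subspace_derivative[OF subspace_model[OF X] A] by blast
  have m: "?h y \<in> model Y" if "y \<in> ?A" for y
    using that param_at_coord[OF X p] coord_at_model[OF Y q] by auto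
  show thesis
    by (rule that[OF D[OF x]], rule has_derivative_in_subspace[OF subspace_model[OF X] subspace_model[OF Y] D[OF x] A x m])
qed

lemma tangent_map_eq:
  assumes X: "smooth_atlas X" and "p \<in> points X"
    and "((\<lambda>x. coord_at Y (F p) (F (param_at X p x))) has_derivative L) (at (coord_at X p p) within model X)"
    and "v \<in> model X"
  shows "tangent_map X Y F p v = L v"
  unfolding tangent_map_def by (rule deriv_along_eq[OF X assms(2)]) (use assms in \<open>simp_all add: comp_def\<close>)

lemma tangent_map_linear:
  assumes "smooth_atlas X" "smooth_atlas Y" "smooth_map X Y F" "p \<in> points X"
  obtains L where "linear L" "\<And>v. v \<in> model X \<Longrightarrow> tangent_map X Y F p v = L v"
proof -
  obtain L where L: "((\<lambda>x. coord_at Y (F p) (F (param_at X p x))) has_derivative L) (at (coord_at X p p) within model X)"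
    using smooth_map_derivative[OF assms] by blast
  show thesis
    by (rule that[OF has_derivative_linear[OF L] tangent_map_eq[OF assms(1,4) L]])
qed

lemma tangent_map_zero: "tangent_map X Y F p 0 = 0"
  by (simp add: tangent_map_def deriv_along_def)

lemma has_velocity_map:
  assumes X: "smooth_atlas X" and Y: "smooth_atlas Y" and F: "smooth_map X Y F" and c: "has_velocity X c v t S"
  shows "has_velocity Y (\<lambda>s. F (c s)) (tangent_map X Y F (c t) v) t S"
proof -
  note p = has_velocityD(2)[OF c] and v = has_velocityD(1)[OF c]
  obtain L where L: "((\<lambda>x. coord_at Y (F (c t)) (F (param_at X (c t) x))) has_derivative L) (at (coord_at X (c t) (c t)) within model X)"
      "\<And>v. v \<in> model X \<Longrightarrow> L v \<in> model Y"
    by (rule smooth_map_derivative[OF X Y F p]) blast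
  have "curve_continuous Y (\<lambda>s. F (c s)) t S"
    unfolding curve_continuous_def
  proof (intro allI impI)
    fix W assume "openin (mtop Y) W" "F (c t) \<in> W"
    then have "eventually (\<lambda>s. c s \<in> points X \<inter> F -` W) (at t within S)"
      using has_velocityD(3)[OF c smooth_map_vimage[OF X F]] p by blast
    then show "eventually (\<lambda>s. F (c s) \<in> W) (at t within S)" by eventually_elim simp
  qed
  moreover have "((\<lambda>s. coord_at Y (F (c t)) (F (c s))) has_vector_derivative L v) (at t within S)"
    by (rule has_velocity_derivative[OF X c L(1)])
  ultimately show ?thesis
    unfolding has_velocity_def tangent_map_eq[OF X p L(1) v]
    using L(2)[OF v] smooth_map_points[OF X Y F p] by simp
qed

lemma tangent_map_model:
  assumes "smooth_atlas X" "smooth_atlas Y" "smooth_map X Y F" "p \<in> points X" "v \<in> model X"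
  shows "tangent_map X Y F p v \<in> model Y"
  using has_velocityD(1)[OF has_velocity_map[OF assms(1-3) has_velocity_param_line(1)[OF assms(1,4,5)]]]
    has_velocity_param_line(2)[OF assms(1,4,5)] by simp

lemma tangent_map_velocity:
  assumes X: "smooth_atlas X" and p: "p \<in> points X" and v: "v \<in> model X"
    and F: "has_velocity Y (\<lambda>s. F (param_at X p (coord_at X p p + s *\<^sub>R v))) w 0 UNIV"
  shows "tangent_map X Y F p v = w"
proof -
  have "((\<lambda>s. (coord_at Y (F p) \<circ> F) (param_at X p (coord_at X p p + s *\<^sub>R v))) has_vector_derivative w) (at 0)"
    using has_velocityD(4)[OF F] has_velocity_param_line(2)[OF X p v] by simp
  then show ?thesis unfolding tangent_map_def deriv_along_def by (rule vector_derivative_at)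
qed

text \<open>Push the test curve with velocity \<open>v\<close> forward twice and read off its
  velocity.\<close>

lemma tangent_map_compose:
  assumes X: "smooth_atlas X" and Y: "smooth_atlas Y" and Z: "smooth_atlas Z"
    and F: "smooth_map X Y F" and G: "smooth_map Y Z G" and p: "p \<in> points X" and v: "v \<in> model X"
  shows "tangent_map X Z (\<lambda>x. G (F x)) p v = tangent_map Y Z G (F p) (tangent_map X Y F p v)"
  using tangent_map_velocity[OF X p v has_velocity_map[OF Y Z G has_velocity_map[OF X Y F has_velocity_param_line(1)[OF X p v]]]]
    has_velocity_param_line(2)[OF X p v] by simp

text \<open>Values outside \<open>points X\<close> may differ, and the test curve is meaningful near
  time \<open>0\<close> only; being continuous there, it eventually stays in
  \<open>points X\<close>.\<close>

lemma tangent_map_cong: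
  assumes X: "smooth_atlas X" and Y: "smooth_atlas Y" and F: "smooth_map X Y F"
    and eq: "\<And>x. x \<in> points X \<Longrightarrow> F x = G x" and p: "p \<in> points X" and v: "v \<in> model X"
  shows "tangent_map X Y F p v = tangent_map X Y G p v"
proof -
  have "smooth_map X Y G"
  proof (rule smooth_mapI[OF X Y])
    fix U \<phi> assume U: "(U, \<phi>) \<in> atlas X"
    show "smooth_from (\<phi> ` U) Y (\<lambda>x. G (inv_into U \<phi> x))"
      by (rule smooth_from_cong[OF Y smooth_map_from[OF X Y F smooth_from_inv_into[OF X U]]])
        (use eq smooth_from_points[OF X smooth_from_inv_into[OF X U]] in blast)
  qed
  note G = has_velocity_map[OF X Y this has_velocity_param_line(1)[OF X p v]]
  let ?c = "\<lambda>s. param_at X p (coord_at X p p + s *\<^sub>R v)"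
  have "eventually (\<lambda>s. ?c s \<in> points X) (at 0)"
    using has_velocityD(3)[OF has_velocity_param_line(1)[OF X p v], of "points X"]
      has_velocity_param_line(2)[OF X p v] p topspace_mtop[OF X] by (metis openin_topspace)
  then have ev: "eventually (\<lambda>s. coord_at Y (G p) (G (?c s)) = coord_at Y (F p) (F (?c s))) (at 0)"
    by eventually_elim (simp add: eq p)
  have "((\<lambda>s. coord_at Y (G p) (G (?c s))) has_derivative (\<lambda>h. h *\<^sub>R tangent_map X Y G p v)) (at 0)"
    using has_velocityD(4)[OF G] has_velocity_param_line(2)[OF X p v] by (simp add: has_vector_derivative_def)
  then have "((\<lambda>s. coord_at Y (F p) (F (?c s))) has_derivative (\<lambda>h. h *\<^sub>R tangent_map X Y G p v)) (at 0)"
    by (rule has_derivative_transform_eventually[OF _ ev])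
      (use has_velocity_param_line(2)[OF X p v] eq[OF p] in simp_all)
  then have "((\<lambda>s. (coord_at Y (F p) \<circ> F) (?c s)) has_vector_derivative tangent_map X Y G p v) (at 0)"
    by (simp add: has_vector_derivative_def)
  then show ?thesis unfolding tangent_map_def[of X Y F] deriv_along_def by (rule vector_derivative_at)
qed

lemma tangent_map_id:
  assumes "smooth_atlas X" "p \<in> points X" "v \<in> model X"
  shows "tangent_map X X (\<lambda>x. x) p v = v"
  by (rule tangent_map_velocity[OF assms has_velocity_param_line(1)[OF assms]])

text \<open>The preferred chart of the product at \<open>(p, q)\<close> need not be the product of
  the preferred charts, so the velocity of a pair is known only up to a linear map \<open>L\<close>
  that depends on the point alone.\<close>

lemma has_velocity_Pair:
  assumes X: "smooth_atlas X" and N: "smooth_atlas N" and p: "p \<in> points X" and q: "q \<in> points N"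
  obtains L where "linear L" "\<forall>c d v w t S. c t = p \<and> d t = q \<and> has_velocity X c v t S \<and> has_velocity N d w t S \<longrightarrow>
      has_velocity (prod_manifold X N) (\<lambda>s. (c s, d s)) (L (v, w)) t S"
proof -
  note XN = smooth_atlas_prod[OF X N]
  note k = chart_at_atlas[OF X p] and l = chart_at_atlas[OF N q]
  let ?U = "dom_at X p \<times> dom_at N q" and ?\<psi> = "map_prod (coord_at X p) (coord_at N q)"
  have U: "(?U, ?\<psi>) \<in> atlas (prod_manifold X N)" using k l by (auto simp: prod_manifold_def)
  have pq: "(p, q) \<in> ?U" using k l by simp
  obtain L where L: "linear L" "\<forall>c t S u. c t = (p, q) \<and> curve_continuous (prod_manifold X N) c t S \<and>
      ((\<lambda>s. ?\<psi> (c s)) has_vector_derivative u) (at t within S) \<and> u \<in> model (prod_manifold X N) \<longrightarrow>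
      has_velocity (prod_manifold X N) c (L u) t S"
    by (rule velocity_from_chart[OF XN U pq])
  show thesis
  proof (rule that[OF L(1)], intro allI impI, elim conjE)
    fix c d v w and t :: real and S
    assume t: "c t = p" "d t = q" and c: "has_velocity X c v t S" and d: "has_velocity N d w t S"
    show "has_velocity (prod_manifold X N) (\<lambda>s. (c s, d s)) (L (v, w)) t S"
    proof (rule L(2)[rule_format], intro conjI)
      show "(c t, d t) = (p, q)" using t by simp
      have "((\<lambda>s. coord_at X p (c s)) has_vector_derivative v) (at t within S)"
        "((\<lambda>s. coord_at N q (d s)) has_vector_derivative w) (at t within S)"
        using has_velocityD(4)[OF c] has_velocityD(4)[OF d] t by simp_all
      then show "((\<lambda>s. ?\<psi> (c s, d s)) has_vector_derivative (v, w)) (at t within S)"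
        by (simp add: has_vector_derivative_Pair)
      show "(v, w) \<in> model (prod_manifold X N)"
        using has_velocityD(1)[OF c] has_velocityD(1)[OF d] by (simp add: prod_manifold_def)
      show "curve_continuous (prod_manifold X N) (\<lambda>s. (c s, d s)) t S"
        unfolding curve_continuous_def
      proof (intro allI impI)
        fix W assume W: "openin (mtop (prod_manifold X N)) W" "(c t, d t) \<in> W"
        have "?\<psi> (p, q) \<in> ?\<psi> ` (W \<inter> ?U)" using W t pq by (intro imageI) auto
        then have xy: "(coord_at X p p, coord_at N q q) \<in> ?\<psi> ` (W \<inter> ?U)" by simp
        have op: "openin (top_of_set (model X \<times> model N)) (?\<psi> ` (W \<inter> ?U))"
          using openin_chart_image[OF XN W(1) U] by (simp add: prod_manifold_def)
        then obtain T where T: "open T" "?\<psi> ` (W \<inter> ?U) = (model X \<times> model N) \<inter> T" by (auto simp: openin_open)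
        have xyT: "(coord_at X p p, coord_at N q q) \<in> T" using xy unfolding T(2) by simp
        obtain A B where AB0: "open A" "open B" "(coord_at X p p, coord_at N q q) \<in> A \<times> B" "A \<times> B \<subseteq> T"
          by (rule open_prod_elim[OF T(1) xyT])
        then have AB: "open A" "open B" "coord_at X p p \<in> A" "coord_at N q q \<in> B" "A \<times> B \<subseteq> T" by simp_all
        have "eventually (\<lambda>s. c s \<in> {r \<in> dom_at X p. coord_at X p r \<in> model X \<inter> A}) (at t within S)"
          by (rule has_velocityD(3)[OF c openin_chart_vimage[OF X k(1)]])
            (use AB(1,3) t k(2) coord_at_model[OF X p k(2)] in \<open>auto intro: openin_open_Int\<close>)
        moreover have "eventually (\<lambda>s. d s \<in> {r \<in> dom_at N q. coord_at N q r \<in> model N \<inter> B}) (at t within S)"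
          by (rule has_velocityD(3)[OF d openin_chart_vimage[OF N l(1)]])
            (use AB(2,4) t l(2) coord_at_model[OF N q l(2)] in \<open>auto intro: openin_open_Int\<close>)
        ultimately show "eventually (\<lambda>s. (c s, d s) \<in> W) (at t within S)"
        proof eventually_elim
          case (elim s)
          then have "?\<psi> (c s, d s) \<in> ?\<psi> ` (W \<inter> ?U)" unfolding T(2) using AB(5) by auto
          then obtain z where z: "z \<in> W \<inter> ?U" "?\<psi> z = ?\<psi> (c s, d s)" by (elim imageE) simp
          have "z = (c s, d s)"
            by (rule inj_onD[OF chart_inj[OF XN U] z(2)]) (use z elim in auto)
          then show ?case using z by blast
        qed
      qed
    qed
  qed
qed

text \<open>Since the pairing is known only up to a linear map, the velocity of
  \<open>A (c s) (d s)\<close> is some linear function of \<open>(v, w)\<close>. Curves with one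
  factor constant identify its values on \<open>(v, 0)\<close> and \<open>(0, w)\<close> as the two
  partial tangent maps.\<close>

lemma has_velocity_product:
  assumes X: "smooth_atlas X" and N: "smooth_atlas N" and Y: "smooth_atlas Y"
    and A: "smooth_map (prod_manifold X N) Y (\<lambda>(x, y). A x y)"
    and c: "has_velocity X c v t S" and d: "has_velocity N d w t S"
  shows "has_velocity Y (\<lambda>s. A (c s) (d s))
    (tangent_map X Y (\<lambda>x. A x (d t)) (c t) v + tangent_map N Y (\<lambda>y. A (c t) y) (d t) w) t S"
proof -
  note XN = smooth_atlas_prod[OF X N]
  define p q where "p = c t" and "q = d t"
  have p: "p \<in> points X" and q: "q \<in> points N" using has_velocityD(2) c d by (auto simp: p_def q_def)
  note v = has_velocityD(1)[OF c] and w = has_velocityD(1)[OF d]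
  obtain L where L: "linear L" "\<forall>c d v w t S. c t = p \<and> d t = q \<and> has_velocity X c v t S \<and> has_velocity N d w t S \<longrightarrow>
      has_velocity (prod_manifold X N) (\<lambda>s. (c s, d s)) (L (v, w)) t S"
    by (rule has_velocity_Pair[OF X N p q])
  obtain T where T: "linear T" "\<And>z. z \<in> model (prod_manifold X N) \<Longrightarrow>
      tangent_map (prod_manifold X N) Y (\<lambda>(x, y). A x y) (p, q) z = T z"
    using tangent_map_linear[OF XN Y A, of "(p, q)"] p q by (auto simp: points_prod_manifold)
  have M: "has_velocity Y (\<lambda>s. A (c s) (d s)) (T (L (v, w))) t S"
    if "c t = p" "d t = q" "has_velocity X c v t S" "has_velocity N d w t S" for c d v w t S
  proof -
    have *: "has_velocity (prod_manifold X N) (\<lambda>s. (c s, d s)) (L (v, w)) t S"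
      using L(2) that by blast
    then show ?thesis
      using has_velocity_map[OF XN Y A *] T(2)[OF has_velocityD(1)[OF *]] that(1,2) by simp
  qed
  note cp = has_velocity_param_line[OF X p v] and dq = has_velocity_param_line[OF N q w]
  have 1: "tangent_map X Y (\<lambda>x. A x q) p v = T (L (v, 0))"
    by (rule tangent_map_velocity[OF X p v M[OF cp(2) _ cp(1) has_velocity_const[OF N q]]]) simp
  have 2: "tangent_map N Y (\<lambda>y. A p y) q w = T (L (0, w))"
    by (rule tangent_map_velocity[OF N q w M[OF _ dq(2) has_velocity_const[OF X p] dq(1)]]) simp
  have "T (L (v, w)) = T (L (v, 0)) + T (L (0, w))"
    using linear_add[OF linear_compose[OF L(1) T(1)], of "(v, 0)" "(0, w)"] by simp
  then have "T (L (v, w)) = tangent_map X Y (\<lambda>x. A x q) p v + tangent_map N Y (\<lambda>y. A p y) q w"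
    using 1 2 by simp
  then show ?thesis using M[OF _ _ c d] by (simp add: p_def q_def)
qed

subsection \<open>Curves on the unit interval\<close>

lemma at_within_convex_nontrivial:
  fixes J :: "real set"
  assumes "convex J" "a \<in> J" "b \<in> J" "a \<noteq> b" "t \<in> J"
  shows "at t within J \<noteq> bot"
proof -
  have "t islimpt J"
    by (rule connected_imp_perfect[OF convex_connected[OF assms(1)] assms(5)]) (use assms in blast)
  then show ?thesis by (simp add: trivial_limit_within)
qed

lemma at_within_unit_interval: "t \<in> {0..1::real} \<Longrightarrow> at t within {0..1} \<noteq> bot"
  by (rule at_within_convex_nontrivial[of _ 0 1]) auto

lemma velocity_eq:
  assumes "has_velocity X c v t {0..1}" "t \<in> {0..1}"
  shows "velocity X c t = v"
  unfolding velocity_def comp_def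
  by (rule vector_derivative_within[OF at_within_unit_interval[OF assms(2)] has_velocityD(4)[OF assms(1)]])

lemma has_velocity_velocity:
  assumes "smooth_atlas X" "smooth_from {0..1} X c" "t \<in> {0..1}"
  shows "has_velocity X c (velocity X c t) t {0..1}"
  using smooth_from_has_velocity[OF assms at_within_unit_interval[OF assms(3)]] velocity_eq assms(3) by metis

section \<open>Smooth actions of Lie groups\<close>

locale lie_grp = group G for G (structure) +
  fixes X :: "('a, 'e::euclidean_space) manifold"
  assumes X: "smooth_atlas X" and points_X: "points X = carrier G"
    and mult_smooth: "smooth_map (prod_manifold X X) X (\<lambda>(x, y). x \<otimes> y)"
    and inv_smooth: "smooth_map X X (\<lambda>x. inv x)"
begin

lemma smooth_from_mult:
  assumes "smooth_from S X f" "smooth_from S X g"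
  shows "smooth_from S X (\<lambda>s. f s \<otimes> g s)"
  using smooth_map_from[OF smooth_atlas_prod[OF X X] X mult_smooth smooth_from_Pair[OF X X assms]] by simp

lemma smooth_from_inv: "smooth_from S X f \<Longrightarrow> smooth_from S X (\<lambda>s. inv f s)"
  by (rule smooth_map_from[OF X X inv_smooth])

lemma smooth_from_carrier: "smooth_from S X f \<Longrightarrow> s \<in> S \<Longrightarrow> f s \<in> carrier G"
  using smooth_from_points[OF X] points_X by blast

definition right_field :: "'a \<Rightarrow> 'e \<Rightarrow> 'e" where
  "right_field g v = tangent_map X X (\<lambda>x. x \<otimes> g) \<one> v"

text \<open>Arbitrary time sets are allowed so that solutions on overlapping subintervals can be
  restricted and glued.\<close>

definition solution :: "real set \<Rightarrow> (real \<Rightarrow> 'e) \<Rightarrow> (real \<Rightarrow> 'a) \<Rightarrow> bool" where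
  "solution J q g \<longleftrightarrow> smooth_from J X g \<and> (\<forall>t\<in>J. has_velocity X g (right_field (g t) (q t)) t J)"

end

locale smooth_action = lie_grp G X for G (structure) and X :: "('a, 'e::euclidean_space) manifold" +
  fixes N :: "('q, 'f::euclidean_space) manifold" and act :: "'a \<Rightarrow> 'q \<Rightarrow> 'q"
  assumes N: "smooth_atlas N"
    and act_smooth: "smooth_map (prod_manifold X N) N (\<lambda>(x, p). act x p)"
    and act_one: "p \<in> points N \<Longrightarrow> act \<one> p = p"
    and act_mult: "g \<in> carrier G \<Longrightarrow> h \<in> carrier G \<Longrightarrow> p \<in> points N \<Longrightarrow> act (g \<otimes> h) p = act g (act h p)"
begin

lemma smooth_from_act:
  assumes "smooth_from S X f" "smooth_from S N g"
  shows "smooth_from S N (\<lambda>s. act (f s) (g s))"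
  using smooth_map_from[OF smooth_atlas_prod[OF X N] N act_smooth smooth_from_Pair[OF X N assms]] by simp

lemma act_point_smooth: "p \<in> points N \<Longrightarrow> smooth_map X N (\<lambda>x. act x p)"
  by (intro smooth_mapI X N smooth_from_act smooth_from_inv_into smooth_from_const)

lemma act_elem_smooth: "g \<in> carrier G \<Longrightarrow> smooth_map N N (\<lambda>p. act g p)"
  by (intro smooth_mapI X N smooth_from_act smooth_from_inv_into smooth_from_const) (simp_all add: points_X)

lemma act_inv: "g \<in> carrier G \<Longrightarrow> p \<in> points N \<Longrightarrow> act (inv g) (act g p) = p"
  using act_mult[of "inv g" g p] act_one by simp

lemma act_inv': "g \<in> carrier G \<Longrightarrow> p \<in> points N \<Longrightarrow> act g (act (inv g) p) = p"
  using act_mult[of g "inv g" p] act_one by simp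

definition fundamental_field :: "'q \<Rightarrow> 'e \<Rightarrow> 'f" where
  "fundamental_field p v = tangent_map X N (\<lambda>x. act x p) \<one> v"

lemma tangent_act_inv:
  assumes g: "g \<in> carrier G" and p: "p \<in> points N" and w: "w \<in> model N"
  shows "tangent_map N N (act (inv g)) (act g p) (tangent_map N N (act g) p w) = w"
proof -
  have "tangent_map N N (act (inv g)) (act g p) (tangent_map N N (act g) p w) =
      tangent_map N N (\<lambda>p. act (inv g) (act g p)) p w"
    using tangent_map_compose[OF N N N act_elem_smooth[OF g] act_elem_smooth[OF inv_closed[OF g]] p w] by simp
  also have "\<dots> = tangent_map N N (\<lambda>p. p) p w"
    by (rule tangent_map_cong[OF N N smooth_map_compose[OF N N N act_elem_smooth[OF g] act_elem_smooth[OF inv_closed[OF g]]] _ p w])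
      (rule act_inv[OF g])
  also have "\<dots> = w" by (rule tangent_map_id[OF N p w])
  finally show ?thesis .
qed

end

context lie_grp
begin

lemma mult_action: "smooth_action G X X (\<otimes>)"
  by unfold_locales (use X mult_smooth points_X in \<open>auto simp: m_assoc\<close>)

lemma right_mult_smooth: "g \<in> carrier G \<Longrightarrow> smooth_map X X (\<lambda>x. x \<otimes> g)"
  using smooth_action.act_point_smooth[OF mult_action] points_X by simp

lemma right_field_model: "g \<in> carrier G \<Longrightarrow> v \<in> model X \<Longrightarrow> right_field g v \<in> model X"
  unfolding right_field_def
  by (rule tangent_map_model[OF X X right_mult_smooth]) (simp_all add: points_X)

end

context smooth_action
begin

text \<open>Differentiate \<open>act (x \<otimes> g) p = act x (act g p)\<close> at the
  identity.\<close>

lemma tangent_right_field: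
  assumes g: "g \<in> carrier G" and p: "p \<in> points N" and v: "v \<in> model X"
  shows "tangent_map X N (\<lambda>x. act x p) g (right_field g v) = fundamental_field (act g p) v"
proof -
  have one: "\<one> \<in> points X" by (simp add: points_X)
  have "tangent_map X N (\<lambda>x. act x p) g (right_field g v) = tangent_map X N (\<lambda>x. act (x \<otimes> g) p) \<one> v"
    using tangent_map_compose[OF X X N right_mult_smooth[OF g] act_point_smooth[OF p] one v] g
    by (simp add: right_field_def)
  also have "\<dots> = tangent_map X N (\<lambda>x. act x (act g p)) \<one> v"
    by (rule tangent_map_cong[OF X N smooth_map_compose[OF X X N right_mult_smooth[OF g] act_point_smooth[OF p]] _ one v])
      (use act_mult g p in \<open>simp add: points_X\<close>)
  finally show ?thesis by (simp add: fundamental_field_def)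
qed

lemma solution_transport_const:
  assumes g: "solution J q g" and q: "\<And>t. t \<in> J \<Longrightarrow> q t \<in> model X"
    and c: "smooth_from J N c" "\<And>t. t \<in> J \<Longrightarrow> has_velocity N c (fundamental_field (c t) (q t)) t J"
    and J: "convex J" "\<And>t. t \<in> J \<Longrightarrow> at t within J \<noteq> bot" and "a \<in> J" "b \<in> J"
  shows "act (inv (g a)) (c a) = act (inv (g b)) (c b)"
proof -
  have sg: "smooth_from J X g" using g by (simp add: solution_def)
  have gc: "g s \<in> carrier G" "c s \<in> points N" if "s \<in> J" for s
    using smooth_from_carrier[OF sg that] smooth_from_points[OF N c(1) that] by blast+
  define f where "f s = act (inv (g s)) (c s)" for s
  have f: "smooth_from J N f"
    unfolding f_def by (intro smooth_from_act smooth_from_inv sg c(1))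
  have fp: "f s \<in> points N" if "s \<in> J" for s using smooth_from_points[OF N f that] .
  \<comment> \<open>Differentiating \<open>c = act g f\<close> rather than the formula for
    \<open>f\<close> avoids the derivative of the inversion: the unknown velocity \<open>w\<close>
    of \<open>f\<close> appears in the one term of the product rule that is left over.\<close>
  have cf: "act (g s) (f s) = c s" if "s \<in> J" for s
    unfolding f_def by (rule act_inv'[OF gc[OF that]])
  have "has_velocity N f 0 t J" if t: "t \<in> J" for t
  proof -
    obtain w where w: "has_velocity N f w t J" using smooth_from_has_velocity[OF N f t J(2)[OF t]] .
    note wm = has_velocityD(1)[OF w]
    have "has_velocity X g (right_field (g t) (q t)) t J" using g t by (simp add: solution_def)
    from has_velocity_cong[OF N has_velocity_product[OF X N N act_smooth this w] t cf]
    have "has_velocity N c (tangent_map X N (\<lambda>x. act x (f t)) (g t) (right_field (g t) (q t)) +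
       tangent_map N N (act (g t)) (f t) w) t J" by simp
    then have "has_velocity N c (fundamental_field (c t) (q t) + tangent_map N N (act (g t)) (f t) w) t J"
      using tangent_right_field[OF gc(1)[OF t] fp[OF t] q[OF t]] cf[OF t] by simp
    then have "tangent_map N N (act (g t)) (f t) w = 0"
      using has_velocity_unique[OF N _ c(2)[OF t] J(2)[OF t]] by fastforce
    then have "w = 0"
      using tangent_act_inv[OF gc(1)[OF t] fp[OF t] wm] by (simp add: tangent_map_zero)
    then show ?thesis using w by simp
  qed
  then have "f a = f b" by (rule velocity_zero_constant[OF N f J(1) _ \<open>a \<in> J\<close> \<open>b \<in> J\<close>])
  then show ?thesis by (simp add: f_def)
qed

end

section \<open>Right-invariant differential equations\<close>

context lie_grp
begin

lemma one_points: "\<one> \<in> points X"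
  by (simp add: points_X)

lemma mult_fundamental_field: "smooth_action.fundamental_field G X X (\<otimes>) = right_field"
  by (intro ext) (simp add: smooth_action.fundamental_field_def[OF mult_action] right_field_def)

lemma solution_unique:
  assumes g: "solution J q g" and k: "solution J q k" and q: "\<And>t. t \<in> J \<Longrightarrow> q t \<in> model X"
    and J: "convex J" "\<And>t. t \<in> J \<Longrightarrow> at t within J \<noteq> bot"
    and b: "b \<in> J" "g b = k b" and t: "t \<in> J"
  shows "g t = k t"
proof -
  have gc: "g s \<in> carrier G" "k s \<in> carrier G" if "s \<in> J" for s
    using smooth_from_carrier that g k by (auto simp: solution_def)
  have "inv (g t) \<otimes> k t = inv (g b) \<otimes> k b"
    by (rule smooth_action.solution_transport_const[OF mult_action g q _ _ J t b(1)])
      (use k in \<open>auto simp: solution_def mult_fundamental_field\<close>)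
  also have "\<dots> = \<one>" using gc[OF b(1)] b(2) by simp
  finally show ?thesis using gc[OF t] by (metis inv_equality inv_inv inv_closed)
qed

lemma solution_right_mult:
  assumes g: "solution J q g" and q: "\<And>t. t \<in> J \<Longrightarrow> q t \<in> model X" and h: "h \<in> carrier G"
  shows "solution J q (\<lambda>s. g s \<otimes> h)"
  unfolding solution_def
proof (intro conjI ballI)
  have sg: "smooth_from J X g" using g by (simp add: solution_def)
  show "smooth_from J X (\<lambda>s. g s \<otimes> h)"
    by (intro smooth_from_mult sg smooth_from_const[OF X]) (simp add: points_X h)
  fix t assume t: "t \<in> J"
  have "has_velocity X g (right_field (g t) (q t)) t J" using g t by (simp add: solution_def)
  from has_velocity_map[OF X X right_mult_smooth[OF h] this]
  show "has_velocity X (\<lambda>s. g s \<otimes> h) (right_field (g t \<otimes> h) (q t)) t J"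
    using smooth_action.tangent_right_field[OF mult_action smooth_from_carrier[OF sg t] _ q[OF t], of h] h
    by (simp add: mult_fundamental_field points_X)
qed

lemma solution_cong:
  assumes "solution J q g" "\<And>s. s \<in> J \<Longrightarrow> g s = k s"
  shows "solution J q k"
  using assms smooth_from_cong[OF X _ assms(2)] has_velocity_cong[OF X _ _ assms(2)]
  by (auto simp: solution_def)

lemma solution_subset: "solution J q g \<Longrightarrow> K \<subseteq> J \<Longrightarrow> solution K q g"
  unfolding solution_def using smooth_from_subset[OF X] has_velocity_subset[OF X] by blast

text \<open>Relative openness of both pieces makes velocities within a piece and within the union
  the same.\<close>

lemma solution_union:
  assumes A: "openin (top_of_set (A \<union> B)) A" "solution A q g"
    and B: "openin (top_of_set (A \<union> B)) B" "solution B q g"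
  shows "solution (A \<union> B) q g"
  unfolding solution_def
proof (intro conjI ballI)
  show "smooth_from (A \<union> B) X g"
    by (rule smooth_from_local[OF X]) (use A B in \<open>auto simp: solution_def\<close>)
  fix t assume "t \<in> A \<union> B"
  then show "has_velocity X g (right_field (g t) (q t)) t (A \<union> B)"
    using A B has_velocity_within_openin[OF X A(1)] has_velocity_within_openin[OF X B(1)]
    unfolding solution_def by blast
qed

end

section \<open>Existence of solutions and the map Evol\<close>

context lie_grp
begin

text \<open>The solution constructed passes through the identity at time \<open>t0\<close>. In the
  chart there, the right-invariant field is a partial derivative of the multiplication, hence
  smooth. The resulting equation makes sense for times in \<open>[0, 1]\<close> and values in
  \<open>model X\<close> only, and is extended to an open set before Picard iteration.\<close>

lemma ex_local_solution:
  assumes q: "smooth_on {0..1} q" "\<And>t. t \<in> {0..1} \<Longrightarrow> q t \<in> model X" and t0: "t0 \<in> {0..1}"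
  obtains J g where "openin (top_of_set {0..1}) J" "convex J" "t0 \<in> J" "solution J q g"
proof -
  note V = subspace_model[OF X]
  define U \<phi> where "U = dom_at X \<one>" and "\<phi> = coord_at X \<one>"
  have U: "(U, \<phi>) \<in> atlas X" "\<one> \<in> U" using chart_at_atlas[OF X one_points] by (simp_all add: U_def \<phi>_def)
  have UG: "U \<subseteq> carrier G" using chart_points[OF X U(1)] points_X by simp
  define par where "par = inv_into U \<phi>"
  have par_\<phi>: "par (\<phi> h) = h" if "h \<in> U" for h using chart_inv[OF X U(1) that] by (simp add: par_def)
  have spar: "smooth_from (\<phi> ` U) X par" unfolding par_def by (rule smooth_from_inv_into[OF X U(1)])
  \<comment> \<open>The first coordinate is the point \<open>h\<close>, the second the left factor
    that varies around the identity, so that the partial derivative in the second variable is the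
    right field at \<open>h\<close>.\<close>
  define m where "m z = par (snd z) \<otimes> par (fst z)" for z
  define W where "W = (\<phi> ` U \<times> \<phi> ` U) \<inter> m -` U"
  have sm: "smooth_from (\<phi> ` U \<times> \<phi> ` U) X m"
    unfolding m_def
    by (intro smooth_from_mult smooth_from_comp[OF X _ _ spar] smooth_on_fst smooth_on_snd smooth_on_id) auto
  have "openin (top_of_set (\<phi> ` U \<times> \<phi> ` U)) W"
    unfolding W_def by (rule smooth_from_vimage[OF X sm openin_chart_domain[OF X U(1)]])
  then have W: "openin (top_of_set (model X \<times> model X)) W"
    using openin_Times[OF chart_image[OF X U(1)] chart_image[OF X U(1)]] openin_trans by blast
  have smW: "smooth_on W (\<lambda>z. \<phi> (m z))" unfolding W_def by (rule smooth_from_chartD[OF X sm U(1)])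
  obtain D where D: "smooth_on (W \<times> UNIV) (\<lambda>z. D (fst z) (snd z))"
    "\<And>y x. (y, x) \<in> W \<Longrightarrow> ((\<lambda>x. \<phi> (m (y, x))) has_derivative D (y, x)) (at x within model X)"
    using smooth_on_partial_derivative[OF V V W smW] by blast
  have inW: "(\<phi> h, \<phi> \<one>) \<in> W" if "h \<in> U" for h
    using that U(2) par_\<phi> UG by (auto simp: W_def m_def)
  have D_eq: "deriv_along X \<phi> h (right_field h v) = D (\<phi> h, \<phi> \<one>) v" if h: "h \<in> U" and v: "v \<in> model X" for h v
  proof -
    let ?k = "\<lambda>s. par (\<phi> \<one> + s *\<^sub>R v)"
    have hG: "h \<in> carrier G" using UG h by blast
    have k: "has_velocity X ?k v 0 UNIV" "?k 0 = \<one>"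
      using has_velocity_param_line[OF X one_points v]
      by (simp_all add: par_def U_def \<phi>_def param_at_def)
    have "has_velocity X (\<lambda>s. ?k s \<otimes> h) (right_field h v) 0 UNIV"
      using has_velocity_map[OF X X right_mult_smooth[OF hG] k(1)] k(2) by (simp add: right_field_def)
    from has_velocity_chart[OF X U(1) _ this]
    have "((\<lambda>s. \<phi> (?k s \<otimes> h)) has_vector_derivative deriv_along X \<phi> h (right_field h v)) (at 0)"
      using k(2) h hG by simp
    moreover have "((\<lambda>s. \<phi> (m (\<phi> h, \<phi> \<one> + s *\<^sub>R v))) has_vector_derivative D (\<phi> h, \<phi> \<one>) v) (at 0)"
      by (rule has_derivative_along_line[OF V D(2)[OF inW[OF h]] chart_model[OF X U] v])
    ultimately show ?thesis
      using vector_derivative_unique_at by (fastforce simp: m_def par_\<phi>[OF h])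
  qed
  define F0 where "F0 z = D (snd z, \<phi> \<one>) (q (fst z))" for z
  define B where "B = {0..1::real} \<times> \<phi> ` U"
  have "smooth_on B F0"
    unfolding F0_def
  proof (rule smooth_on_compose[OF _ D(1), of B "\<lambda>z. ((snd z, \<phi> \<one>), q (fst z))", simplified])
    show "smooth_on B (\<lambda>z. ((snd z, \<phi> \<one>), q (fst z)))"
      by (intro smooth_on_Pair smooth_on_const smooth_on_snd smooth_on_id
          smooth_on_compose[OF smooth_on_fst[OF smooth_on_id] q(1)]) (auto simp: B_def)
    show "(\<lambda>z. ((snd z, \<phi> \<one>), q (fst z))) ` B \<subseteq> W \<times> UNIV"
      using inW by (auto simp: B_def)
  qed
  moreover have "(t0, \<phi> \<one>) \<in> B" using t0 U by (auto simp: B_def)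
  \<comment> \<open>The extension reaches beyond \<open>[0, 1]\<close>, so \<open>t0\<close> may be
    an end point.\<close>
  ultimately obtain O1 F1 where F1: "open O1" "(t0, \<phi> \<one>) \<in> O1" "\<forall>k. Ck_on k O1 F1" "\<forall>z\<in>B \<inter> O1. F1 z = F0 z"
    by (rule smooth_onE)
  obtain P :: "'e \<Rightarrow> 'e" where P: "linear P" "\<And>x. P x \<in> model X" "\<And>x. x \<in> model X \<Longrightarrow> P x = x"
    using subspace_projection[OF V] by metis
  obtain T where T: "open T" "\<phi> ` U = model X \<inter> T"
    using chart_image[OF X U(1)] by (auto simp: openin_open)
  \<comment> \<open>Projecting the argument gives an equation on an open set of the whole space;
    projecting the value keeps solutions that start in \<open>model X\<close> inside it. The factor
    \<open>T\<close> in \<open>O3\<close> then confines them to the image of the chart.\<close>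
  let ?r = "\<lambda>z::real \<times> 'e. (fst z, P (snd z))"
  define O3 where "O3 = ?r -` O1 \<inter> UNIV \<times> T"
  define F2 where "F2 z = P (F1 (?r z))" for z
  have sr: "smooth_on S ?r" for S
    by (intro smooth_on_Pair smooth_on_fst smooth_on_id smooth_on_linear_comp[OF P(1)] smooth_on_snd)
  have O3: "open O3"
    unfolding O3_def
    using open_vimage[OF F1(1) smooth_on_imp_continuous_on[OF sr]] T(1) by (intro open_Int open_Times) auto
  have F2: "smooth_on O3 F2"
    unfolding F2_def
    by (intro smooth_on_linear_comp[OF P(1)] smooth_on_compose[OF sr smooth_on_Ck[OF F1(1) F1(3)[rule_format]]])
      (auto simp: O3_def)
  have e: "\<phi> \<one> \<in> model X" "\<phi> \<one> \<in> T" using T(2) U(2) by blast+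
  have "(t0, \<phi> \<one>) \<in> O3" using F1(2) e P(3) by (simp add: O3_def)
  then have "\<exists>d y. d > 0 \<and> y t0 = \<phi> \<one> \<and>
      (\<forall>t\<in>{t0-d<..<t0+d}. (t, y t) \<in> O3 \<and> (y has_vector_derivative F2 (t, y t)) (at t))"
    by (rule picard_solution[OF O3 F2]) blast
  then obtain d y where d: "d > 0" "y t0 = \<phi> \<one>"
    "\<And>t. t \<in> {t0-d<..<t0+d} \<Longrightarrow> (t, y t) \<in> O3 \<and> (y has_vector_derivative F2 (t, y t)) (at t)"
    by blast
  let ?I = "{t0-d<..<t0+d}"
  have sy: "smooth_on ?I y" by (rule smooth_on_ode_solution[OF O3 F2 _ d(3)]) auto
  \<comment> \<open>The component \<open>y - P y\<close> has derivative zero, as \<open>F2\<close>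
    takes values in \<open>model X\<close>, and it vanishes at \<open>t0\<close>.\<close>
  have yV: "y t \<in> model X" if t: "t \<in> ?I" for t
  proof -
    have *: "((\<lambda>s. y s - P (y s)) has_vector_derivative 0) (at s within ?I)" if s: "s \<in> ?I" for s
    proof -
      have y': "(y has_vector_derivative F2 (s, y s)) (at s within ?I)"
        using d(3)[OF s] has_vector_derivative_at_within by blast
      have "((\<lambda>s. P (y s)) has_vector_derivative P (F2 (s, y s))) (at s within ?I)"
        using bounded_linear.has_vector_derivative[OF _ y'] P(1) linear_linear by blast
      from has_vector_derivative_diff[OF y' this] show ?thesis using P(2,3) by (simp add: F2_def)
    qed
    have "\<exists>k. \<forall>s\<in>?I. y s - P (y s) = k"
      by (rule has_vector_derivative_zero_constant[OF convex_real_interval(8) *]) (assumption, blast)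
    then obtain k where k: "\<And>s. s \<in> ?I \<Longrightarrow> y s - P (y s) = k" by blast
    have "k = 0" using k[of t0] d(1,2) P(3)[OF e(1)] by simp
    then show ?thesis using k[OF t] P(2)[of "y t"] by simp
  qed
  define J where "J = {0..1} \<inter> ?I"
  have J: "openin (top_of_set {0..1}) J" "convex J" "t0 \<in> J"
    using t0 d(1) by (auto simp: J_def openin_open intro: convex_Int)
  have yU: "y t \<in> \<phi> ` U" if "t \<in> J" for t
    using d(3)[of t] yV[of t] that unfolding T(2) by (auto simp: J_def O3_def)
  define g where "g t = par (y t)" for t
  have gU: "g t \<in> U" and \<phi>g: "\<phi> (g t) = y t" if "t \<in> J" for t
    using yU[OF that] par_\<phi> by (auto simp: g_def)
  have sg: "smooth_from J X g"
    unfolding g_def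
    by (rule smooth_from_comp[OF X smooth_on_subset[OF sy] yU spar]) (auto simp: J_def)
  have "has_velocity X g (right_field (g t) (q t)) t J" if t: "t \<in> J" for t
  proof -
    have t01: "t \<in> {0..1}" and tI: "t \<in> ?I" using t by (auto simp: J_def)
    note qt = q(2)[OF t01]
    have gG: "g t \<in> carrier G" using gU[OF t] UG by blast
    have nb: "at t within J \<noteq> bot"
      using at_within_openin[OF J(1) t] at_within_unit_interval[OF t01] by simp
    \<comment> \<open>Existence of some velocity follows from smoothness; it is then identified
      through its coordinates, since these determine tangent vectors.\<close>
    obtain v where v: "has_velocity X g v t J" using smooth_from_has_velocity[OF X sg t nb] .
    have dm: "deriv_along X \<phi> (g t) (right_field (g t) (q t)) \<in> model X"
      by (rule deriv_along_chart_model[OF X U(1) gU[OF t] right_field_model[OF gG qt]])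
    have "(t, y t) \<in> B \<inter> O1"
      using d(3)[OF tI] yU[OF t] t01 P(3)[OF yV[OF tI]] by (auto simp: B_def O3_def)
    then have "F1 (t, y t) = deriv_along X \<phi> (g t) (right_field (g t) (q t))"
      using F1(4) D_eq[OF gU[OF t] qt] \<phi>g[OF t] by (simp add: F0_def)
    then have "F2 (t, y t) = deriv_along X \<phi> (g t) (right_field (g t) (q t))"
      using P(3)[OF yV[OF tI]] P(3)[OF dm] by (simp add: F2_def)
    then have "(y has_vector_derivative deriv_along X \<phi> (g t) (right_field (g t) (q t))) (at t within J)"
      using d(3)[OF tI] has_vector_derivative_at_within by metis
    moreover have "(y has_vector_derivative deriv_along X \<phi> (g t) v) (at t within J)"
      by (rule has_vector_derivative_transform[OF t _ has_velocity_chart[OF X U(1) gU[OF t] v]])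
        (simp add: \<phi>g)
    ultimately have "deriv_along X \<phi> (g t) v = deriv_along X \<phi> (g t) (right_field (g t) (q t))"
      using vector_derivative_unique_within[OF nb] by blast
    then have "v = right_field (g t) (q t)"
      by (rule deriv_along_chart_inj[OF X U(1) gU[OF t] has_velocityD(1)[OF v] right_field_model[OF gG qt]])
    then show ?thesis using v by simp
  qed
  then have "solution J q g" using sg by (simp add: solution_def)
  then show thesis using that J by blast
qed

text \<open>Bisection: having a solution on a neighbourhood of a subinterval holds for short
  intervals and passes to concatenations.\<close>

lemma ex_solution:
  assumes q: "smooth_on {0..1} q" "\<And>t. t \<in> {0..1} \<Longrightarrow> q t \<in> model X"
  obtains g where "solution {0..1} q g" "g 0 = \<one>"
proof -
  \<comment> \<open>Relatively open \<open>J\<close> let adjacent pieces overlap around the common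
    end point, and uniqueness makes them agree on the overlap.\<close>
  define Q where "Q a b \<longleftrightarrow> (0 \<le> a \<and> a \<le> b \<and> b \<le> 1 \<longrightarrow>
    (\<exists>J g. openin (top_of_set {0..1}) J \<and> convex J \<and> {a..b} \<subseteq> J \<and> solution J q g))" for a b :: real
  have "(0::real) \<le> 1" by simp
  then have "Q 0 1"
  proof (induction rule: Bolzano)
    case (trans a b c)
    show ?case
      unfolding Q_def
    proof (intro impI, elim conjE)
      assume ac: "0 \<le> a" "a \<le> c" "c \<le> 1"
      obtain J1 g1 where 1: "openin (top_of_set {0..1}) J1" "convex J1" "{a..b} \<subseteq> J1" "solution J1 q g1"
        using trans ac unfolding Q_def by force
      obtain J2 g2 where 2: "openin (top_of_set {0..1}) J2" "convex J2" "{b..c} \<subseteq> J2" "solution J2 q g2"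
        using trans ac unfolding Q_def by force
      have b: "b \<in> J1" "b \<in> J2" using 1(3) 2(3) trans by auto
      have J01: "J1 \<subseteq> {0..1}" "J2 \<subseteq> {0..1}" using 1(1) 2(1) openin_imp_subset by blast+
      \<comment> \<open>Right translation by \<open>h\<close> moves the value of \<open>g2\<close>
        at \<open>b\<close> to that of \<open>g1\<close>.\<close>
      define h where "h = inv (g2 b) \<otimes> g1 b"
      have g12: "g1 b \<in> carrier G" "g2 b \<in> carrier G"
        using smooth_from_carrier 1(4) 2(4) b by (auto simp: solution_def)
      then have h: "h \<in> carrier G" by (simp add: h_def)
      define k where "k s = g2 s \<otimes> h" for s
      have k: "solution J2 q k"
        unfolding k_def by (rule solution_right_mult[OF 2(4) q(2) h]) (use J01 in auto)
      have kb: "k b = g1 b" using g12 by (simp add: k_def h_def m_assoc[symmetric])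
      have op: "openin (top_of_set {0..1}) (J1 \<inter> J2)" using 1(1) 2(1) by blast
      have eq: "g1 t = k t" if t: "t \<in> J1 \<inter> J2" for t
      proof (rule solution_unique[where J = "J1 \<inter> J2" and q = q and b = b])
        show "solution (J1 \<inter> J2) q g1" "solution (J1 \<inter> J2) q k"
          using solution_subset 1(4) k by blast+
        show "at s within J1 \<inter> J2 \<noteq> bot" if "s \<in> J1 \<inter> J2" for s
          using at_within_openin[OF op that] at_within_unit_interval[of s] that J01 by auto
      qed (use q(2) J01 1(2) 2(2) b kb t in \<open>auto intro: convex_Int\<close>)
      define g where "g s = (if s \<in> J1 then g1 s else k s)" for s
      have gs: "solution J1 q g" "solution J2 q g"
        by (rule solution_cong[OF 1(4)], simp add: g_def, rule solution_cong[OF k], simp add: g_def eq)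
      have sub: "J1 \<union> J2 \<subseteq> {0..1}" using J01 by blast
      have "openin (top_of_set (J1 \<union> J2)) J1" "openin (top_of_set (J1 \<union> J2)) J2"
        using openin_subset_trans[OF 1(1) _ sub] openin_subset_trans[OF 2(1) _ sub] by blast+
      then have "solution (J1 \<union> J2) q g" using solution_union gs by blast
      moreover have "convex (J1 \<union> J2)"
        using connected_Un[OF convex_connected[OF 1(2)] convex_connected[OF 2(2)]] b
        by (metis IntI empty_iff is_interval_connected_1 is_interval_convex_1)
      moreover have "{a..c} \<subseteq> J1 \<union> J2" using ivl_disj_un_two_touch(4)[of a b c] trans(3,4) 1(3) 2(3) by blast
      moreover have "openin (top_of_set {0..1}) (J1 \<union> J2)" using 1(1) 2(1) by blast
      ultimately show "\<exists>J g. openin (top_of_set {0..1}) J \<and> convex J \<and> {a..c} \<subseteq> J \<and> solution J q g"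
        by blast
    qed
  next
    case (local x)
    then have x: "x \<in> {0..1}" by simp
    obtain J g where J: "openin (top_of_set {0..1}) J" "convex J" "x \<in> J" "solution J q g"
      by (rule ex_local_solution[OF q x])
    obtain e where e: "e > 0" "ball x e \<inter> {0..1} \<subseteq> J"
      using J(1,3) unfolding openin_contains_ball by blast
    have "Q a b" if "a \<le> x" "x \<le> b" "b - a < e" for a b
      unfolding Q_def
    proof (intro impI exI[of _ J] exI[of _ g] conjI J(1,2,4))
      assume "0 \<le> a \<and> a \<le> b \<and> b \<le> 1"
      then show "{a..b} \<subseteq> J" using that e(2) by (auto simp: dist_real_def subset_iff)
    qed
    then show ?case using e(1) by blast
  qed
  then obtain J g where J: "openin (top_of_set {0..1}) J" "{0..1} \<subseteq> J" "solution J q g"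
    by (auto simp: Q_def)
  then have "J = {0..1}" using openin_imp_subset by blast
  then have g: "solution {0..1} q g" using J(3) by simp
  then have g0: "g 0 \<in> carrier G" using smooth_from_carrier[of "{0..1}" g 0] by (simp add: solution_def)
  show thesis
    by (rule that[OF solution_right_mult[OF g q(2), of "inv (g 0)"]]) (use g0 in auto)
qed

text \<open>The description in \<open>Evol\<close> requires uniqueness as functions on the whole
  line, so extensionality off \<open>[0, 1]\<close> complements the uniqueness of solutions.\<close>

lemma Evol_solution:
  assumes q: "smooth_on {0..1} q" "\<And>t. t \<in> {0..1} \<Longrightarrow> q t \<in> model X"
  shows "solution {0..1} q (Evol G X q)" "Evol G X q 0 = \<one>"
proof -
  define Q where "Q g \<longleftrightarrow> g \<in> Cinf_at X \<one> \<and>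
     (\<forall>t\<in>{0..1}. velocity X g t = tangent_map X X (\<lambda>x. x \<otimes> g t) \<one> (q t))" for g
  have Q: "solution {0..1} q g \<and> g 0 = \<one> \<and> g \<in> extensional {0..1}" if "Q g" for g
  proof -
    have g: "smooth_from {0..1} X g" using that by (simp add: Q_def Cinf_at_def Cinf_def)
    then show ?thesis
      using has_velocity_velocity[OF X g] that
      by (auto simp: Q_def Cinf_at_def Cinf_def solution_def right_field_def)
  qed
  obtain g where g: "solution {0..1} q g" "g 0 = \<one>" by (rule ex_solution[OF q])
  let ?g = "restrict g {0..1}"
  have sg: "solution {0..1} q ?g" by (rule solution_cong[OF g(1)]) simp
  have "Q ?g"
    unfolding Q_def Cinf_at_def Cinf_def
    using sg g(2) velocity_eq[of X ?g] by (auto simp: solution_def right_field_def)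
  moreover have "k = ?g" if "Q k" for k
  proof (rule extensionalityI[of _ "{0..1}"])
    show "k t = ?g t" if t: "t \<in> {0..1}" for t
      by (rule solution_unique[OF _ sg q(2), where b = 0])
        (use Q[OF \<open>Q k\<close>] g(2) t at_within_unit_interval in auto)
  qed (use Q[OF that] in auto)
  ultimately have "Q (THE g. Q g)" by (rule theI)
  moreover have "Evol G X q = (THE g. Q g)" by (simp add: Evol_def Q_def)
  ultimately show "solution {0..1} q (Evol G X q)" "Evol G X q 0 = \<one>" using Q by simp_all
qed

end

section \<open>Homogeneous spaces\<close>

locale homogeneous = lie_grp G X for G (structure) and X :: "('a, 'e::euclidean_space) manifold" +
  fixes H :: "'a set" and M :: "('a set, 'f::euclidean_space) manifold"
  assumes H: "subgroup H G" and M: "smooth_atlas M" and points_M: "points M = lcosets H"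
    and proj_smooth: "smooth_map X M (\<lambda>g. g <# H)"
    and proj_surj: "p \<in> carrier G \<Longrightarrow> tangent_map X M (\<lambda>g. g <# H) p ` model X = model M"
begin

lemma coset_repr:
  assumes "C \<in> points M"
  obtains g where "g \<in> carrier G" "C = g <# H"
  using assms by (auto simp: points_M LCOSETS_def)

lemma coset_points: "g \<in> carrier G \<Longrightarrow> g <# H \<in> points M"
  by (auto simp: points_M LCOSETS_def)

lemma H_points: "H \<in> points M"
  using coset_points[OF one_closed] lcos_mult_one[OF subgroup.subset[OF H]] by simp

lemma coset_mult: "g \<in> carrier G \<Longrightarrow> h \<in> carrier G \<Longrightarrow> g <# (h <# H) = (g \<otimes> h) <# H"
  by (rule lcos_m_assoc[OF subgroup.subset[OF H]])

lemma coset_elem: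
  assumes "C \<in> points M" "g \<in> C"
  shows "g \<in> carrier G" "C = g <# H"
proof -
  obtain a where a: "a \<in> carrier G" "C = a <# H" by (rule coset_repr[OF assms(1)])
  show "g \<in> carrier G"
    using l_coset_subset_G[OF subgroup.subset[OF H] a(1)] a(2) assms(2) by blast
  show "C = g <# H" using l_repr_independence[OF _ a(1) H] a(2) assms(2) by simp
qed

lemma coset_nonempty: "C \<in> points M \<Longrightarrow> \<exists>g. g \<in> C"
  using coset_repr lcos_self[OF _ H] by metis

lemma smooth_from_proj: "smooth_from S X g \<Longrightarrow> smooth_from S M (\<lambda>s. g s <# H)"
  by (rule smooth_map_from[OF X M proj_smooth])

section \<open>Local sections of the projection and the smooth action on cosets\<close>

definition local_section :: "'a set \<Rightarrow> 'a set set \<Rightarrow> ('a set \<Rightarrow> 'a) \<Rightarrow> bool" where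
  "local_section C U \<sigma> \<longleftrightarrow> openin (mtop M) U \<and> C \<in> U \<and> U \<subseteq> dom_at M C \<and>
     (\<forall>p\<in>U. \<sigma> p <# H = p) \<and> smooth_from (coord_at M C ` U) X (\<lambda>y. \<sigma> (param_at M C y))"

text \<open>The projection has a surjective derivative \<open>D\<close> at \<open>g0\<close> but may
  lower the dimension. On a slice through \<open>g0\<close> in the range of a right inverse
  \<open>R\<close> of \<open>D\<close>, its derivative becomes the identity of
  \<open>model M\<close>, and inverting this restriction supplies the section.\<close>

lemma ex_local_section:
  assumes C: "C \<in> points M"
  obtains U \<sigma> where "local_section C U \<sigma>"
proof -
  obtain g0 where g0: "g0 \<in> carrier G" "C = g0 <# H" by (rule coset_repr[OF C])
  have g0X: "g0 \<in> points X" using g0 by (simp add: points_X)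
  note VX = subspace_model[OF X] and VM = subspace_model[OF M]
  define U \<phi> where "U = dom_at X g0" and "\<phi> = coord_at X g0"
  define W \<psi> where "W = dom_at M C" and "\<psi> = coord_at M C"
  have U: "(U, \<phi>) \<in> atlas X" "g0 \<in> U" using chart_at_atlas[OF X g0X] by (simp_all add: U_def \<phi>_def)
  have W: "(W, \<psi>) \<in> atlas M" "C \<in> W" using chart_at_atlas[OF M C] by (simp_all add: W_def \<psi>_def)
  define par where "par = inv_into U \<phi>"
  have par: "par (\<phi> h) = h" if "h \<in> U" for h using chart_inv[OF X U(1) that] by (simp add: par_def)
  have spar: "smooth_from (\<phi> ` U) X par" unfolding par_def by (rule smooth_from_inv_into[OF X U(1)])
  define f where "f x = \<psi> (par x <# H)" for x
  define A where "A = \<phi> ` U \<inter> (\<lambda>x. par x <# H) -` W"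
  have "openin (top_of_set (\<phi> ` U)) A"
    unfolding A_def by (rule smooth_from_vimage[OF M smooth_from_proj[OF spar] openin_chart_domain[OF M W(1)]])
  then have A: "openin (top_of_set (model X)) A" using chart_image[OF X U(1)] openin_trans by blast
  have sf: "smooth_on A f"
    unfolding A_def f_def by (rule smooth_from_chartD[OF M smooth_from_proj[OF spar] W(1)])
  define x0 where "x0 = \<phi> g0"
  have x0: "x0 \<in> A" using U W g0 by (auto simp: A_def x0_def par)
  have x0V: "x0 \<in> model X" using A x0 openin_imp_subset by blast
  obtain D where D: "(f has_derivative D) (at x0 within model X)"
    using smooth_on_subspace_derivative[OF VX A sf] x0 by blast
  have linD: "linear D" using D has_derivative_linear by blast
  have "tangent_map X M (\<lambda>g. g <# H) g0 v = D v" if "v \<in> model X" for v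
    by (rule tangent_map_eq[OF X g0X _ that])
      (use D in \<open>simp add: f_def[abs_def] par_def U_def \<phi>_def \<psi>_def g0(2) param_at_def x0_def\<close>)
  then have Dsurj: "D ` model X = model M" using proj_surj[OF g0(1)] by force
  obtain R :: "'f \<Rightarrow> 'e" where R0: "range R \<subseteq> model X" "linear R" "\<forall>v\<in>D ` model X. D (R v) = v"
    using linear_exists_right_inverse_on[OF linD VX] by blast
  have R: "\<And>y. R y \<in> model X" "linear R" "\<And>v. v \<in> model M \<Longrightarrow> D (R v) = v"
    using R0 Dsurj by auto
  obtain P :: "'f \<Rightarrow> 'f" where P: "linear P" "\<And>x. P x \<in> model M" "\<And>x. x \<in> model M \<Longrightarrow> P x = x"
    using subspace_projection[OF VM] by metis
  \<comment> \<open>An affine parametrization of the slice, transversal to the kernel of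
    \<open>D\<close>.\<close>
  let ?r = "\<lambda>y. x0 + R (P y)"
  define Q where "Q = ?r -` A"
  have sr: "smooth_on S ?r" for S
    by (intro smooth_on_add smooth_on_const smooth_on_linear_comp[OF R(2)] smooth_on_linear[OF P(1)])
  have rV: "?r y \<in> model X" for y using x0V R(1) VX by (intro subspace_add)
  obtain T where T: "open T" "A = model X \<inter> T" using A by (auto simp: openin_open)
  have "Q = ?r -` T" using T(2) rV by (auto simp: Q_def)
  then have Q: "open Q" using open_vimage[OF T(1) smooth_on_imp_continuous_on[OF sr]] by simp
  have lin0: "P 0 = 0" "R 0 = 0" using linear_0 P(1) R(2) by blast+
  have Q0: "0 \<in> Q" using x0 by (simp add: Q_def lin0)
  \<comment> \<open>The summand \<open>y - P y\<close> extends the local representation of the projection, which is defined on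
    \<open>model M\<close> only, to a map of the whole space whose derivative at \<open>0\<close> is the identity.\<close>
  define h where "h y = f (?r y) + (y - P y)" for y
  have lin: "linear (\<lambda>y. y - P y)"
    using linear_compose_sub[OF linear_id[unfolded id_def] P(1)] by simp
  have sh: "smooth_on Q h"
    unfolding h_def
    by (intro smooth_on_add smooth_on_compose[OF sr sf] smooth_on_linear[OF lin]) (auto simp: Q_def)
  have h': "(h has_derivative (\<lambda>y. y)) (at 0)"
  proof -
    have bl: "bounded_linear P" "bounded_linear R" using P(1) R(2) linear_linear by blast+
    have 1: "(?r has_derivative (\<lambda>y. R (P y))) (at 0)"
      using bounded_linear_imp_has_derivative[OF bounded_linear_compose[OF bl(2,1)]]
      by (auto intro!: derivative_eq_intros)
    have "((\<lambda>y. f (?r y)) has_derivative (\<lambda>y. D (R (P y)))) (at 0)"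
      by (rule has_derivative_in_compose[OF 1])
        (use has_derivative_subset[OF D, of "range ?r"] rV in \<open>auto simp: lin0\<close>)
    then have "((\<lambda>y. f (?r y)) has_derivative P) (at 0)" using R(3) P(2) by simp
    from has_derivative_add[OF this bounded_linear_imp_has_derivative[OF lin[unfolded linear_conv_bounded_linear]]]
    show ?thesis by (simp add: h_def[abs_def])
  qed
  obtain V K where K: "open V" "h 0 \<in> V" "smooth_on V K" "K ` V \<subseteq> Q" "\<And>y. y \<in> V \<Longrightarrow> h (K y) = y" "K (h 0) = 0"
    using smooth_inverse_function[OF Q sh Q0 h'] by blast
  have h0: "h 0 = \<psi> C" using U g0(2) by (simp add: h_def lin0 f_def x0_def par)
  define U0 where "U0 = {p \<in> W. \<psi> p \<in> model M \<inter> V}"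
  define \<sigma> where "\<sigma> p = par (?r (K (\<psi> p)))" for p
  have opU0: "openin (mtop M) U0"
    unfolding U0_def by (rule openin_chart_vimage[OF M W(1)]) (simp add: K(1) openin_open_Int)
  have rA: "?r (K y) \<in> A" if "y \<in> V" for y using K(4) that by (auto simp: Q_def)
  have sec: "\<sigma> p <# H = p" if p: "p \<in> U0" for p
  proof -
    let ?y = "\<psi> p"
    have y: "?y \<in> model M" "?y \<in> V" "p \<in> W" using p by (auto simp: U0_def)
    let ?x = "?r (K ?y)"
    have x: "?x \<in> \<phi> ` U" "par ?x <# H \<in> W" using rA[OF y(2)] by (auto simp: A_def)
    have fM: "f ?x \<in> model M" unfolding f_def by (rule chart_model[OF M W(1) x(2)])
    have y_eq: "?y = f ?x + (K ?y - P (K ?y))" using K(5)[OF y(2)] by (simp add: h_def)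
    then have "K ?y - P (K ?y) = ?y - f ?x" by (simp add: algebra_simps)
    \<comment> \<open>This difference lies in \<open>model M\<close>, where \<open>P\<close> is the
      identity, yet \<open>P\<close> annihilates it. So the auxiliary summand of \<open>h\<close>
      vanishes at \<open>K ?y\<close>, and what remains is the projection itself.\<close>
    then have "K ?y - P (K ?y) \<in> model M" using y(1) fM VM by (simp add: subspace_diff)
    then have "K ?y - P (K ?y) = P (K ?y - P (K ?y))" using P(3) by simp
    also have "\<dots> = 0" using P(2,3) linear_diff[OF P(1)] by simp
    finally have "?y = f ?x" using y_eq by simp
    then have "\<psi> p = \<psi> (\<sigma> p <# H)" by (simp add: f_def \<sigma>_def)
    then show ?thesis using inj_onD[OF chart_inj[OF M W(1)]] y(3) x(2) by (metis \<sigma>_def)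
  qed
  have "smooth_from (\<psi> ` U0) X (\<lambda>y. par (?r (K y)))"
  proof (rule smooth_from_comp[OF X _ _ spar])
    have "\<psi> ` U0 \<subseteq> V" by (auto simp: U0_def)
    then show "smooth_on (\<psi> ` U0) (\<lambda>y. ?r (K y))"
      using smooth_on_compose[OF smooth_on_subset[OF K(3)] sr[of UNIV]] by blast
    show "?r (K y) \<in> \<phi> ` U" if "y \<in> \<psi> ` U0" for y
      using rA[of y] that by (auto simp: A_def U0_def)
  qed
  then have "smooth_from (\<psi> ` U0) X (\<lambda>y. \<sigma> (param_at M C y))"
  proof (rule smooth_from_cong[OF X])
    fix y assume "y \<in> \<psi> ` U0"
    then obtain p where p: "p \<in> W" "y = \<psi> p" by (auto simp: U0_def)
    show "par (?r (K y)) = \<sigma> (param_at M C y)"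
      using param_at_coord[OF M C, of p] p by (simp add: \<sigma>_def W_def \<psi>_def)
  qed
  then have "local_section C U0 \<sigma>"
    unfolding local_section_def
    using opU0 W(2) K(2) h0 sec chart_model[OF M W] by (auto simp: U0_def W_def \<psi>_def)
  then show thesis by (rule that)
qed

lemma smooth_from_section:
  assumes C: "C \<in> points M" and \<sigma>: "local_section C U \<sigma>" and f: "smooth_from S M f" "\<And>s. s \<in> S \<Longrightarrow> f s \<in> U"
  shows "smooth_from S X (\<lambda>s. \<sigma> (f s))"
proof -
  have UD: "U \<subseteq> dom_at M C" using \<sigma> by (simp add: local_section_def)
  have "S \<inter> f -` dom_at M C = S" using UD f(2) by auto
  then have "smooth_on S (\<lambda>s. coord_at M C (f s))"
    using smooth_from_chartD[OF M f(1) chart_at_atlas(1)[OF M C]] by simp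
  then have "smooth_from S X (\<lambda>s. \<sigma> (param_at M C (coord_at M C (f s))))"
    by (rule smooth_from_comp[OF X _ _ conjunct2[OF \<sigma>[unfolded local_section_def, THEN conjunct2,
            THEN conjunct2, THEN conjunct2]]]) (use f(2) in blast)
  then show ?thesis
    by (rule smooth_from_cong[OF X]) (simp add: param_at_coord[OF M C subsetD[OF UD f(2)]])
qed

lemma section_carrier:
  assumes C: "C \<in> points M" and \<sigma>: "local_section C U \<sigma>" and p: "p \<in> U"
  shows "\<sigma> p \<in> carrier G" "\<sigma> p <# H = p" "\<sigma> p \<in> p" "p \<in> points M"
proof -
  show pM: "p \<in> points M"
    using p \<sigma> chart_points[OF M chart_at_atlas(1)[OF M C]] unfolding local_section_def by blast
  show eq: "\<sigma> p <# H = p" using \<sigma> p by (simp add: local_section_def)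
  \<comment> \<open>The one-point parameter set turns the smoothness of the section into membership
    of a single value in the group.\<close>
  have "smooth_from {0::real} X (\<lambda>s. \<sigma> p)"
    by (rule smooth_from_section[OF C \<sigma> smooth_from_const[OF M pM]]) (rule p)
  then show c: "\<sigma> p \<in> carrier G" using smooth_from_carrier by blast
  show "\<sigma> p \<in> p" using lcos_self[OF c H] eq by simp
qed

text \<open>Locally \<open>g s <# f s\<close> equals
  \<open>(g s \<otimes> \<sigma> (f s)) <# H\<close>, a composite of multiplication in the group and
  the projection.\<close>

lemma smooth_from_coset_mult:
  assumes g: "smooth_from S X g" and f: "smooth_from S M f"
  shows "smooth_from S M (\<lambda>s. g s <# f s)"
proof (rule smooth_from_local[OF M])
  fix s assume s: "s \<in> S"
  note C = smooth_from_points[OF M f s]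
  obtain U \<sigma> where \<sigma>: "local_section (f s) U \<sigma>" by (rule ex_local_section[OF C])
  let ?N = "S \<inter> f -` U"
  have N: "openin (top_of_set S) ?N" "s \<in> ?N"
    using smooth_from_vimage[OF M f] \<sigma> s by (auto simp: local_section_def)
  have "smooth_from ?N X (\<lambda>s. \<sigma> (f s))"
    by (rule smooth_from_section[OF C \<sigma> smooth_from_subset[OF M f]]) auto
  then have "smooth_from ?N M (\<lambda>s. (g s \<otimes> \<sigma> (f s)) <# H)"
    by (intro smooth_from_proj smooth_from_mult smooth_from_subset[OF X g]) auto
  then have "smooth_from ?N M (\<lambda>s. g s <# f s)"
  proof (rule smooth_from_cong[OF M])
    fix t assume t: "t \<in> ?N"
    then have "f t \<in> U" by simp
    note sc = section_carrier[OF C \<sigma> this]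
    have "g t \<in> carrier G" using smooth_from_carrier[OF g] t by blast
    then show "(g t \<otimes> \<sigma> (f t)) <# H = g t <# f t" using coset_mult[OF _ sc(1)] sc(2) by simp
  qed
  then show "\<exists>N. openin (top_of_set S) N \<and> s \<in> N \<and> smooth_from N M (\<lambda>s. g s <# f s)" using N by blast
qed

lemma coset_action: "smooth_action G X M (l_coset G)"
proof unfold_locales
  show "smooth_atlas M" by (rule M)
  show "\<one> <# p = p" if "p \<in> points M" for p
    using coset_repr[OF that] lcos_mult_one l_coset_subset_G[OF subgroup.subset[OF H]] by metis
  show "(g \<otimes> h) <# p = g <# (h <# p)" if gh: "g \<in> carrier G" "h \<in> carrier G" and p: "p \<in> points M" for g h p
  proof -
    obtain a where a: "a \<in> carrier G" "p = a <# H" by (rule coset_repr[OF p])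
    then show ?thesis using gh by (simp add: coset_mult m_assoc)
  qed
  show "smooth_map (prod_manifold X M) M (\<lambda>(x, p). x <# p)"
  proof (rule smooth_mapI[OF smooth_atlas_prod[OF X M] M])
    fix U \<phi> assume "(U, \<phi>) \<in> atlas (prod_manifold X M)"
    then obtain U1 \<phi>1 U2 \<phi>2 where
      U: "U = U1 \<times> U2" "\<phi> = map_prod \<phi>1 \<phi>2" "(U1, \<phi>1) \<in> atlas X" "(U2, \<phi>2) \<in> atlas M"
      by (rule atlas_prod_manifoldE)
    have im: "\<phi> ` U = \<phi>1 ` U1 \<times> \<phi>2 ` U2" unfolding U by (auto simp: map_prod_def)
    have "smooth_from (\<phi> ` U) M (\<lambda>z. inv_into U1 \<phi>1 (fst z) <# inv_into U2 \<phi>2 (snd z))"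
      unfolding im
      by (intro smooth_from_coset_mult smooth_from_comp[OF X _ _ smooth_from_inv_into[OF X U(3)]]
          smooth_from_comp[OF M _ _ smooth_from_inv_into[OF M U(4)]] smooth_on_fst smooth_on_snd smooth_on_id) auto
    then show "smooth_from (\<phi> ` U) M (\<lambda>z. case inv_into U \<phi> z of (x, p) \<Rightarrow> x <# p)"
    proof (rule smooth_from_cong[OF M])
      fix z assume "z \<in> \<phi> ` U"
      then have "fst z \<in> \<phi>1 ` U1" "snd z \<in> \<phi>2 ` U2" unfolding im by auto
      then have "inv_into U \<phi> z = (inv_into U1 \<phi>1 (fst z), inv_into U2 \<phi>2 (snd z))"
        unfolding U using inv_into_map_prod[OF chart_inj[OF X U(3)] chart_inj[OF M U(4)], of "fst z" "snd z"]
        by simp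
      then show "inv_into U1 \<phi>1 (fst z) <# inv_into U2 \<phi>2 (snd z) = (case inv_into U \<phi> z of (x, p) \<Rightarrow> x <# p)"
        by simp
    qed
  qed
qed

end

sublocale homogeneous \<subseteq> smooth_action G X M "l_coset G"
  by (rule coset_action)

section \<open>The adjoint action and the kernel of the derivative of the projection\<close>

context homogeneous
begin

lemma fundamental_H: "fundamental_field H v = tangent_map X M (\<lambda>x. x <# H) \<one> v"
  by (simp add: fundamental_field_def)

lemma act_inv_repr: "C \<in> points M \<Longrightarrow> g \<in> C \<Longrightarrow> inv g <# C = H"
  using coset_elem[of C g] act_inv[OF _ H_points, of g] by simp

lemma conj_smooth: "g \<in> carrier G \<Longrightarrow> smooth_map X X (\<lambda>x. g \<otimes> x \<otimes> inv g)"
  by (intro smooth_mapI X smooth_from_mult smooth_from_const smooth_from_inv_into) (simp_all add: points_X)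

lemma Ad_model: "g \<in> carrier G \<Longrightarrow> v \<in> model X \<Longrightarrow> Ad G X g v \<in> model X"
  unfolding Ad_def by (rule tangent_map_model[OF X X conj_smooth _ ]) (simp_all add: points_X)

lemma Ad_mult:
  assumes g: "g \<in> carrier G" and h: "h \<in> carrier G" and v: "v \<in> model X"
  shows "Ad G X (g \<otimes> h) v = Ad G X g (Ad G X h v)"
proof -
  have "Ad G X g (Ad G X h v) = tangent_map X X (\<lambda>x. g \<otimes> (h \<otimes> x \<otimes> inv h) \<otimes> inv g) \<one> v"
    using tangent_map_compose[OF X X X conj_smooth[OF h] conj_smooth[OF g] one_points v] h
    by (simp add: Ad_def)
  also have "\<dots> = tangent_map X X (\<lambda>x. (g \<otimes> h) \<otimes> x \<otimes> inv (g \<otimes> h)) \<one> v"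
    by (rule tangent_map_cong[OF X X smooth_map_compose[OF X X X conj_smooth[OF h] conj_smooth[OF g]] _ one_points v])
      (use g h in \<open>simp add: points_X inv_mult_group m_assoc\<close>)
  finally show ?thesis by (simp add: Ad_def)
qed

text \<open>Differentiate \<open>(g \<otimes> x \<otimes> inv g) <# (g <# H) = g <# (x <# H)\<close>
  at the identity.\<close>

lemma fundamental_Ad:
  assumes g: "g \<in> carrier G" and v: "v \<in> model X"
  shows "fundamental_field (g <# H) (Ad G X g v) = tangent_map M M (l_coset G g) H (fundamental_field H v)"
proof -
  note gH = coset_points[OF g]
  have "fundamental_field (g <# H) (Ad G X g v) = tangent_map X M (\<lambda>x. (g \<otimes> x \<otimes> inv g) <# (g <# H)) \<one> v"
    using tangent_map_compose[OF X X M conj_smooth[OF g] act_point_smooth[OF gH] one_points v] g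
    by (simp add: Ad_def fundamental_field_def)
  also have "\<dots> = tangent_map X M (\<lambda>x. g <# (x <# H)) \<one> v"
    by (rule tangent_map_cong[OF X M smooth_map_compose[OF X X M conj_smooth[OF g] act_point_smooth[OF gH]] _ one_points v])
      (use g in \<open>simp add: points_X coset_mult m_assoc\<close>)
  also have "\<dots> = tangent_map M M (l_coset G g) H (fundamental_field H v)"
    using tangent_map_compose[OF X M M act_point_smooth[OF H_points] act_elem_smooth[OF g] one_points v]
      act_one[OF H_points] by (simp add: fundamental_field_def)
  finally show ?thesis .
qed

lemma tangent_act_inv':
  assumes g: "g \<in> carrier G" and p: "p \<in> points M" and w: "w \<in> model M"
  shows "tangent_map M M (l_coset G g) (inv g <# p) (tangent_map M M (l_coset G (inv g)) p w) = w"
  using tangent_act_inv[OF inv_closed[OF g] p w] g by simp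

lemma tangent_act_model:
  "g \<in> carrier G \<Longrightarrow> p \<in> points M \<Longrightarrow> w \<in> model M \<Longrightarrow> tangent_map M M (l_coset G g) p w \<in> model M"
  by (rule tangent_map_model[OF M M act_elem_smooth])

lemma right_field_one:
  assumes v: "v \<in> model X" shows "right_field \<one> v = v"
proof -
  have "right_field \<one> v = tangent_map X X (\<lambda>x. x) \<one> v"
    unfolding right_field_def
    by (rule tangent_map_cong[OF X X right_mult_smooth[OF one_closed] _ one_points v]) (simp add: points_X)
  then show ?thesis using tangent_map_id[OF X one_points v] by simp
qed

text \<open>The solution through the identity of the equation with constant right-hand side \<open>v\<close> is a
  one-parameter subgroup. If \<open>v\<close> is in the kernel, it fixes the base point, so it runs in \<open>H\<close>.\<close>

lemma kernel_lie_algebra: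
  assumes v: "v \<in> model X" and ker: "fundamental_field H v = 0"
  shows "v \<in> lie_algebra G X H"
proof -
  obtain g where g: "solution {0..1} (\<lambda>t. v) g" "g 0 = \<one>"
    by (rule ex_solution[OF smooth_on_const]) (rule v)
  have gc: "g t \<in> carrier G" if "t \<in> {0..1}" for t
    using smooth_from_carrier[OF _ that] g(1) unfolding solution_def by blast
  have gH: "g t \<in> H" if t: "t \<in> {0..1}" for t
  proof -
    have "inv (g t) <# H = inv (g 0) <# H"
    proof (rule solution_transport_const[OF g(1) v, of "\<lambda>t. H"])
      show "smooth_from {0..1} M (\<lambda>t. H)" by (rule smooth_from_const[OF M H_points])
      show "has_velocity M (\<lambda>t. H) (fundamental_field H v) t {0..1}" for t
        unfolding ker by (rule has_velocity_const[OF M H_points])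
    qed (use t at_within_unit_interval in auto)
    also have "\<dots> = H" using act_one[OF H_points] g(2) by simp
    finally have "inv (g t) \<in> H" using lcos_self[OF inv_closed[OF gc[OF t]] H] by simp
    then show ?thesis using subgroup.m_inv_closed[OF H] gc[OF t] by (metis inv_inv)
  qed
  let ?g = "restrict g {0..1}"
  have sg: "solution {0..1} (\<lambda>t. v) ?g" by (rule solution_cong[OF g(1)]) simp
  have "has_velocity X ?g (right_field (?g 0) v) 0 {0..1}" using sg unfolding solution_def by auto
  then have "velocity X ?g 0 = v"
    using velocity_eq[of X ?g _ 0] right_field_one[OF v] g(2) by simp
  moreover have "?g \<in> Cinf_at X \<one>" using sg g(2) by (simp add: solution_def Cinf_at_def Cinf_def)
  moreover have "?g ` {0..1} \<subseteq> H" using gH by auto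
  ultimately show ?thesis unfolding lie_algebra_def tangent_subspace_def by blast
qed

text \<open>A curve in \<open>H\<close> projects to the constant curve \<open>H\<close>, whose
  velocity is zero.\<close>

lemma lie_algebra_kernel:
  assumes v: "v \<in> lie_algebra G X H"
  shows "fundamental_field H v = 0"
proof -
  obtain c where c: "c \<in> Cinf_at X \<one>" "c ` {0..1} \<subseteq> H" "v = velocity X c 0"
    using v by (auto simp: lie_algebra_def tangent_subspace_def)
  have "has_velocity X c v 0 {0..1}" "c 0 = \<one>"
    using has_velocity_velocity[OF X, of c 0] c by (simp_all add: Cinf_at_def Cinf_def)
  then have "has_velocity M (\<lambda>s. c s <# H) (fundamental_field H v) 0 {0..1}"
    using has_velocity_map[OF X M proj_smooth, of c v 0] by (simp add: fundamental_field_def)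
  moreover have "has_velocity M (\<lambda>s. c s <# H) 0 0 {0..1}"
  proof (rule has_velocity_cong[OF M has_velocity_const[OF M H_points]])
    show "H = c s <# H" if "s \<in> {0..1}" for s
      using coset_join3[OF _ H, of "c s"] subgroup.subset[OF H] c(2) that by blast
  qed simp
  ultimately show ?thesis using has_velocity_unique[OF M _ _ at_within_unit_interval] by fastforce
qed

end

section \<open>The reductive complement and the pointwise properties of the form\<close>

locale reductive = homogeneous G X H M for G (structure) and X :: "('a, 'e::euclidean_space) manifold"
    and H :: "'a set" and M :: "('a set, 'f::euclidean_space) manifold" +
  fixes \<mm> :: "'e set"
  assumes reductive: "reductive_complement G X H \<mm>"
begin

lemma mm_subspace: "subspace \<mm>"
  and mm_decomp: "{x + y | x y. x \<in> lie_algebra G X H \<and> y \<in> \<mm>} = model X"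
  and mm_inter: "lie_algebra G X H \<inter> \<mm> = {0}"
  and mm_Ad: "h \<in> H \<Longrightarrow> v \<in> \<mm> \<Longrightarrow> Ad G X h v \<in> \<mm>"
  using reductive unfolding reductive_complement_def by blast+

lemma mm_model: "v \<in> \<mm> \<Longrightarrow> v \<in> model X"
proof -
  assume "v \<in> \<mm>"
  moreover have "0 \<in> lie_algebra G X H" using mm_inter by blast
  ultimately have "0 + v \<in> model X" unfolding mm_decomp[symmetric] by blast
  then show ?thesis by simp
qed

lemma lie_algebra_model: "x \<in> lie_algebra G X H \<Longrightarrow> x \<in> model X"
proof -
  assume "x \<in> lie_algebra G X H"
  then have "x + 0 \<in> model X" unfolding mm_decomp[symmetric] using subspace_0[OF mm_subspace] by blast
  then show ?thesis by simp
qed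

lemma fundamental_linear:
  obtains L where "linear L" "\<And>v. v \<in> model X \<Longrightarrow> fundamental_field H v = L v"
  using tangent_map_linear[OF X M act_point_smooth[OF H_points] one_points]
  by (metis fundamental_field_def)

lemma fundamental_inj: "inj_on (fundamental_field H) \<mm>"
proof (rule inj_onI)
  fix x y assume xy: "x \<in> \<mm>" "y \<in> \<mm>" "fundamental_field H x = fundamental_field H y"
  obtain L where L: "linear L" "\<And>v. v \<in> model X \<Longrightarrow> fundamental_field H v = L v"
    using fundamental_linear by blast
  have d: "x - y \<in> \<mm>" using xy subspace_diff[OF mm_subspace] by blast
  have "fundamental_field H (x - y) = 0"
    using L(2)[OF mm_model] d xy linear_diff[OF L(1)] by simp
  then have "x - y \<in> lie_algebra G X H" by (rule kernel_lie_algebra[OF mm_model[OF d]])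
  then have "x - y = 0" using d mm_inter by blast
  then show "x = y" by simp
qed

text \<open>The derivative of the projection is onto by submersivity and annihilates the subalgebra,
  so the complement alone already yields all values.\<close>

lemma fundamental_surj: "fundamental_field H ` \<mm> = model M"
proof -
  obtain L where L: "linear L" "\<And>v. v \<in> model X \<Longrightarrow> fundamental_field H v = L v"
    using fundamental_linear by blast
  have "fundamental_field H ` \<mm> = fundamental_field H ` model X"
  proof
    show "fundamental_field H ` \<mm> \<subseteq> fundamental_field H ` model X" using mm_model by blast
    show "fundamental_field H ` model X \<subseteq> fundamental_field H ` \<mm>"
    proof (rule image_subsetI)
      fix v assume v: "v \<in> model X"
      then obtain x y where xy: "v = x + y" "x \<in> lie_algebra G X H" "y \<in> \<mm>"
        unfolding mm_decomp[symmetric] by blast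
      have "fundamental_field H v = L x + L y"
        using L(2)[OF v] linear_add[OF L(1)] xy(1) by simp
      also have "\<dots> = fundamental_field H y"
        using L(2)[OF lie_algebra_model[OF xy(2)]] L(2)[OF mm_model[OF xy(3)]] lie_algebra_kernel[OF xy(2)] by simp
      finally show "fundamental_field H v \<in> fundamental_field H ` \<mm>" using xy(3) by blast
    qed
  qed
  also have "\<dots> = model M"
    using proj_surj[OF one_closed] by (simp add: fundamental_H[abs_def])
  finally show ?thesis .
qed

abbreviation base_form :: "'f \<Rightarrow> 'e" where
  "base_form \<equiv> omega_e G X H M \<mm>"

lemma base_form_eq: "base_form = inv_into \<mm> (fundamental_field H)"
  by (simp add: omega_e_def fundamental_H[abs_def])

lemma base_form_mm: "w \<in> model M \<Longrightarrow> base_form w \<in> \<mm>"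
  unfolding base_form_eq fundamental_surj[symmetric] by (rule inv_into_into)

lemma fundamental_base_form: "w \<in> model M \<Longrightarrow> fundamental_field H (base_form w) = w"
  unfolding base_form_eq fundamental_surj[symmetric] by (rule f_inv_into_f)

lemma base_form_fundamental: "x \<in> \<mm> \<Longrightarrow> base_form (fundamental_field H x) = x"
  unfolding base_form_eq by (rule inv_into_f_f[OF fundamental_inj])

text \<open>\<open>inv_into\<close> is under control on \<open>model M\<close> only. A linear map on
  the whole type that agrees with it there is smooth at once.\<close>

lemma base_form_linear:
  obtains B where "linear B" "\<And>w. w \<in> model M \<Longrightarrow> base_form w = B w"
proof -
  obtain L where L: "linear L" "\<And>v. v \<in> model X \<Longrightarrow> fundamental_field H v = L v"
    using fundamental_linear by blast
  have "inj_on L \<mm>" using fundamental_inj L(2) mm_model by (metis inj_on_cong)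
  then obtain B where B: "linear B" "\<forall>v\<in>\<mm>. B (L v) = v"
    using linear_exists_left_inverse_on[OF L(1) mm_subspace] by blast
  show thesis
  proof (rule that[OF B(1)])
    fix w assume w: "w \<in> model M"
    have "B (L (base_form w)) = base_form w" using B(2) base_form_mm[OF w] by blast
    then show "base_form w = B w"
      using L(2)[OF mm_model[OF base_form_mm[OF w]]] fundamental_base_form[OF w] by simp
  qed
qed

text \<open>Two representatives differ by some \<open>h \<in> H\<close>. Invariance of
  \<open>\<mm>\<close> under \<open>Ad G X h\<close> puts \<open>Ad G X h (base_form w')\<close> and
  \<open>base_form w\<close> both into \<open>\<mm>\<close>, equivariance gives them the same image
  \<open>w\<close> under the derivative of the projection, and that derivative is injective on
  \<open>\<mm>\<close>.\<close>

lemma omega_eq: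
  assumes C: "C \<in> points M" and v: "v \<in> model M" and g: "g \<in> C"
  shows "omega G X H M \<mm> (C, v) = Ad G X g (base_form (tangent_map M M (l_coset G (inv g)) C v))"
proof -
  let ?val = "\<lambda>g. Ad G X g (base_form (tangent_map M M (l_coset G (inv g)) C v))"
  have eq: "?val k = ?val g" if k: "k \<in> C" for k
  proof -
    note gC = coset_elem[OF C g] and kC = coset_elem[OF C k]
    define h where "h = inv g \<otimes> k"
    have "h \<in> inv g <# C" using k by (auto simp: h_def l_coset_def)
    then have h: "h \<in> H" using act_inv_repr[OF C g] by simp
    have hG: "h \<in> carrier G" using h subgroup.subset[OF H] by blast
    have k_eq: "k = g \<otimes> h" using gC(1) kC(1) by (simp add: h_def m_assoc[symmetric])
    define w where "w = tangent_map M M (l_coset G (inv g)) C v"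
    have w: "w \<in> model M" unfolding w_def by (rule tangent_act_model[OF inv_closed[OF gC(1)] C v])
    \<comment> \<open>\<open>w\<close> and \<open>w'\<close> are the given vector moved to the base
      point by the inverses of \<open>g\<close> and of \<open>k = g \<otimes> h\<close>.\<close>
    define w' where "w' = tangent_map M M (l_coset G (inv h)) H w"
    have w': "w' \<in> model M" unfolding w'_def by (rule tangent_act_model[OF inv_closed[OF hG] H_points w])
    have hH: "inv h <# H = H" "h <# H = H"
      using coset_join3[OF _ H] subgroup.m_inv_closed[OF H h] h hG by auto
    have "tangent_map M M (l_coset G (inv k)) C v = tangent_map M M (\<lambda>p. inv h <# (inv g <# p)) C v"
    proof (rule tangent_map_cong[OF M M act_elem_smooth[OF inv_closed[OF kC(1)]] _ C v])
      show "inv k <# p = inv h <# (inv g <# p)" if "p \<in> points M" for p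
        using act_mult[OF inv_closed[OF hG] inv_closed[OF gC(1)] that] gC(1) hG
        by (simp add: k_eq inv_mult_group)
    qed
    also have "\<dots> = w'"
      using tangent_map_compose[OF M M M act_elem_smooth[OF inv_closed[OF gC(1)]] act_elem_smooth[OF inv_closed[OF hG]] C v]
      by (simp add: w'_def w_def act_inv_repr[OF C g])
    finally have 1: "tangent_map M M (l_coset G (inv k)) C v = w'" .
    have "fundamental_field H (Ad G X h (base_form w')) = tangent_map M M (l_coset G h) H w'"
      using fundamental_Ad[OF hG mm_model[OF base_form_mm[OF w']]] hH(2) fundamental_base_form[OF w'] by simp
    also have "\<dots> = w" using tangent_act_inv'[OF hG H_points w] hH(1) by (simp add: w'_def)
    finally have "Ad G X h (base_form w') = base_form w"
      using base_form_fundamental[OF mm_Ad[OF h base_form_mm[OF w']]] by simp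
    then show ?thesis
      using Ad_mult[OF gC(1) hG mm_model[OF base_form_mm[OF w']]] 1 by (simp add: k_eq[symmetric] w_def)
  qed
  show ?thesis
    unfolding omega_def prod.case
  proof (rule the_equality)
    show "\<forall>k\<in>C. ?val g = ?val k" using eq by simp
    show "x = ?val g" if "\<forall>k\<in>C. x = ?val k" for x using that g by blast
  qed
qed

lemma omega_model:
  assumes C: "C \<in> points M" and v: "v \<in> model M"
  shows "omega G X H M \<mm> (C, v) \<in> model X"
proof -
  obtain g where g: "g \<in> C" using coset_nonempty[OF C] by blast
  note gC = coset_elem[OF C g]
  show ?thesis
    unfolding omega_eq[OF C v g]
    by (intro Ad_model mm_model base_form_mm tangent_act_model inv_closed gC(1) C v)
qed

text \<open>Equivariance turns \<open>Ad G X g\<close> into the translation by \<open>g\<close>,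
  which undoes the translation by \<open>inv g\<close>. Thus \<open>omega\<close> is a right inverse
  of the infinitesimal action.\<close>

lemma fundamental_omega:
  assumes C: "C \<in> points M" and v: "v \<in> model M"
  shows "fundamental_field C (omega G X H M \<mm> (C, v)) = v"
proof -
  obtain g where g: "g \<in> C" using coset_nonempty[OF C] by blast
  note gC = coset_elem[OF C g]
  define w where "w = tangent_map M M (l_coset G (inv g)) C v"
  have w: "w \<in> model M" unfolding w_def by (rule tangent_act_model[OF inv_closed[OF gC(1)] C v])
  have "fundamental_field C (omega G X H M \<mm> (C, v)) = fundamental_field (g <# H) (Ad G X g (base_form w))"
    using omega_eq[OF C v g] gC(2) by (simp add: w_def)
  also have "\<dots> = tangent_map M M (l_coset G g) H w"
    using fundamental_Ad[OF gC(1) mm_model[OF base_form_mm[OF w]]] fundamental_base_form[OF w] by simp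
  also have "\<dots> = v"
    using tangent_act_inv'[OF gC(1) C v] act_inv_repr[OF C g] by (simp add: w_def)
  finally show ?thesis .
qed

lemma omega_nonzero:
  assumes "C \<in> points M" "v \<in> model M" "v \<noteq> 0"
  shows "omega G X H M \<mm> (C, v) \<noteq> 0"
  using fundamental_omega[OF assms(1,2)] assms(3) by (auto simp: fundamental_field_def tangent_map_zero)

end

section \<open>Smoothness of the form\<close>

context reductive
begin

text \<open>With the representative \<open>\<sigma> p\<close> of \<open>p\<close>, the form is the
  translation by \<open>inv (\<sigma> p)\<close>, followed by \<open>base_form\<close> and then by
  \<open>Ad\<close> of \<open>\<sigma> p\<close>. The middle map is linear, and the outer two are
  partial derivatives of smooth maps of two variables.\<close>

lemma omega_local_representation:
  assumes C: "C \<in> points M"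
  obtains U w where "openin (mtop M) U" "C \<in> U" "U \<subseteq> dom_at M C"
    "smooth_on (coord_at M C ` U \<times> UNIV) w"
    "\<And>p v. p \<in> U \<Longrightarrow> v \<in> model M \<Longrightarrow>
      omega G X H M \<mm> (p, v) = w (coord_at M C p, deriv_along M (coord_at M C) p v)"
proof -
  note VX = subspace_model[OF X] and VM = subspace_model[OF M]
  obtain U \<sigma> where \<sigma>: "local_section C U \<sigma>" by (rule ex_local_section[OF C])
  note sc = section_carrier[OF C \<sigma>]
  define W \<psi> where "W = dom_at M C" and "\<psi> = coord_at M C"
  have W: "(W, \<psi>) \<in> atlas M" "C \<in> W" using chart_at_atlas[OF M C] by (simp_all add: W_def \<psi>_def)
  have U: "openin (mtop M) U" "C \<in> U" "U \<subseteq> W" using \<sigma> by (simp_all add: local_section_def W_def)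
  define par where "par = inv_into W \<psi>"
  have par: "par (\<psi> p) = p" if "p \<in> W" for p using chart_inv[OF M W(1) that] by (simp add: par_def)
  define Y where "Y = \<psi> ` U"
  have "U \<inter> W = U" using U(3) by blast
  then have Y: "openin (top_of_set (model M)) Y"
    using openin_chart_image[OF M U(1) W(1)] by (simp add: Y_def)
  have spar: "smooth_from Y M par"
    unfolding par_def Y_def
    by (rule smooth_from_subset[OF M smooth_from_inv_into[OF M W(1)]]) (use U(3) in blast)
  define s where "s y = \<sigma> (par y)" for y
  have ss: "smooth_from Y X s"
    using \<sigma> by (simp add: local_section_def s_def[abs_def] Y_def \<psi>_def par_def W_def param_at_def)
  have s_\<psi>: "s (\<psi> p) = \<sigma> p" if "p \<in> U" for p using par U(3) that by (auto simp: s_def)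

  \<comment> \<open>In the second variable this is translation by the inverse of the section over
    the first. Its derivative on the diagonal is the tangent map in \<open>omega\<close>; there
    \<open>k\<close> takes the value \<open>H\<close>, so the chart at \<open>H\<close> yields the
    stored coordinates.\<close>
  define k where "k z = inv (s (fst z)) <# par (snd z)" for z
  have sk: "smooth_from (Y \<times> Y) M k"
    unfolding k_def
    by (intro smooth_from_act smooth_from_inv smooth_from_comp[OF X _ _ ss] smooth_from_comp[OF M _ _ spar]
        smooth_on_fst smooth_on_snd smooth_on_id) auto
  note HW = chart_at_atlas[OF M H_points]
  define B where "B = (Y \<times> Y) \<inter> k -` dom_at M H"
  have "openin (top_of_set (Y \<times> Y)) B"
    unfolding B_def by (rule smooth_from_vimage[OF M sk openin_chart_domain[OF M HW(1)]])
  then have B: "openin (top_of_set (model M \<times> model M)) B"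
    using openin_Times[OF Y Y] openin_trans by blast
  have sB: "smooth_on B (\<lambda>z. coord_at M H (k z))"
    unfolding B_def by (rule smooth_from_chartD[OF M sk HW(1)])
  obtain D where D: "smooth_on (B \<times> UNIV) (\<lambda>z. D (fst z) (snd z))"
    "\<And>y x. (y, x) \<in> B \<Longrightarrow> ((\<lambda>x. coord_at M H (k (y, x))) has_derivative D (y, x)) (at x within model M)"
    using smooth_on_partial_derivative[OF VM VM B sB] by blast
  have k\<psi>: "k (\<psi> p, \<psi> p) = H" if p: "p \<in> U" for p
    using act_inv_repr[OF sc(4,3)[OF p]] s_\<psi>[OF p] par[of p] p U(3) by (auto simp: k_def)
  have inB: "(\<psi> p, \<psi> p) \<in> B" if "p \<in> U" for p
    using k\<psi>[OF that] HW(2) that by (simp add: B_def Y_def)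
  have D_eq: "tangent_map M M (l_coset G (inv (\<sigma> p))) p v = D (\<psi> p, \<psi> p) (deriv_along M \<psi> p v)"
    if p: "p \<in> U" and v: "v \<in> model M" for p v
  proof -
    have pW: "p \<in> W" using p U(3) by blast
    let ?u = "deriv_along M \<psi> p v"
    \<comment> \<open>A line in the chart at \<open>C\<close> rather than in the preferred chart at
      \<open>p\<close>, since the derivative has to be smooth as \<open>p\<close> varies.\<close>
    let ?c = "\<lambda>r. par (\<psi> p + r *\<^sub>R ?u)"
    have c: "has_velocity M ?c v 0 UNIV" unfolding par_def by (rule chart_line_velocity[OF M W(1) pW v])
    have "has_velocity M (\<lambda>r. inv (\<sigma> p) <# ?c r) (tangent_map M M (l_coset G (inv (\<sigma> p))) p v) 0 UNIV"
      using has_velocity_map[OF M M act_elem_smooth[OF inv_closed[OF sc(1)[OF p]]] c] par[OF pW] by simp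
    from has_velocityD(4)[OF this]
    have "((\<lambda>r. coord_at M H (k (\<psi> p, \<psi> p + r *\<^sub>R ?u))) has_vector_derivative
        tangent_map M M (l_coset G (inv (\<sigma> p))) p v) (at 0)"
      using par[OF pW] act_inv_repr[OF sc(4,3)[OF p]] s_\<psi>[OF p] by (simp add: k_def)
    moreover have "((\<lambda>r. coord_at M H (k (\<psi> p, \<psi> p + r *\<^sub>R ?u))) has_vector_derivative D (\<psi> p, \<psi> p) ?u) (at 0)"
      by (rule has_derivative_along_line[OF VM D(2)[OF inB[OF p]] chart_model[OF M W(1) pW]
            deriv_along_chart_model[OF M W(1) pW v]])
    ultimately show ?thesis by (rule vector_derivative_unique_at)
  qed

  note E = chart_at_atlas[OF X one_points]
  define V \<phi> where "V = dom_at X \<one>" and "\<phi> = coord_at X \<one>"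
  have V: "(V, \<phi>) \<in> atlas X" "\<one> \<in> V" using E by (simp_all add: V_def \<phi>_def)
  define pare where "pare = inv_into V \<phi>"
  have pare: "pare (\<phi> h) = h" if "h \<in> V" for h using chart_inv[OF X V(1) that] by (simp add: pare_def)
  have spare: "smooth_from (\<phi> ` V) X pare" unfolding pare_def by (rule smooth_from_inv_into[OF X V(1)])
  \<comment> \<open>Conjugation by the section, with the conjugated element in the second variable;
    its derivative at the identity is \<open>Ad\<close>.\<close>
  define m where "m z = s (fst z) \<otimes> pare (snd z) \<otimes> inv (s (fst z))" for z
  have sm: "smooth_from (Y \<times> \<phi> ` V) X m"
    unfolding m_def
    by (intro smooth_from_mult smooth_from_inv smooth_from_comp[OF X _ _ ss] smooth_from_comp[OF X _ _ spare]
        smooth_on_fst smooth_on_snd smooth_on_id) auto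
  define A where "A = (Y \<times> \<phi> ` V) \<inter> m -` V"
  have "openin (top_of_set (Y \<times> \<phi> ` V)) A"
    unfolding A_def by (rule smooth_from_vimage[OF X sm openin_chart_domain[OF X V(1)]])
  then have A: "openin (top_of_set (model M \<times> model X)) A"
    using openin_Times[OF Y chart_image[OF X V(1)]] openin_trans by blast
  have sA: "smooth_on A (\<lambda>z. \<phi> (m z))"
    unfolding A_def by (rule smooth_from_chartD[OF X sm V(1)])
  obtain D' where D': "smooth_on (A \<times> UNIV) (\<lambda>z. D' (fst z) (snd z))"
    "\<And>y x. (y, x) \<in> A \<Longrightarrow> ((\<lambda>x. \<phi> (m (y, x))) has_derivative D' (y, x)) (at x within model X)"
    using smooth_on_partial_derivative[OF VM VX A sA] by blast
  have sG: "s y \<in> carrier G" if "y \<in> Y" for y using smooth_from_carrier[OF ss that] .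
  have inA: "(y, \<phi> \<one>) \<in> A" if "y \<in> Y" for y
    using sG[OF that] that V(2) pare by (auto simp: A_def m_def)
  have D'_eq: "Ad G X (s y) v = D' (y, \<phi> \<one>) v" if y: "y \<in> Y" and v: "v \<in> model X" for y v
  proof -
    let ?c = "\<lambda>r. pare (\<phi> \<one> + r *\<^sub>R v)"
    have c: "has_velocity X ?c v 0 UNIV" "?c 0 = \<one>"
      using has_velocity_param_line[OF X one_points v]
      by (simp_all add: pare_def V_def \<phi>_def param_at_def)
    have "has_velocity X (\<lambda>r. s y \<otimes> ?c r \<otimes> inv (s y)) (Ad G X (s y) v) 0 UNIV"
      using has_velocity_map[OF X X conj_smooth[OF sG[OF y]] c(1)] c(2) by (simp add: Ad_def)
    from has_velocityD(4)[OF this]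
    have "((\<lambda>r. \<phi> (m (y, \<phi> \<one> + r *\<^sub>R v))) has_vector_derivative Ad G X (s y) v) (at 0)"
      using c(2) sG[OF y] by (simp add: m_def \<phi>_def)
    moreover have "((\<lambda>r. \<phi> (m (y, \<phi> \<one> + r *\<^sub>R v))) has_vector_derivative D' (y, \<phi> \<one>) v) (at 0)"
      by (rule has_derivative_along_line[OF VX D'(2)[OF inA[OF y]] chart_model[OF X V] v])
    ultimately show ?thesis by (rule vector_derivative_unique_at)
  qed

  obtain L where L: "linear L" "\<And>w. w \<in> model M \<Longrightarrow> base_form w = L w"
    using base_form_linear by blast
  define w where "w z = D' (fst z, \<phi> \<one>) (L (D (fst z, fst z) (snd z)))" for z
  have YB: "(y, y) \<in> B" if "y \<in> Y" for y using inB that by (auto simp: Y_def)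
  have f1: "smooth_on (Y \<times> (UNIV::'f set)) fst" and f2: "smooth_on (Y \<times> (UNIV::'f set)) snd"
    by (rule smooth_on_linear[OF linear_fst], rule smooth_on_linear[OF linear_snd])
  have i1: "smooth_on (Y \<times> (UNIV::'f set)) (\<lambda>z. ((fst z, fst z), snd z))"
    by (intro smooth_on_Pair f1 f2)
  have "(\<lambda>z. ((fst z, fst z), snd z)) ` (Y \<times> (UNIV::'f set)) \<subseteq> B \<times> UNIV"
    using YB by auto
  from smooth_on_compose[OF i1 D(1) this]
  have "smooth_on (Y \<times> (UNIV::'f set)) (\<lambda>z. D (fst z, fst z) (snd z))" by simp
  then have i2: "smooth_on (Y \<times> (UNIV::'f set)) (\<lambda>z. ((fst z, \<phi> \<one>), L (D (fst z, fst z) (snd z))))"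
    by (intro smooth_on_Pair f1 smooth_on_const smooth_on_linear_comp[OF L(1)])
  have "(\<lambda>z. ((fst z, \<phi> \<one>), L (D (fst z, fst z) (snd z)))) ` (Y \<times> (UNIV::'f set)) \<subseteq> A \<times> UNIV"
    using inA by auto
  from smooth_on_compose[OF i2 D'(1) this]
  have sw: "smooth_on (Y \<times> UNIV) w" unfolding w_def by simp
  show thesis
  proof (rule that[OF U(1,2)])
    show "U \<subseteq> dom_at M C" using U(3) by (simp add: W_def)
    show "smooth_on (coord_at M C ` U \<times> UNIV) w" using sw by (simp add: Y_def \<psi>_def)
    fix p v assume p: "p \<in> U" and v: "v \<in> model M"
    note sp = sc(1)[OF p] and pM = sc(4)[OF p]
    have T: "tangent_map M M (l_coset G (inv (\<sigma> p))) p v \<in> model M" (is "?T \<in> _")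
      by (rule tangent_act_model[OF inv_closed[OF sp] pM v])
    have "omega G X H M \<mm> (p, v) = Ad G X (\<sigma> p) (base_form ?T)"
      by (rule omega_eq[OF pM v sc(3)[OF p]])
    also have "\<dots> = D' (\<psi> p, \<phi> \<one>) (base_form ?T)"
      using D'_eq[of "\<psi> p", OF _ mm_model[OF base_form_mm[OF T]]] s_\<psi>[OF p] p by (simp add: Y_def)
    also have "\<dots> = w (\<psi> p, deriv_along M \<psi> p v)"
      using L(2)[OF T] D_eq[OF p v] by (simp add: w_def)
    finally show "omega G X H M \<mm> (p, v) = w (coord_at M C p, deriv_along M (coord_at M C) p v)"
      by (simp add: \<psi>_def)
  qed
qed

text \<open>The condition on \<open>deriv_along\<close> asks for smooth fibre coordinates in every
  chart. In this form the rule serves families in the tangent bundle as well as velocities of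
  curves.\<close>

lemma smooth_on_omega:
  assumes f: "smooth_from S M f" and v: "\<And>s. s \<in> S \<Longrightarrow> v s \<in> model M"
    and d: "\<And>U \<psi>. (U, \<psi>) \<in> atlas M \<Longrightarrow> smooth_on (S \<inter> f -` U) (\<lambda>s. deriv_along M \<psi> (f s) (v s))"
  shows "smooth_on S (\<lambda>s. omega G X H M \<mm> (f s, v s))"
proof (rule smooth_on_local)
  fix s0 assume s0: "s0 \<in> S"
  note C = smooth_from_points[OF M f s0]
  let ?\<psi> = "coord_at M (f s0)"
  obtain U w where U: "openin (mtop M) U" "f s0 \<in> U" "U \<subseteq> dom_at M (f s0)"
    "smooth_on (?\<psi> ` U \<times> UNIV) w"
    "\<And>p v. p \<in> U \<Longrightarrow> v \<in> model M \<Longrightarrow> omega G X H M \<mm> (p, v) = w (?\<psi> p, deriv_along M ?\<psi> p v)"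
    using omega_local_representation[OF C] by blast
  note k = chart_at_atlas(1)[OF M C]
  let ?N = "S \<inter> f -` U"
  have N: "openin (top_of_set S) ?N" "s0 \<in> ?N" using smooth_from_vimage[OF M f U(1)] s0 U(2) by auto
  have sub: "?N \<subseteq> S \<inter> f -` dom_at M (f s0)" using U(3) by blast
  have pair: "smooth_on ?N (\<lambda>s. (?\<psi> (f s), deriv_along M ?\<psi> (f s) (v s)))"
    by (intro smooth_on_Pair smooth_on_subset[OF smooth_from_chartD[OF M f k] sub] smooth_on_subset[OF d[OF k] sub])
  have "smooth_on ?N (\<lambda>s. w (?\<psi> (f s), deriv_along M ?\<psi> (f s) (v s)))"
    by (rule smooth_on_compose[OF pair U(4)]) auto
  then have "smooth_on ?N (\<lambda>s. omega G X H M \<mm> (f s, v s))"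
    by (rule smooth_on_cong[THEN iffD1, rotated]) (use U(5) v in simp)
  then show "\<exists>N. openin (top_of_set S) N \<and> s0 \<in> N \<and> smooth_on N (\<lambda>s. omega G X H M \<mm> (f s, v s))"
    using N by blast
qed

end

section \<open>Curves in the tangent bundle\<close>

text \<open>Bundle charts are injective and map each fibre onto \<open>model X\<close>. Hence
  \<open>W \<times> model X\<close> is open whenever \<open>W\<close> is, which makes the foot point
  continuous; the two components of a bundle chart give the rest.\<close>

lemma smooth_from_tangent_bundle:
  assumes X: "smooth_atlas X" and F: "smooth_from S (tangent_bundle X) F"
  shows "smooth_from S X (\<lambda>s. fst (F s))" "\<And>s. s \<in> S \<Longrightarrow> snd (F s) \<in> model X"
    "\<And>U \<psi>. (U, \<psi>) \<in> atlas X \<Longrightarrow>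
      smooth_on (S \<inter> (\<lambda>s. fst (F s)) -` U) (\<lambda>s. deriv_along X \<psi> (fst (F s)) (snd (F s)))"
proof -
  define \<Psi> :: "('a \<Rightarrow> 'b) \<Rightarrow> 'a \<times> 'b \<Rightarrow> 'b \<times> 'b" where "\<Psi> \<psi> = (\<lambda>(p, v). (\<psi> p, deriv_along X \<psi> p v))" for \<psi>
  have atlas: "atlas (tangent_bundle X) = {(U \<times> model X, \<Psi> \<psi>) | U \<psi>. (U, \<psi>) \<in> atlas X}"
    by (simp add: tangent_bundle_def \<Psi>_def)
  have inj: "inj_on \<Psi>' U'" if a: "(U', \<Psi>') \<in> atlas (tangent_bundle X)" for U' \<Psi>'
  proof -
    obtain U \<psi> where U: "(U, \<psi>) \<in> atlas X" "U' = U \<times> model X" "\<Psi>' = \<Psi> \<psi>"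
      using a by (auto simp: atlas)
    show ?thesis
    proof (rule inj_onI)
      fix x y assume "x \<in> U'" "y \<in> U'" "\<Psi>' x = \<Psi>' y"
      then obtain p v p' v' where xy: "x = (p, v)" "y = (p', v')" "p \<in> U" "p' \<in> U" "v \<in> model X" "v' \<in> model X"
        "\<psi> p = \<psi> p'" "deriv_along X \<psi> p v = deriv_along X \<psi> p' v'"
        unfolding U(2,3) \<Psi>_def by auto
      have "p = p'" by (rule inj_onD[OF chart_inj[OF X U(1)] xy(7,3,4)])
      then show "x = y" using deriv_along_chart_inj[OF X U(1) xy(3,5,6)] xy(1,2,8) by simp
    qed
  qed
  have opn: "openin (mtop (tangent_bundle X)) W \<longleftrightarrow> W \<subseteq> points (tangent_bundle X) \<and>
      (\<forall>(U, \<phi>) \<in> atlas (tangent_bundle X). openin (top_of_set (model (tangent_bundle X))) (\<phi> ` (W \<inter> U)))" for W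
    by (rule openin_mtop_inj[OF inj])
  have pts: "points (tangent_bundle X) = points X \<times> model X"
  proof -
    have "atlas (tangent_bundle X) = (\<lambda>\<kappa>. (fst \<kappa> \<times> model X, \<Psi> (snd \<kappa>))) ` atlas X"
      unfolding atlas by (auto intro: rev_image_eqI) blast
    then have "points (tangent_bundle X) = (\<Union>\<kappa>\<in>atlas X. fst \<kappa> \<times> model X)"
      by (simp add: points_def image_image)
    also have "\<dots> = points X \<times> model X"
      unfolding points_def by (simp only: Union_eq) blast
    finally show ?thesis .
  qed
  have op: "openin (mtop (tangent_bundle X)) (W \<times> model X)" if W: "openin (mtop X) W" for W
    unfolding opn
  proof (intro conjI ballI; clarify?)
    show "(p, v) \<in> points (tangent_bundle X)" if "p \<in> W" "v \<in> model X" for p v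
      using that W openin_mtop_iff[OF X] by (auto simp: pts)
  next
    fix U' \<Psi>' assume "(U', \<Psi>') \<in> atlas (tangent_bundle X)"
    then obtain U \<psi> where U: "(U, \<psi>) \<in> atlas X" "U' = U \<times> model X" "\<Psi>' = \<Psi> \<psi>"
      by (auto simp: atlas)
    have "\<Psi>' ` (W \<times> model X \<inter> U') = \<psi> ` (W \<inter> U) \<times> model X"
    proof
      show "\<Psi>' ` (W \<times> model X \<inter> U') \<subseteq> \<psi> ` (W \<inter> U) \<times> model X"
        using deriv_along_chart_model[OF X U(1)] by (auto simp: U(2,3) \<Psi>_def)
      show "\<psi> ` (W \<inter> U) \<times> model X \<subseteq> \<Psi>' ` (W \<times> model X \<inter> U')"
      proof clarify
        fix p u assume p: "p \<in> W" "p \<in> U" and u: "u \<in> model X"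
        obtain v where "v \<in> model X" "deriv_along X \<psi> p v = u"
          by (rule deriv_along_chart_surj[OF X U(1) p(2) u])
        then show "(\<psi> p, u) \<in> \<Psi>' ` (W \<times> model X \<inter> U')"
          using p by (intro image_eqI[of _ _ "(p, v)"]) (auto simp: U(2,3) \<Psi>_def)
      qed
    qed
    then show "openin (top_of_set (model (tangent_bundle X))) (\<Psi>' ` (W \<times> model X \<inter> U'))"
      using openin_Times[OF openin_chart_image[OF X W U(1)] openin_subtopology_self]
      by (simp add: tangent_bundle_def)
  qed
  have "F s \<in> points (tangent_bundle X)" if "s \<in> S" for s
  proof -
    have "F s \<in> topspace (mtop (tangent_bundle X))"
      using F that by (auto simp: smooth_from_def continuous_map_def)
    then show ?thesis using opn openin_topspace by blast
  qed
  then have Fp: "fst (F s) \<in> points X" "snd (F s) \<in> model X" if "s \<in> S" for s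
    using that by (force simp: pts)+
  then show "\<And>s. s \<in> S \<Longrightarrow> snd (F s) \<in> model X" by blast
  have vim: "S \<inter> F -` (W \<times> model X) = S \<inter> (\<lambda>s. fst (F s)) -` W" for W
    using Fp(2) by (auto simp: mem_Times_iff)
  have sm: "smooth_on (S \<inter> (\<lambda>s. fst (F s)) -` U) (\<lambda>s. \<Psi> \<psi> (F s))" if "(U, \<psi>) \<in> atlas X" for U \<psi>
  proof -
    have "(U \<times> model X, \<Psi> \<psi>) \<in> atlas (tangent_bundle X)" using that by (auto simp: atlas)
    then have "smooth_on (S \<inter> F -` (U \<times> model X)) (\<Psi> \<psi> \<circ> F)"
      using F unfolding smooth_from_def by blast
    then show ?thesis by (simp add: vim comp_def)
  qed
  show "smooth_from S X (\<lambda>s. fst (F s))"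
  proof (rule smooth_fromI[OF X Fp(1)])
    show "openin (top_of_set S) (S \<inter> (\<lambda>s. fst (F s)) -` W)" if "openin (mtop X) W" for W
    proof -
      have "openin (top_of_set S) {s \<in> topspace (top_of_set S). F s \<in> W \<times> model X}"
        by (rule openin_continuous_map_preimage[OF _ op[OF that]]) (use F in \<open>simp add: smooth_from_def\<close>)
      moreover have "{s \<in> topspace (top_of_set S). F s \<in> W \<times> model X} = S \<inter> F -` (W \<times> model X)" by auto
      ultimately show ?thesis by (simp add: vim)
    qed
    show "smooth_on (S \<inter> (\<lambda>s. fst (F s)) -` U) (\<lambda>s. \<psi> (fst (F s)))" if "(U, \<psi>) \<in> atlas X" for U \<psi>
      using smooth_on_fst[OF sm[OF that]] by (simp add: \<Psi>_def case_prod_unfold)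
  qed
  show "smooth_on (S \<inter> (\<lambda>s. fst (F s)) -` U) (\<lambda>s. deriv_along X \<psi> (fst (F s)) (snd (F s)))"
    if "(U, \<psi>) \<in> atlas X" for U \<psi>
    using smooth_on_snd[OF sm[OF that]] by (simp add: \<Psi>_def case_prod_unfold)
qed

text \<open>A smooth extension of \<open>f\<close> has a smooth derivative, which agrees with
  \<open>d\<close> on \<open>S\<close> because derivatives within \<open>S\<close> are unique
  there.\<close>

lemma smooth_on_vector_derivative:
  fixes f :: "real \<Rightarrow> 'b::euclidean_space"
  assumes f: "smooth_on S f"
    and d: "\<And>t. t \<in> S \<Longrightarrow> (f has_vector_derivative d t) (at t within S)"
    and S: "\<And>t. t \<in> S \<Longrightarrow> at t within S \<noteq> bot"
  shows "smooth_on S d"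
proof (rule smooth_onI)
  fix t0 assume t0: "t0 \<in> S"
  obtain U F where U: "open U" "t0 \<in> U" "\<forall>k. Ck_on k U F" "\<forall>y\<in>S \<inter> U. F y = f y"
    by (rule smooth_onE[OF f t0])
  let ?D = "\<lambda>t. frechet_derivative F (at t) 1"
  have "?D t = d t" if t: "t \<in> S \<inter> U" for t
  proof -
    have "(F has_vector_derivative ?D t) (at t)"
      by (rule Ck_on_has_vector_derivative[OF U(3)[rule_format, of "Suc 0"]]) (use t in blast)
    then have "(F has_vector_derivative ?D t) (at t within S \<inter> U)" by (rule has_vector_derivative_at_within)
    then have "(f has_vector_derivative ?D t) (at t within S \<inter> U)"
      by (rule has_vector_derivative_transform[rotated 2]) (use U t in auto)
    moreover have eq: "at t within S \<inter> U = at t within S"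
      by (rule at_within_openin[OF openin_open_Int[OF U(1)] t])
    ultimately show ?thesis
      using vector_derivative_unique_within[OF S] d t by (metis IntD1)
  qed
  moreover have "\<forall>k. Ck_on k U ?D"
  proof
    show "Ck_on k U ?D" for k using U(3)[rule_format, of "Suc k"] by simp
  qed
  ultimately show "\<exists>U F. open U \<and> t0 \<in> U \<and> (\<forall>k. Ck_on k U F) \<and> (\<forall>y\<in>S \<inter> U. F y = d y)"
    using U(1,2) by blast
qed

lemma smooth_on_chart_velocity:
  assumes X: "smooth_atlas X" and c: "smooth_from {0..1} X c" and U: "(U, \<psi>) \<in> atlas X"
  shows "smooth_on ({0..1} \<inter> c -` U) (\<lambda>t. deriv_along X \<psi> (c t) (velocity X c t))"
proof (rule smooth_on_vector_derivative[OF smooth_from_chartD[OF X c U]])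
  have op: "openin (top_of_set {0..1}) ({0..1} \<inter> c -` U)"
    by (rule smooth_from_vimage[OF X c openin_chart_domain[OF X U]])
  fix t assume t: "t \<in> {0..1} \<inter> c -` U"
  note eq = at_within_openin[OF op t]
  show "at t within {0..1} \<inter> c -` U \<noteq> bot" unfolding eq by (rule at_within_unit_interval) (use t in blast)
  show "((\<lambda>t. \<psi> (c t)) has_vector_derivative deriv_along X \<psi> (c t) (velocity X c t)) (at t within {0..1} \<inter> c -` U)"
    unfolding eq by (rule has_velocity_chart[OF X U _ has_velocity_velocity[OF X c]]) (use t in auto)
qed

section \<open>The operator theta and the square root velocity transform\<close>

context reductive
begin

abbreviation \<theta> :: "(real \<Rightarrow> 'a set \<times> 'f) \<Rightarrow> real \<Rightarrow> 'e" where
  "\<theta> \<equiv> theta G X H M \<mm>"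

lemma smooth_from_omega_bundle:
  assumes F: "smooth_from S (tangent_bundle M) F"
  shows "smooth_from S (vector_manifold (model X)) (\<lambda>s. omega G X H M \<mm> (F s))"
proof -
  note tb = smooth_from_tangent_bundle[OF M F]
  have "smooth_on S (\<lambda>s. omega G X H M \<mm> (fst (F s), snd (F s)))" by (rule smooth_on_omega[OF tb])
  moreover have "omega G X H M \<mm> (fst (F s), snd (F s)) \<in> model X" if "s \<in> S" for s
    by (rule omega_model[OF smooth_from_points[OF M tb(1) that] tb(2)[OF that]])
  ultimately show ?thesis
    by (intro smooth_from_vector subspace_model[OF X]) simp_all
qed

text \<open>\<open>omega\<close> composed with a smooth family is smooth for every parameter set.
  The set \<open>{0..1}\<close> gives well-definedness on curves, the set
  \<open>UNIV \<times> {0..1}\<close> gives preservation of smooth curves of curves.\<close>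

lemma theta_smooth: "smooth_curve_operator (tangent_bundle M) (vector_manifold (model X)) \<theta>"
  unfolding smooth_curve_operator_def
proof (intro conjI allI impI)
  note VA = smooth_atlas_vector[OF subspace_model[OF X]]
  show "\<theta> \<in> Cinf (tangent_bundle M) \<rightarrow> Cinf (vector_manifold (model X))"
  proof
    fix f assume "f \<in> Cinf (tangent_bundle M)"
    then have "smooth_from {0..1} (tangent_bundle M) f" by (simp add: Cinf_def)
    from smooth_from_cong[OF VA smooth_from_omega_bundle[OF this], of "\<theta> f"]
    show "\<theta> f \<in> Cinf (vector_manifold (model X))" by (simp add: Cinf_def theta_def)
  qed
  fix F :: "real \<times> real \<Rightarrow> 'a set \<times> 'f"
  assume "smooth_from (UNIV \<times> {0..1}) (tangent_bundle M) F"
  from smooth_from_omega_bundle[OF this]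
  show "smooth_from (UNIV \<times> {0..1}) (vector_manifold (model X)) (\<lambda>(s, t). \<theta> (\<lambda>\<tau>\<in>{0..1}. F (s, \<tau>)) t)"
    by (rule smooth_from_cong[OF VA]) (auto simp: theta_def)
qed

lemma theta_curve_deriv:
  assumes c: "smooth_from {0..1} M c"
  shows "smooth_on {0..1} (\<theta> (curve_deriv M c))"
    "\<And>t. t \<in> {0..1} \<Longrightarrow> \<theta> (curve_deriv M c) t = omega G X H M \<mm> (c t, velocity M c t)"
    "\<And>t. t \<in> {0..1} \<Longrightarrow> \<theta> (curve_deriv M c) t \<in> model X"
proof -
  note vel = has_velocity_velocity[OF M c]
  show eq: "\<theta> (curve_deriv M c) t = omega G X H M \<mm> (c t, velocity M c t)" if "t \<in> {0..1}" for t
    using that by (simp add: theta_def curve_deriv_def)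
  then show "\<theta> (curve_deriv M c) t \<in> model X" if "t \<in> {0..1}" for t
    using omega_model[OF smooth_from_points[OF M c that] has_velocityD(1)[OF vel[OF that]]] that by simp
  have "smooth_on {0..1} (\<lambda>t. omega G X H M \<mm> (c t, velocity M c t))"
    by (rule smooth_on_omega[OF c has_velocityD(1)[OF vel] smooth_on_chart_velocity[OF M c]])
  then show "smooth_on {0..1} (\<theta> (curve_deriv M c))"
    by (rule smooth_on_cong[THEN iffD1, rotated]) (simp add: eq)
qed

lemma rho_theta:
  assumes c: "c \<in> Cinf_at M c0"
  shows "rho G X c0 (\<theta> (curve_deriv M c)) = c"
proof -
  have sc: "smooth_from {0..1} M c" and ext: "c \<in> extensional {0..1}" and c0: "c 0 = c0"
    using c by (simp_all add: Cinf_at_def Cinf_def)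
  let ?q = "\<theta> (curve_deriv M c)"
  note q = theta_curve_deriv[OF sc]
  let ?g = "Evol G X ?q"
  note g = Evol_solution[OF q(1,3)]
  have pts: "c t \<in> points M" if "t \<in> {0..1}" for t using smooth_from_points[OF M sc that] .
  have "?g t <# c0 = c t" if t: "t \<in> {0..1}" for t
  proof -
    have gt: "?g t \<in> carrier G" using smooth_from_carrier[OF _ t] g(1) unfolding solution_def by blast
    have "inv (?g t) <# c t = inv (?g 0) <# c 0"
    proof (rule solution_transport_const[OF g(1) q(3) sc])
      fix s :: real assume s: "s \<in> {0..1}"
      note v = has_velocity_velocity[OF M sc s]
      show "has_velocity M c (fundamental_field (c s) (?q s)) s {0..1}"
        using v fundamental_omega[OF pts[OF s] has_velocityD(1)[OF v]] q(2)[OF s] by simp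
    qed (use t at_within_unit_interval in auto)
    also have "\<dots> = c0" using act_one[of c0] pts[of 0] c0 g(2) by simp
    finally show ?thesis using act_inv'[OF gt pts[OF t]] by simp
  qed
  then show ?thesis
    unfolding rho_def by (intro extensionalityI[OF restrict_extensional ext]) simp
qed

lemma theta_nonzero:
  assumes c: "c \<in> Imm M" and t: "t \<in> {0..1}"
  shows "\<theta> (curve_deriv M c) t \<noteq> 0"
proof -
  have sc: "smooth_from {0..1} M c" using c by (simp add: Imm_def Cinf_def)
  have "velocity M c t \<noteq> 0" using c t by (simp add: Imm_def)
  then show ?thesis
    unfolding theta_curve_deriv(2)[OF sc t]
    by (rule omega_nonzero[OF smooth_from_points[OF M sc t] has_velocityD(1)[OF has_velocity_velocity[OF M sc t]]])
qed

lemma theta_Cinf_nonzero: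
  assumes c: "c \<in> Imm M"
  shows "\<theta> (curve_deriv M c) \<in> Cinf_nonzero (model X)"
proof -
  have sc: "smooth_from {0..1} M c" using c by (simp add: Imm_def Cinf_def)
  have "smooth_from {0..1} (vector_manifold (model X)) (\<theta> (curve_deriv M c))"
    by (rule smooth_from_vector[OF subspace_model[OF X] theta_curve_deriv(3,1)[OF sc]])
  moreover have "\<theta> (curve_deriv M c) \<in> extensional {0..1}" by (simp add: theta_def)
  ultimately show ?thesis using theta_nonzero[OF c] by (simp add: Cinf_nonzero_def Cinf_def)
qed

text \<open>At the identity the metric is one fixed bilinear form on a finite-dimensional space;
  extended to the whole type by the projection \<open>P\<close>, it is bounded bilinear and hence
  smooth.\<close>

lemma smooth_on_metric_square:
  assumes \<gamma>: "riemannian_metric X \<gamma>" and q: "smooth_on S q" "\<And>t. t \<in> S \<Longrightarrow> q t \<in> model X"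
  shows "smooth_on S (\<lambda>t. \<gamma> \<one> (q t) (q t))"
proof -
  have lin: "\<gamma> \<one> (a *\<^sub>R u + b *\<^sub>R v) w = a * \<gamma> \<one> u w + b * \<gamma> \<one> v w" and sym: "\<gamma> \<one> u v = \<gamma> \<one> v u"
    if "u \<in> model X" "v \<in> model X" "w \<in> model X" for a b u v w
    using \<gamma> one_points that unfolding riemannian_metric_def by blast+
  obtain P :: "'e \<Rightarrow> 'e" where P: "linear P" "\<And>x. P x \<in> model X" "\<And>x. x \<in> model X \<Longrightarrow> P x = x"
    using subspace_projection[OF subspace_model[OF X]] by metis
  let ?b = "\<lambda>u v. \<gamma> \<one> (P u) (P v)"
  have l: "linear (\<lambda>u. ?b u v)" for v
    \<comment> \<open>Coefficients \<open>1\<close> and \<open>1\<close> give additivity, a second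
      coefficient \<open>0\<close> gives homogeneity.\<close>
    using lin[OF P(2) P(2) P(2), of 1 _ 1] lin[OF P(2) P(2) P(2), of _ _ 0]
    by (intro linearI) (simp_all add: linear_add[OF P(1)] linear_cmul[OF P(1)])
  moreover have "linear (\<lambda>v. ?b u v)" for u
  proof -
    have "(\<lambda>v. ?b u v) = (\<lambda>v. ?b v u)" by (rule ext) (rule sym[OF P(2) P(2) P(2)])
    then show ?thesis using l[of u] by simp
  qed
  ultimately have "bounded_bilinear ?b" by (simp add: bilinear_conv_bounded_bilinear[symmetric] bilinear_def)
  from smooth_on_bilinear[OF this q(1) q(1)] show ?thesis
    by (rule smooth_on_cong[THEN iffD1, rotated]) (simp add: q(2) P(3))
qed

lemma srvt_Cinf_nonzero:
  assumes \<gamma>: "riemannian_metric X \<gamma>" and c: "c \<in> Imm M"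
  shows "srvt G \<gamma> M \<theta> c \<in> Cinf_nonzero (model X)"
proof -
  let ?q = "\<theta> (curve_deriv M c)"
  have sc: "smooth_from {0..1} M c" using c by (simp add: Imm_def Cinf_def)
  note q = theta_curve_deriv[OF sc]
  define b where "b t = \<gamma> \<one> (?q t) (?q t)" for t
  have b: "b t > 0" if "t \<in> {0..1}" for t
    using \<gamma> one_points q(3)[OF that] theta_nonzero[OF c that] unfolding riemannian_metric_def b_def by blast
  have "smooth_on {0..1} b"
    unfolding b_def by (rule smooth_on_metric_square[OF \<gamma> q(1,3)])
  \<comment> \<open>The norm is \<open>sqrt b\<close>, so division by its square root is
    multiplication by \<open>b powr (-1/4)\<close>, smooth because \<open>b\<close> is
    positive.\<close>
  then have "smooth_on {0..1} (\<lambda>t. b t powr (-1/4))"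
    by (rule smooth_on_compose[OF _ smooth_on_Ck[OF open_greaterThan Ck_on_powr]]) (use b in auto)
  then have "smooth_on {0..1} (\<lambda>t. (b t powr (-1/4)) *\<^sub>R ?q t)"
    by (rule smooth_on_bilinear[OF bounded_bilinear_scaleR _ q(1)])
  moreover have eq: "srvt G \<gamma> M \<theta> c t = (b t powr (-1/4)) *\<^sub>R ?q t" if t: "t \<in> {0..1}" for t
  proof -
    have "sqrt (sqrt (b t)) = b t powr (1/4)"
      using b[OF t] by (simp add: powr_half_sqrt[symmetric] powr_powr)
    then show ?thesis using t by (simp add: srvt_def lie_norm_def b_def powr_minus)
  qed
  ultimately have "smooth_on {0..1} (srvt G \<gamma> M \<theta> c)"
    using smooth_on_cong[of "{0..1}" "srvt G \<gamma> M \<theta> c"] by simp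
  moreover have "srvt G \<gamma> M \<theta> c t \<in> model X" "srvt G \<gamma> M \<theta> c t \<noteq> 0" if t: "t \<in> {0..1}" for t
    unfolding eq[OF t] using subspace_scale[OF subspace_model[OF X] q(3)[OF t]] b[OF t] theta_nonzero[OF c t]
    by auto
  ultimately show ?thesis
    using smooth_from_vector[OF subspace_model[OF X], of "{0..1}" "srvt G \<gamma> M \<theta> c"]
    by (simp add: Cinf_nonzero_def Cinf_def srvt_def)
qed

end

lemma reductiveI:
  assumes "homogeneous_space G X H M" "reductive_complement G X H \<mm>"
  shows "reductive G X H M \<mm>"
proof -
  have lie: "lie_group G X" and sub: "closed_lie_subgroup G X H" and M: "smooth_manifold M"
    and pts: "points M = lcosets\<^bsub>G\<^esub> H" and pr: "submersion X M (\<lambda>g. g <#\<^bsub>G\<^esub> H)"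
    using assms(1) by (simp_all add: homogeneous_space_def)
  interpret group G using lie by (simp add: lie_group_def)
  interpret subgroup H G using sub by (simp add: closed_lie_subgroup_def)
  show ?thesis
    by unfold_locales
      (use lie sub M pts pr assms(2) in
        \<open>simp_all add: lie_group_def closed_lie_subgroup_def submersion_def smooth_manifold_atlas\<close>)
qed

theorem proposition18:
  fixes G :: "('g, 'r) monoid_scheme"
    and X :: "('g, 'e::euclidean_space) manifold"
    and H :: "'g set"
    and M :: "('g set, 'f::euclidean_space) manifold"
    and \<mm> :: "'e set"
    and c0 :: "'g set"
    and \<gamma> :: "'g \<Rightarrow> 'e \<Rightarrow> 'e \<Rightarrow> real"
  assumes "homogeneous_space G X H M"
    and "reductive_complement G X H \<mm>"
    and "c0 \<in> lcosets\<^bsub>G\<^esub> H"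
    and "riemannian_metric X \<gamma>" and "right_invariant G X \<gamma>"
  shows "smooth_curve_operator (tangent_bundle M) (vector_manifold (model X)) (theta G X H M \<mm>) \<and>
    (\<forall>c \<in> Cinf_at M c0. rho G X c0 (theta G X H M \<mm> (curve_deriv M c)) = c) \<and>
    (theta G X H M \<mm> \<circ> curve_deriv M) ` (Imm M \<inter> Cinf_at M c0) \<subseteq> Cinf_nonzero (model X) \<and>
    srvt G \<gamma> M (theta G X H M \<mm>) \<in> Imm M \<rightarrow> Cinf_nonzero (model X)"
proof -
  interpret reductive G X H M \<mm> by (rule reductiveI[OF assms(1,2)])
  show ?thesis
    using theta_smooth rho_theta theta_Cinf_nonzero srvt_Cinf_nonzero[OF assms(4)] by auto
qed

end
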